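(* Assume that $(\Delta-1)\sigma\in L^1(\mathbb R^3)$; that $|\sigma(x)|\le Ce^{-\varepsilon|x|}$ for all $x\in\mathbb R^3$ with some $C,\varepsilon>0$; that $\Sigma(\theta)$ is positive definite for a.e. $\theta\in\Pi^*\setminus\Gamma^*$ (Wiener condition); and that $\hat\sigma(2\pi m)=0$ for all $m\in\mathbb Z^3\setminus\{0\}$ (Jellium condition). Let $Z\in\mathcal X_d^\perp$ be a finite linear combination of vectors of $\mathcal X^0(\mathbb R^3)$ whose Bloch transforms have the form $$\tilde Z(\theta)=P_l(\theta)D(\theta),\qquad D\in C_0^\infty(W,\mathcal X^0(\mathbb T)),$$ where $(W,\omega_l,P_l)$ are nonconstant analytic spectral branches (as defined in the context, possibly different for different terms). Then for any $\omega\in\mathbb R$ and any $\alpha<-7/2$ the resolvent $R_K(\omega\pm i\epsilon)=(K-\omega\mp i\epsilon)^{-1}$ has limits $$R_K(\omega\pm i\epsilon)Z\longrightarrow R_K(\omega\pm i0)Z\quad\text{in }\mathcal X_\alpha,\qquad \epsilon\to+0 .$$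
   Context: All spaces are complex. Fix constants $e>0$, $M>0$, a number $Z_0>0$ (the ion charge number), and a real function $\sigma\in L^1(\mathbb R^3)$ with $\int_{\mathbb R^3}\sigma\,dx=eZ_0$. Put $\hat\sigma(\xi)=\int e^{i\xi\cdot x}\sigma(x)\,dx$, $\Gamma^*=2\pi\mathbb Z^3$, $\Pi^*=[0,2\pi]^3$, $\Pi=[0,1]^3$, $\mathbb T=\mathbb R^3/\mathbb Z^3$, $\psi^0=\sqrt{Z_0}$, and $$\Sigma(\theta)=\sum_{m\in\mathbb Z^3}\Big[\frac{\xi\otimes\xi}{|\xi|^2}|\hat\sigma(\xi)|^2\Big]_{\xi=2\pi m+\theta},\qquad \Pi^*_+=\{\theta\in\Pi^*\setminus\Gamma^*:\Sigma(\theta)>0\},$$ where $\xi\otimes\xi=(\xi_i\xi_j)$. Let $\mathcal X^s(\mathbb T)=H^s(\mathbb T)\oplus H^s(\mathbb T)\oplus\mathbb C^3\oplus\mathbb C^3$ and $\mathcal X^0(\mathbb R^3)=L^2(\mathbb R^3)\oplus L^2(\mathbb R^3)\oplus\ell^2(\mathbb Z^3)\otimes\mathbb C^3\oplus\ell^2(\mathbb Z^3)\otimes\mathbb C^3$. For $\theta\in\Pi^*\setminus\Gamma^*$ let $$\tilde B(\theta)=\begin{pmatrix}2\tilde H^0(\theta)+4e^2\psi^0\tilde G(\theta)\psi^0&0&2\tilde S(\theta)&0\\0&2\tilde H^0(\theta)&0&0\\2\tilde S^*(\theta)&0&\tilde T(\theta)&0\\0&0&0&M^{-1}\end{pmatrix},\qquad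 J=\begin{pmatrix}0&\frac12&0&0\\-\frac12&0&0&0\\0&0&0&1\\0&0&-1&0\end{pmatrix},$$ with domain $\mathcal X^2(\mathbb T)$ in $\mathcal X^0(\mathbb T)$ for $\tilde B(\theta)$, where $\tilde H^0(\theta)=\frac12(i\nabla+\theta)^2$, $\tilde G(\theta)=(i\nabla+\theta)^{-2}$, $\tilde S(\theta)q=e\psi^0\tilde G(\theta)[(\nabla-i\theta)\tilde\sigma(\theta,\cdot)\cdot q]$ for $q\in\mathbb C^3$, $\tilde\sigma(\theta,y)=\sum_{n\in\mathbb Z^3}e^{i\theta\cdot(n+y)}\sigma(n+y)$, $\tilde T(\theta)=\Sigma(\theta)$. Under the stated conditions $\tilde B(\theta)$ is selfadjoint and nonnegative, and positive definite for $\theta\in\Pi^*_+$. Put $\tilde\Lambda(\theta)=\tilde B(\theta)^{1/2}$ and $\tilde K(\theta)=\tilde\Lambda(\theta)\,iJ\,\tilde\Lambda(\theta)$; for $\theta\in\Pi^*_+$ this is a selfadjoint operator in $\mathcal X^0(\mathbb T)$ with compact inverse. The Bloch transform $\mathcal F:Y=(\Psi_1,\Psi_2,q,p)\mapsto\tilde Y(\theta)=(\tilde\Psi_1(\theta,\cdot),\tilde\Psi_2(\theta,\cdot),\hat q(\theta),\hat p(\theta))$, $\tilde\Psi_j(\theta,y)=\sum_n e^{i\theta\cdot(n+y)}\Psi_j(n+y)$, $\hat q(\theta)=\sum_n e^{i\theta\cdot n}q(n)$, similarly $\hat p$, is an isomorphism $\mathcal X^0(\mathbb R^3)\to L^2(\Pi^*,\mathcal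 X^0(\mathbb T))$. $K=\mathcal F^{-1}\tilde K\mathcal F$, where $\tilde K$ is multiplication by $\tilde K(\theta)$ (defined for a.e. $\theta$) on its maximal domain in $L^2(\Pi^*,\mathcal X^0(\mathbb T))$; $K$ is selfadjoint. $\mathcal X_d$ is the closed subspace of $\mathcal X^0(\mathbb R^3)$ spanned by the eigenvectors of $K$. A nonconstant analytic spectral branch is a triple $(W,\omega_l,P_l)$ with $W\subset\Pi^*_+$ open, $\omega_l:W\to\mathbb R$ real-analytic with $\omega_l(\theta)$ an eigenvalue of $\tilde K(\theta)$ and $\nabla\omega_l(\theta)\ne0$ for all $\theta\in W$, and $P_l(\theta)$ the orthogonal projection onto the corresponding eigenspace, real-analytic in $\theta\in W$. Off $W$, $\tilde Z(\theta)=P_l(\theta)D(\theta)$ is extended by zero. Weighted spaces: for $Y=(\Psi_1,\Psi_2,q,p)$ and $n\in\mathbb Z^3$ let $Y(n)=(\Psi_1(n+\cdot)|_\Pi,\Psi_2(n+\cdot)|_\Pi,q(n),p(n))\in\mathcal X^0(\Pi)=L^2(\Pi)\oplus L^2(\Pi)\oplus\mathbb C^3\oplus\mathbb C^3$. $\mathcal X_\alpha$ is the Hilbert space with norm $\big(\sum_{n\in\mathbb Z^3}(1+|n|)^{2\alpha}\|Y(n)\|^2_{\mathcal X^0(\Pi)}\big)^{1/2}$. *)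

theory Defs
  imports "HOL-Analysis.Analysis"
begin

section \<open>Complex inner product spaces\<close>

class complex_inner = real_inner +
  fixes scaleC :: "complex \<Rightarrow> 'a \<Rightarrow> 'a"  (infixr \<open>*\<^sub>C\<close> 75)
  assumes scaleC_add_right: "c *\<^sub>C (x + y) = c *\<^sub>C x + c *\<^sub>C y"
    and scaleC_add_left: "(c + d) *\<^sub>C x = c *\<^sub>C x + d *\<^sub>C x"
    and scaleC_scaleC: "c *\<^sub>C d *\<^sub>C x = (c * d) *\<^sub>C x"
    and scaleC_of_real: "complex_of_real r *\<^sub>C x = r *\<^sub>R x"
    and inner_imaginary: "(\<i> *\<^sub>C x) \<bullet> (\<i> *\<^sub>C y) = x \<bullet> y"

text \<open>The complex inner product, antilinear in its first argument. Its real part is the library's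
  real inner product, which determines it.\<close>

definition cinner :: "'a::complex_inner \<Rightarrow> 'a \<Rightarrow> complex" where
  "cinner x y = Complex (x \<bullet> y) ((\<i> *\<^sub>C x) \<bullet> y)"

instantiation complex :: complex_inner
begin
definition scaleC_complex :: "complex \<Rightarrow> complex \<Rightarrow> complex" where
  "scaleC_complex c x = c * x"
instance
  by standard (auto simp: scaleC_complex_def algebra_simps scaleR_conv_of_real inner_complex_def)
end

instantiation vec :: (complex_inner, finite) complex_inner
begin
definition scaleC_vec :: "complex \<Rightarrow> 'a ^ 'b \<Rightarrow> 'a ^ 'b" where
  "scaleC_vec c x = (\<chi> i. c *\<^sub>C x $ i)"
instance
  by standard (auto simp: scaleC_vec_def vec_eq_iff inner_vec_def scaleC_add_right scaleC_add_left
      scaleC_scaleC scaleC_of_real inner_imaginary)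
end

instantiation prod :: (complex_inner, complex_inner) complex_inner
begin
definition scaleC_prod :: "complex \<Rightarrow> 'a \<times> 'b \<Rightarrow> 'a \<times> 'b" where
  "scaleC_prod c x = (c *\<^sub>C fst x, c *\<^sub>C snd x)"
instance
  by standard (auto simp: scaleC_prod_def scaleC_add_right scaleC_add_left
      scaleC_scaleC scaleC_of_real inner_imaginary prod_eq_iff)
end

lemma cinner_complex: "cinner x y = cnj x * y" for x y :: complex
  by (simp add: cinner_def scaleC_complex_def inner_complex_def complex_eq_iff)

lemma scaleC_diff_right: "c *\<^sub>C (x - y) = c *\<^sub>C x - c *\<^sub>C y" for x y :: "'a::complex_inner"
  by (metis add_diff_cancel diff_add_cancel scaleC_add_right)

lemma inner_scaleC_scaleC: "(c *\<^sub>C x) \<bullet> (c *\<^sub>C y) = (cmod c)\<^sup>2 * (x \<bullet> y)"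
  for x y :: "'a::complex_inner"
proof -
  have ii: "\<i> *\<^sub>C \<i> *\<^sub>C z = - z" for z :: 'a
    using scaleC_of_real[of "-1" z] by (simp add: scaleC_scaleC)
  have sk: "(\<i> *\<^sub>C u) \<bullet> v = - (u \<bullet> (\<i> *\<^sub>C v))" for u v :: 'a
    using inner_imaginary[of u "\<i> *\<^sub>C v"] by (simp add: ii)
  have dec: "c *\<^sub>C z = Re c *\<^sub>R z + Im c *\<^sub>R (\<i> *\<^sub>C z)" for z :: 'a
  proof -
    have "c *\<^sub>C z = (complex_of_real (Re c) + complex_of_real (Im c) * \<i>) *\<^sub>C z"
      by (rule arg_cong[of _ _ "\<lambda>c. c *\<^sub>C z"]) (simp add: complex_eq_iff)
    then show ?thesis
      by (metis scaleC_add_left scaleC_scaleC scaleC_of_real)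
  qed
  show ?thesis
    unfolding dec[of x] dec[of y]
    unfolding cmod_power2
    by (simp add: inner_add_left inner_add_right sk ii inner_imaginary power2_eq_square
        algebra_simps)
qed

lemma norm_scaleC: "norm (c *\<^sub>C x) = cmod c * norm x" for x :: "'a::complex_inner"
  by (simp add: norm_eq_sqrt_inner inner_scaleC_scaleC real_sqrt_mult)

section \<open>Spaces of square integrable functions\<close>

text \<open>The type \<open>('t, 'b) L2\<close> is the Hilbert space of almost everywhere classes of Bochner square
  integrable functions with values in \<open>'b\<close>; the tag type \<open>'t\<close> selects the underlying measure
  on $R^3$.\<close>

class measure_tag =
  fixes tag_measure :: "'a itself \<Rightarrow> (real^3) measure"

definition Z3 :: "(real^3) set" where
  "Z3 = {n. \<forall>i. n $ i \<in> \<int>}"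

definition Pi_cell :: "(real^3) set" where
  "Pi_cell = cbox 0 1"

definition Pi_star :: "(real^3) set" where
  "Pi_star = cbox 0 ((2 * pi) *\<^sub>R 1)"

datatype whole_space = Whole_Space
datatype torus = Torus
datatype integer_lattice = Integer_Lattice
datatype brillouin = Brillouin

instantiation whole_space :: measure_tag
begin
definition tag_measure_whole_space :: "whole_space itself \<Rightarrow> (real^3) measure" where
  "tag_measure_whole_space _ = lborel"
instance ..
end

text \<open>The torus $R^3/Z^3$ is identified with its fundamental cell.\<close>

instantiation torus :: measure_tag
begin
definition tag_measure_torus :: "torus itself \<Rightarrow> (real^3) measure" where
  "tag_measure_torus _ = restrict_space lborel Pi_cell"
instance ..
end

instantiation integer_lattice :: measure_tag
begin
definition tag_measure_integer_lattice :: "integer_lattice itself \<Rightarrow> (real^3) measure" where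
  "tag_measure_integer_lattice _ = count_space Z3"
instance ..
end

instantiation brillouin :: measure_tag
begin
definition tag_measure_brillouin :: "brillouin itself \<Rightarrow> (real^3) measure" where
  "tag_measure_brillouin _ = restrict_space lborel Pi_star"
instance ..
end

definition strongly_measurable :: "'a measure \<Rightarrow> ('a \<Rightarrow> 'b::topological_space) \<Rightarrow> bool" where
  "strongly_measurable M f \<longleftrightarrow>
    (\<exists>s. (\<forall>i::nat. simple_function M (s i)) \<and> (\<forall>x\<in>space M. (\<lambda>i. s i x) \<longlonglongrightarrow> f x))"

definition square_integrable :: "'a measure \<Rightarrow> ('a \<Rightarrow> 'b::real_normed_vector) \<Rightarrow> bool" where
  "square_integrable M f \<longleftrightarrow> strongly_measurable M f \<and> integrable M (\<lambda>x. (norm (f x))\<^sup>2)"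

lemma strongly_measurable_comp2:
  assumes "strongly_measurable M f" "strongly_measurable M g"
    and "\<And>s t a b. s \<longlonglongrightarrow> a \<Longrightarrow> t \<longlonglongrightarrow> b \<Longrightarrow> (\<lambda>i::nat. h (s i) (t i)) \<longlonglongrightarrow> h a b"
  shows "strongly_measurable M (\<lambda>x. h (f x) (g x))"
proof -
  from assms obtain s t where
    "\<forall>i::nat. simple_function M (s i)" "\<forall>x\<in>space M. (\<lambda>i. s i x) \<longlonglongrightarrow> f x"
    "\<forall>i::nat. simple_function M (t i)" "\<forall>x\<in>space M. (\<lambda>i. t i x) \<longlonglongrightarrow> g x"
    unfolding strongly_measurable_def by blast
  then show ?thesis
    unfolding strongly_measurable_def
    by (intro exI[of _ "\<lambda>i x. h (s i x) (t i x)"])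
      (auto intro: simple_function_compose2 assms(3))
qed

lemma strongly_measurable_comp:
  assumes "strongly_measurable M f"
    and "\<And>s a. s \<longlonglongrightarrow> a \<Longrightarrow> (\<lambda>i::nat. h (s i)) \<longlonglongrightarrow> h a"
  shows "strongly_measurable M (\<lambda>x. h (f x))"
  using strongly_measurable_comp2[OF assms(1) assms(1), of "\<lambda>a b. h a"] assms(2) by blast

lemma strongly_measurable_const: "strongly_measurable M (\<lambda>x. c)"
  unfolding strongly_measurable_def by (intro exI[of _ "\<lambda>_ _. c"]) auto

lemma strongly_measurable_imp_borel:
  fixes f :: "'a \<Rightarrow> 'b::metric_space"
  assumes "strongly_measurable M f"
  shows "f \<in> borel_measurable M"
proof -
  from assms obtain s where s: "\<And>i::nat. simple_function M (s i)"
    "\<And>x. x \<in> space M \<Longrightarrow> (\<lambda>i. s i x) \<longlonglongrightarrow> f x"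
    unfolding strongly_measurable_def by blast
  show ?thesis
    by (rule borel_measurable_LIMSEQ_metric[OF borel_measurable_simple_function s(2)]) (rule s(1))
qed

lemma square_integrable_inner:
  fixes f g :: "'a \<Rightarrow> 'b::real_inner"
  assumes "square_integrable M f" "square_integrable M g"
  shows "integrable M (\<lambda>x. f x \<bullet> g x)"
proof (rule Bochner_Integration.integrable_bound)
  show "integrable M (\<lambda>x. (norm (f x))\<^sup>2 + (norm (g x))\<^sup>2)"
    using assms by (simp add: square_integrable_def)
  show "(\<lambda>x. f x \<bullet> g x) \<in> borel_measurable M"
    using assms unfolding square_integrable_def
    by (intro strongly_measurable_imp_borel strongly_measurable_comp2[where h = "(\<bullet>)"] tendsto_inner) auto
  have "norm (f x \<bullet> g x) \<le> norm ((norm (f x))\<^sup>2 + (norm (g x))\<^sup>2)" for x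
  proof -
    have "\<bar>f x \<bullet> g x\<bar> \<le> norm (f x) * norm (g x)"
      by (rule Cauchy_Schwarz_ineq2)
    also have "\<dots> \<le> 2 * norm (f x) * norm (g x)"
      by simp
    also have "\<dots> \<le> (norm (f x))\<^sup>2 + (norm (g x))\<^sup>2"
      by (rule sum_squares_bound)
    finally show ?thesis by simp
  qed
  then show "AE x in M. norm (f x \<bullet> g x) \<le> norm ((norm (f x))\<^sup>2 + (norm (g x))\<^sup>2)"
    by simp
qed

lemma square_integrable_add:
  fixes f g :: "'a \<Rightarrow> 'b::real_inner"
  assumes "square_integrable M f" "square_integrable M g"
  shows "square_integrable M (\<lambda>x. f x + g x)"
proof -
  have "integrable M (\<lambda>x. (norm (f x))\<^sup>2 + (norm (g x))\<^sup>2 + 2 * (f x \<bullet> g x))"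
    using assms square_integrable_inner[OF assms] by (simp add: square_integrable_def)
  moreover have "(norm (f x + g x))\<^sup>2 = (norm (f x))\<^sup>2 + (norm (g x))\<^sup>2 + 2 * (f x \<bullet> g x)" for x
    by (simp add: power2_norm_eq_inner inner_add_left inner_add_right inner_commute)
  ultimately show ?thesis
    using assms unfolding square_integrable_def
    by (intro conjI strongly_measurable_comp2[where h = "(+)"] tendsto_add) auto
qed

lemma square_integrable_scaleR:
  fixes f :: "'a \<Rightarrow> 'b::real_inner"
  assumes "square_integrable M f"
  shows "square_integrable M (\<lambda>x. r *\<^sub>R f x)"
  using assms unfolding square_integrable_def
  by (intro conjI strongly_measurable_comp[where h = "(*\<^sub>R) r"] tendsto_scaleR)
    (auto simp: power_mult_distrib)

lemma square_integrable_zero: "square_integrable M (\<lambda>x. 0)"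
  by (simp add: square_integrable_def strongly_measurable_const)

lemma square_integrable_scaleC:
  fixes f :: "'a \<Rightarrow> 'b::complex_inner"
  assumes "square_integrable M f"
  shows "square_integrable M (\<lambda>x. c *\<^sub>C f x)"
proof -
  have "bounded_linear ((*\<^sub>C) c :: 'b \<Rightarrow> 'b)"
  proof (rule bounded_linear_intro)
    show "c *\<^sub>C (r *\<^sub>R x) = r *\<^sub>R c *\<^sub>C x" for r and x :: 'b
      by (metis scaleC_of_real scaleC_scaleC mult.commute)
    show "norm (c *\<^sub>C x) \<le> norm x * cmod c" for x :: 'b
      by (simp add: norm_scaleC mult.commute)
  qed (rule scaleC_add_right)
  then have "(\<lambda>i::nat. c *\<^sub>C s i) \<longlonglongrightarrow> c *\<^sub>C a" if "s \<longlonglongrightarrow> a" for s and a :: 'b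
    using that by (rule bounded_linear.tendsto)
  then show ?thesis
    using assms unfolding square_integrable_def
    by (intro conjI strongly_measurable_comp[where h = "(*\<^sub>C) c"])
      (auto simp: power_mult_distrib norm_scaleC)
qed

definition L2_class :: "'a measure \<Rightarrow> ('a \<Rightarrow> 'b::real_inner) \<Rightarrow> ('a \<Rightarrow> 'b) set" where
  "L2_class M f = {g. square_integrable M g \<and> (AE x in M. g x = f x)}"

typedef (overloaded) ('t::measure_tag, 'b::real_inner) L2 =
  "{L2_class (tag_measure TYPE('t)) f | f :: real^3 \<Rightarrow> 'b. square_integrable (tag_measure TYPE('t)) f}"
  using square_integrable_zero by blast

definition to_L2 :: "(real^3 \<Rightarrow> 'b) \<Rightarrow> ('t::measure_tag, 'b::real_inner) L2" where
  "to_L2 f = Abs_L2 (L2_class (tag_measure TYPE('t)) f)"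

definition fun_of_L2 :: "('t::measure_tag, 'b::real_inner) L2 \<Rightarrow> real^3 \<Rightarrow> 'b" where
  "fun_of_L2 F = (SOME f. f \<in> Rep_L2 F)"

lemma L2_class_self: "square_integrable M f \<Longrightarrow> f \<in> L2_class M f"
  by (simp add: L2_class_def)

lemma L2_class_cong: "AE x in M. f x = g x \<Longrightarrow> L2_class M f = L2_class M g"
  unfolding L2_class_def by (auto elim: eventually_elim2)

lemma fun_of_L2_in_Rep: "fun_of_L2 F \<in> Rep_L2 F"
  for F :: "('t::measure_tag, 'b::real_inner) L2"
proof -
  obtain f where "Rep_L2 F = L2_class (tag_measure TYPE('t)) f"
      "square_integrable (tag_measure TYPE('t)) f"
    using Rep_L2[of F] by auto
  then show ?thesis
    unfolding fun_of_L2_def by (metis L2_class_self someI)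
qed

lemma square_integrable_fun_of_L2:
  "square_integrable (tag_measure TYPE('t)) (fun_of_L2 (F :: ('t::measure_tag, 'b::real_inner) L2))"
  using fun_of_L2_in_Rep[of F] Rep_L2[of F] by (auto simp: L2_class_def)

lemma to_L2_fun_of_L2: "to_L2 (fun_of_L2 F) = F"
  for F :: "('t::measure_tag, 'b::real_inner) L2"
proof -
  obtain f where f: "Rep_L2 F = L2_class (tag_measure TYPE('t)) f"
    using Rep_L2[of F] by auto
  then have "AE x in tag_measure TYPE('t). fun_of_L2 F x = f x"
    using fun_of_L2_in_Rep[of F] by (simp add: L2_class_def)
  then have "L2_class (tag_measure TYPE('t)) (fun_of_L2 F) = Rep_L2 F"
    unfolding f by (rule L2_class_cong)
  then show ?thesis
    by (simp add: to_L2_def Rep_L2_inverse)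
qed

lemma fun_of_L2_to_L2:
  assumes "square_integrable (tag_measure TYPE('t::measure_tag)) f"
  shows "AE x in tag_measure TYPE('t). fun_of_L2 (to_L2 f :: ('t, 'b::real_inner) L2) x = f x"
proof -
  have "Rep_L2 (to_L2 f :: ('t, 'b) L2) = L2_class (tag_measure TYPE('t)) f"
    unfolding to_L2_def using assms by (intro Abs_L2_inverse) auto
  then show ?thesis
    using fun_of_L2_in_Rep[of "to_L2 f :: ('t, 'b) L2"] by (simp add: L2_class_def)
qed

lemma to_L2_cong:
  "AE x in tag_measure TYPE('t::measure_tag). f x = g x \<Longrightarrow>
    (to_L2 f :: ('t, 'b::real_inner) L2) = to_L2 g"
  unfolding to_L2_def by (simp add: L2_class_cong)

lemma L2_eqI:
  assumes "AE x in tag_measure TYPE('t). fun_of_L2 F x = fun_of_L2 G x"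
  shows "F = (G :: ('t::measure_tag, 'b::real_inner) L2)"
  using to_L2_cong[OF assms] by (simp add: to_L2_fun_of_L2)

instantiation L2 :: (measure_tag, real_inner) real_inner
begin

definition zero_L2 :: "('a, 'b) L2" where
  "zero_L2 = to_L2 (\<lambda>_. 0)"

definition plus_L2 :: "('a, 'b) L2 \<Rightarrow> ('a, 'b) L2 \<Rightarrow> ('a, 'b) L2" where
  "plus_L2 F G = to_L2 (\<lambda>x. fun_of_L2 F x + fun_of_L2 G x)"

definition scaleR_L2 :: "real \<Rightarrow> ('a, 'b) L2 \<Rightarrow> ('a, 'b) L2" where
  "scaleR_L2 r F = to_L2 (\<lambda>x. r *\<^sub>R fun_of_L2 F x)"

definition uminus_L2 :: "('a, 'b) L2 \<Rightarrow> ('a, 'b) L2" where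
  "uminus_L2 F = (-1) *\<^sub>R F"

definition minus_L2 :: "('a, 'b) L2 \<Rightarrow> ('a, 'b) L2 \<Rightarrow> ('a, 'b) L2" where
  "minus_L2 F G = F + - G"

definition inner_L2 :: "('a, 'b) L2 \<Rightarrow> ('a, 'b) L2 \<Rightarrow> real" where
  "inner_L2 F G = (\<integral>x. fun_of_L2 F x \<bullet> fun_of_L2 G x \<partial>tag_measure TYPE('a))"

definition norm_L2 :: "('a, 'b) L2 \<Rightarrow> real" where
  "norm_L2 F = sqrt (F \<bullet> F)"

definition sgn_L2 :: "('a, 'b) L2 \<Rightarrow> ('a, 'b) L2" where
  "sgn_L2 F = inverse (norm F) *\<^sub>R F"

definition dist_L2 :: "('a, 'b) L2 \<Rightarrow> ('a, 'b) L2 \<Rightarrow> real" where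
  "dist_L2 F G = norm (F - G)"

definition uniformity_L2 :: "(('a, 'b) L2 \<times> ('a, 'b) L2) filter" where
  "uniformity_L2 = (INF e\<in>{0<..}. principal {(F, G). dist F G < e})"

definition open_L2 :: "('a, 'b) L2 set \<Rightarrow> bool" where
  "open_L2 U \<longleftrightarrow> (\<forall>F\<in>U. eventually (\<lambda>(F', G). F' = F \<longrightarrow> G \<in> U) uniformity)"

lemma fun_of_L2_plus:
  fixes F G :: "('a, 'b) L2"
  shows "AE x in tag_measure TYPE('a). fun_of_L2 (F + G) x = fun_of_L2 F x + fun_of_L2 G x"
  unfolding plus_L2_def
  by (intro fun_of_L2_to_L2 square_integrable_add square_integrable_fun_of_L2)

lemma fun_of_L2_scaleR:
  fixes F :: "('a, 'b) L2"
  shows "AE x in tag_measure TYPE('a). fun_of_L2 (r *\<^sub>R F) x = r *\<^sub>R fun_of_L2 F x"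
  unfolding scaleR_L2_def
  by (intro fun_of_L2_to_L2 square_integrable_scaleR square_integrable_fun_of_L2)

lemma fun_of_L2_zero: "AE x in tag_measure TYPE('a). fun_of_L2 (0 :: ('a, 'b) L2) x = 0"
  unfolding zero_L2_def by (intro fun_of_L2_to_L2 square_integrable_zero)

instance
proof
  fix F G H :: "('a, 'b) L2" and r s :: real
  let ?M = "tag_measure TYPE('a)"
  show "F + G + H = F + (G + H)"
    apply (rule L2_eqI)
    using fun_of_L2_plus[of "F + G" H] fun_of_L2_plus[of F G]
      fun_of_L2_plus[of F "G + H"] fun_of_L2_plus[of G H]
    by eventually_elim simp
  show "F + G = G + F"
    by (simp add: plus_L2_def add.commute)
  show zero: "0 + F = F"
    apply (rule L2_eqI)
    using fun_of_L2_plus[of 0 F] fun_of_L2_zero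
    by eventually_elim simp
  show "- F + F = 0"
    unfolding uminus_L2_def apply (rule L2_eqI)
    using fun_of_L2_plus[of "-1 *\<^sub>R F" F] fun_of_L2_scaleR[of "-1" F] fun_of_L2_zero
    by eventually_elim simp
  show "F - G = F + - G"
    by (simp add: minus_L2_def)
  show "r *\<^sub>R (F + G) = r *\<^sub>R F + r *\<^sub>R G"
    apply (rule L2_eqI)
    using fun_of_L2_plus[of F G] fun_of_L2_plus[of "r *\<^sub>R F" "r *\<^sub>R G"]
      fun_of_L2_scaleR[of r F] fun_of_L2_scaleR[of r G] fun_of_L2_scaleR[of r "F + G"]
    by eventually_elim (simp add: algebra_simps)
  show "(r + s) *\<^sub>R F = r *\<^sub>R F + s *\<^sub>R F"
    apply (rule L2_eqI)
    using fun_of_L2_plus[of "r *\<^sub>R F" "s *\<^sub>R F"]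
      fun_of_L2_scaleR[of r F] fun_of_L2_scaleR[of s F] fun_of_L2_scaleR[of "r + s" F]
    by eventually_elim (simp add: algebra_simps)
  show "r *\<^sub>R s *\<^sub>R F = (r * s) *\<^sub>R F"
    apply (rule L2_eqI)
    using fun_of_L2_scaleR[of r "s *\<^sub>R F"] fun_of_L2_scaleR[of s F]
      fun_of_L2_scaleR[of "r * s" F]
    by eventually_elim simp
  show "1 *\<^sub>R F = F"
    by (simp add: scaleR_L2_def to_L2_fun_of_L2)
  show "dist F G = norm (F - G)"
    by (simp add: dist_L2_def)
  show "sgn F = inverse (norm F) *\<^sub>R F"
    by (simp add: sgn_L2_def)
  show "norm F = sqrt (F \<bullet> F)"
    by (simp add: norm_L2_def)
  show "uniformity = (INF e\<in>{0<..}. principal {(F, G :: ('a, 'b) L2). dist F G < e})"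
    by (rule uniformity_L2_def)
  show "open U \<longleftrightarrow> (\<forall>F\<in>U. \<forall>\<^sub>F (F', G) in uniformity. F' = F \<longrightarrow> G \<in> U)"
    for U :: "('a, 'b) L2 set"
    by (rule open_L2_def)
  show "F \<bullet> G = G \<bullet> F"
    by (simp add: inner_L2_def inner_commute)
  note int = square_integrable_inner[OF square_integrable_fun_of_L2 square_integrable_fun_of_L2]
  have "(F + G) \<bullet> H = (\<integral>x. fun_of_L2 F x \<bullet> fun_of_L2 H x + fun_of_L2 G x \<bullet> fun_of_L2 H x \<partial>?M)"
    unfolding inner_L2_def
  proof (rule integral_cong_AE)
    show "AE x in ?M. fun_of_L2 (F + G) x \<bullet> fun_of_L2 H x
        = fun_of_L2 F x \<bullet> fun_of_L2 H x + fun_of_L2 G x \<bullet> fun_of_L2 H x"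
      using fun_of_L2_plus[of F G] by eventually_elim (simp add: inner_add_left)
    show "(\<lambda>x. fun_of_L2 (F + G) x \<bullet> fun_of_L2 H x) \<in> borel_measurable ?M"
      by (rule borel_measurable_integrable[OF int])
    show "(\<lambda>x. fun_of_L2 F x \<bullet> fun_of_L2 H x + fun_of_L2 G x \<bullet> fun_of_L2 H x)
        \<in> borel_measurable ?M"
      by (rule borel_measurable_integrable[OF Bochner_Integration.integrable_add[OF int int]])
  qed
  also have "\<dots> = F \<bullet> H + G \<bullet> H"
    unfolding inner_L2_def by (rule Bochner_Integration.integral_add[OF int int])
  finally show "(F + G) \<bullet> H = F \<bullet> H + G \<bullet> H" .
  have "(r *\<^sub>R F) \<bullet> G = (\<integral>x. r * (fun_of_L2 F x \<bullet> fun_of_L2 G x) \<partial>?M)"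
    unfolding inner_L2_def
  proof (rule integral_cong_AE)
    show "AE x in ?M. fun_of_L2 (r *\<^sub>R F) x \<bullet> fun_of_L2 G x
        = r * (fun_of_L2 F x \<bullet> fun_of_L2 G x)"
      using fun_of_L2_scaleR[of r F] by eventually_elim simp
    show "(\<lambda>x. fun_of_L2 (r *\<^sub>R F) x \<bullet> fun_of_L2 G x) \<in> borel_measurable ?M"
      by (rule borel_measurable_integrable[OF int])
    show "(\<lambda>x. r * (fun_of_L2 F x \<bullet> fun_of_L2 G x)) \<in> borel_measurable ?M"
      by (rule borel_measurable_integrable[OF integrable_mult_right[OF int]])
  qed
  then show "(r *\<^sub>R F) \<bullet> G = r * (F \<bullet> G)"
    by (simp add: inner_L2_def)
  show "0 \<le> F \<bullet> F"
    by (simp add: inner_L2_def)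
  have "F \<bullet> F = 0 \<longleftrightarrow> (AE x in ?M. fun_of_L2 F x \<bullet> fun_of_L2 F x = 0)"
    unfolding inner_L2_def by (rule integral_nonneg_eq_0_iff_AE[OF int]) simp
  also have "\<dots> \<longleftrightarrow> (AE x in ?M. fun_of_L2 F x = 0)"
    by simp
  also have "\<dots> \<longleftrightarrow> F = 0"
  proof
    assume "AE x in ?M. fun_of_L2 F x = 0"
    with fun_of_L2_zero have "AE x in ?M. fun_of_L2 F x = fun_of_L2 (0 :: ('a, 'b) L2) x"
      by eventually_elim simp
    then show "F = 0" by (rule L2_eqI)
  qed (use fun_of_L2_zero in simp)
  finally show "F \<bullet> F = 0 \<longleftrightarrow> F = 0" .
qed

end

instantiation L2 :: (measure_tag, complex_inner) complex_inner
begin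

definition scaleC_L2 :: "complex \<Rightarrow> ('a, 'b) L2 \<Rightarrow> ('a, 'b) L2" where
  "scaleC_L2 c F = to_L2 (\<lambda>x. c *\<^sub>C fun_of_L2 F x)"

lemma fun_of_L2_scaleC:
  fixes F :: "('a, 'b) L2"
  shows "AE x in tag_measure TYPE('a). fun_of_L2 (c *\<^sub>C F) x = c *\<^sub>C fun_of_L2 F x"
  unfolding scaleC_L2_def
  by (intro fun_of_L2_to_L2 square_integrable_scaleC square_integrable_fun_of_L2)

instance
proof
  fix F G :: "('a, 'b) L2" and c d :: complex and r :: real
  let ?M = "tag_measure TYPE('a)"
  show "c *\<^sub>C (F + G) = c *\<^sub>C F + c *\<^sub>C G"
    apply (rule L2_eqI)
    using fun_of_L2_plus[of F G] fun_of_L2_plus[of "c *\<^sub>C F" "c *\<^sub>C G"]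
      fun_of_L2_scaleC[of c F] fun_of_L2_scaleC[of c G] fun_of_L2_scaleC[of c "F + G"]
    by eventually_elim (simp add: scaleC_add_right)
  show "(c + d) *\<^sub>C F = c *\<^sub>C F + d *\<^sub>C F"
    apply (rule L2_eqI)
    using fun_of_L2_plus[of "c *\<^sub>C F" "d *\<^sub>C F"]
      fun_of_L2_scaleC[of c F] fun_of_L2_scaleC[of d F] fun_of_L2_scaleC[of "c + d" F]
    by eventually_elim (simp add: scaleC_add_left)
  show "c *\<^sub>C d *\<^sub>C F = (c * d) *\<^sub>C F"
    apply (rule L2_eqI)
    using fun_of_L2_scaleC[of c "d *\<^sub>C F"] fun_of_L2_scaleC[of d F]
      fun_of_L2_scaleC[of "c * d" F]
    by eventually_elim (simp add: scaleC_scaleC)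
  show "complex_of_real r *\<^sub>C F = r *\<^sub>R F"
    by (simp add: scaleC_L2_def scaleR_L2_def scaleC_of_real)
  note int = square_integrable_inner[OF square_integrable_fun_of_L2 square_integrable_fun_of_L2]
  show "(\<i> *\<^sub>C F) \<bullet> (\<i> *\<^sub>C G) = F \<bullet> G"
    unfolding inner_L2_def
  proof (rule integral_cong_AE)
    show "AE x in ?M. fun_of_L2 (\<i> *\<^sub>C F) x \<bullet> fun_of_L2 (\<i> *\<^sub>C G) x
        = fun_of_L2 F x \<bullet> fun_of_L2 G x"
      using fun_of_L2_scaleC[of \<i> F] fun_of_L2_scaleC[of \<i> G]
      by eventually_elim (simp add: inner_imaginary)
  qed (rule borel_measurable_integrable[OF int])+
qed

end

type_synonym L2_T = "(torus, complex) L2"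

text \<open>$X^0(T)$; the norm of a product type is the Hilbert direct sum norm.\<close>

type_synonym X0_T = "L2_T \<times> L2_T \<times> (complex^3) \<times> (complex^3)"

type_synonym X0_R3 =
  "(whole_space, complex) L2 \<times> (whole_space, complex) L2 \<times>
   (integer_lattice, complex^3) L2 \<times> (integer_lattice, complex^3) L2"

section \<open>Unbounded linear operators\<close>

text \<open>Operators are represented by their graphs; thus \<open>R O S\<close> applies \<open>R\<close> first.\<close>

definition graph_of :: "('a \<Rightarrow> 'b) \<Rightarrow> ('a \<times> 'b) set" where
  "graph_of f = {(x, f x) | x. True}"

definition adjoint_op :: "('a::complex_inner \<times> 'a) set \<Rightarrow> ('a \<times> 'a) set" where
  "adjoint_op R = {(x, y). \<forall>(u, v)\<in>R. cinner v x = cinner u y}"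

definition selfadjoint :: "('a::complex_inner \<times> 'a) set \<Rightarrow> bool" where
  "selfadjoint R \<longleftrightarrow> closure (Domain R) = UNIV \<and> adjoint_op R = R"

definition nonneg_op :: "('a::complex_inner \<times> 'a) set \<Rightarrow> bool" where
  "nonneg_op R \<longleftrightarrow> (\<forall>(x, y)\<in>R. cinner x y \<in> \<real> \<and> 0 \<le> Re (cinner x y))"

definition is_sqrt_op :: "('a::complex_inner \<times> 'a) set \<Rightarrow> ('a \<times> 'a) set \<Rightarrow> bool" where
  "is_sqrt_op R S \<longleftrightarrow> selfadjoint S \<and> nonneg_op S \<and> S O S = R"

text \<open>A nonnegative selfadjoint operator has exactly one nonnegative selfadjoint square root;
  the empty graph is a dummy value for other operators.\<close>

definition sqrt_op :: "('a::complex_inner \<times> 'a) set \<Rightarrow> ('a \<times> 'a) set" where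
  "sqrt_op R = (if \<exists>!S. is_sqrt_op R S then THE S. is_sqrt_op R S else {})"

definition eigenspace :: "('a::complex_inner \<times> 'a) set \<Rightarrow> complex \<Rightarrow> 'a set" where
  "eigenspace R z = {x. (x, z *\<^sub>C x) \<in> R}"

definition eigenvalue :: "('a::complex_inner \<times> 'a) set \<Rightarrow> complex \<Rightarrow> bool" where
  "eigenvalue R z \<longleftrightarrow> (\<exists>x\<in>eigenspace R z. x \<noteq> 0)"

definition orthogonal_projection :: "('a::complex_inner \<Rightarrow>\<^sub>L 'a) \<Rightarrow> 'a set \<Rightarrow> bool" where
  "orthogonal_projection P V \<longleftrightarrow>
    (\<forall>x. blinfun_apply P x \<in> V \<and> (\<forall>v\<in>V. cinner v (x - blinfun_apply P x) = 0))"

text \<open>\<open>(R - z)\<^sup>-\<^sup>1 Z\<close>\<close>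

definition resolvent :: "('a::complex_inner \<times> 'a) set \<Rightarrow> complex \<Rightarrow> 'a \<Rightarrow> 'a" where
  "resolvent R z Z = (THE Y. \<exists>V. (Y, V) \<in> R \<and> V - z *\<^sub>C Y = Z)"

definition cspan :: "'a::complex_inner set \<Rightarrow> 'a set" where
  "cspan S = {\<Sum>x\<in>A. c x *\<^sub>C x | A c. finite A \<and> A \<subseteq> S}"

definition discrete_subspace :: "('a::complex_inner \<times> 'a) set \<Rightarrow> 'a set" where
  "discrete_subspace R = closure (cspan {x. x \<noteq> 0 \<and> (\<exists>z. x \<in> eigenspace R z)})"

definition orth_compl :: "'a::complex_inner set \<Rightarrow> 'a set" where
  "orth_compl V = {x. \<forall>v\<in>V. cinner v x = 0}"

section \<open>Smooth and real-analytic functions\<close>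

primrec C_k :: "nat \<Rightarrow> ('a::real_normed_vector \<Rightarrow> 'b::real_normed_vector) \<Rightarrow> bool" where
  "C_k 0 f \<longleftrightarrow> continuous_on UNIV f"
| "C_k (Suc k) f \<longleftrightarrow>
    (\<forall>x. f differentiable at x) \<and> (\<forall>h. C_k k (\<lambda>x. frechet_derivative f (at x) h))"

definition test_functions :: "(real^3) set \<Rightarrow> (real^3 \<Rightarrow> 'b::real_normed_vector) set" where
  "test_functions W =
    {f. (\<forall>k. C_k k f) \<and> compact (closure {x. f x \<noteq> 0}) \<and> closure {x. f x \<noteq> 0} \<subseteq> W}"

definition partial :: "3 \<Rightarrow> (real^3 \<Rightarrow> 'b::real_normed_vector) \<Rightarrow> real^3 \<Rightarrow> 'b" where
  "partial i f x = frechet_derivative f (at x) (axis i 1)"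

definition gradient :: "(real^3 \<Rightarrow> real) \<Rightarrow> real^3 \<Rightarrow> real^3" where
  "gradient f x = (\<chi> i. partial i f x)"

definition laplacian :: "(real^3 \<Rightarrow> real) \<Rightarrow> real^3 \<Rightarrow> real" where
  "laplacian f x = (\<Sum>i\<in>UNIV. partial i (partial i f) x)"

text \<open>Local expansion in a multivariate power series; \<open>k\<close> runs over the multi-indices.\<close>

definition real_analytic_on :: "(real^3 \<Rightarrow> 'b::real_normed_vector) \<Rightarrow> (real^3) set \<Rightarrow> bool" where
  "real_analytic_on f W \<longleftrightarrow>
    (\<forall>a\<in>W. \<exists>r>0. \<exists>c :: nat^3 \<Rightarrow> 'b. \<forall>x\<in>ball a r.
      ((\<lambda>k. (\<Prod>i\<in>UNIV. (x $ i - a $ i) ^ (k $ i)) *\<^sub>R c k) has_sum f x) UNIV)"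

section \<open>The ion charge density\<close>

text \<open>\<open>(\<Delta> - 1) \<sigma> \<in> L\<^sup>1\<close> in the sense of distributions.\<close>

definition laplace_minus_one_L1 :: "(real^3 \<Rightarrow> real) \<Rightarrow> bool" where
  "laplace_minus_one_L1 \<sigma> \<longleftrightarrow>
    (\<exists>h. integrable lebesgue h \<and>
      (\<forall>\<phi>\<in>test_functions UNIV.
        (\<integral>x. \<sigma> x * (laplacian \<phi> x - \<phi> x) \<partial>lebesgue) = (\<integral>x. h x * \<phi> x \<partial>lebesgue)))"

definition fourier :: "(real^3 \<Rightarrow> real) \<Rightarrow> real^3 \<Rightarrow> complex" where
  "fourier \<sigma> \<xi> = (\<integral>x. cis (\<xi> \<bullet> x) * complex_of_real (\<sigma> x) \<partial>lebesgue)"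

definition Gamma_star :: "(real^3) set" where
  "Gamma_star = {(2 * pi) *\<^sub>R m | m. m \<in> Z3}"

definition Sigma_mat :: "(real^3 \<Rightarrow> real) \<Rightarrow> real^3 \<Rightarrow> real^3^3" where
  "Sigma_mat \<sigma> \<theta> = (\<Sum>\<^sub>\<infinity>m\<in>Z3. let \<xi> = (2 * pi) *\<^sub>R m + \<theta> in
    ((cmod (fourier \<sigma> \<xi>))\<^sup>2 / (norm \<xi>)\<^sup>2) *\<^sub>R (\<chi> i j. \<xi> $ i * \<xi> $ j))"

definition pos_def :: "real^'n^'n \<Rightarrow> bool" where
  "pos_def A \<longleftrightarrow> (\<forall>v. v \<noteq> 0 \<longrightarrow> 0 < v \<bullet> (A *v v))"

definition Pi_star_plus :: "(real^3 \<Rightarrow> real) \<Rightarrow> (real^3) set" where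
  "Pi_star_plus \<sigma> = {\<theta> \<in> Pi_star - Gamma_star. pos_def (Sigma_mat \<sigma> \<theta>)}"

section \<open>The Bloch generators\<close>

text \<open>Functions and distributions \<open>f\<close> on the torus are expanded as
  $f(y)=\sum_{m\in Z^3} c(m)e^{-2\pi i m\cdot y}$, so that differential operators act on the coefficients
  \<open>c\<close> as multipliers. With this sign \<open>i\<nabla> + \<theta>\<close> multiplies \<open>c m\<close> by \<open>2\<pi>m + \<theta>\<close>,
  and \<open>\<nabla> - i\<theta> = - i (i\<nabla> + \<theta>)\<close>. For \<open>\<theta> \<notin> \<Gamma>\<^sup>*\<close> no multiplier \<open>2\<pi>m + \<theta>\<close> vanishes.\<close>

definition fcoeff :: "(real^3 \<Rightarrow> complex) \<Rightarrow> real^3 \<Rightarrow> complex" where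
  "fcoeff f m = (\<integral>y\<in>Pi_cell. cis (2 * pi * (m \<bullet> y)) * f y \<partial>lebesgue)"

definition of_fcoeff :: "(real^3 \<Rightarrow> complex) \<Rightarrow> L2_T" where
  "of_fcoeff c = (THE f. \<forall>m\<in>Z3. fcoeff (fun_of_L2 f) m = c m)"

definition mom :: "real^3 \<Rightarrow> 3 \<Rightarrow> (real^3 \<Rightarrow> complex) \<Rightarrow> real^3 \<Rightarrow> complex" where
  "mom \<theta> j c m = complex_of_real (((2 * pi) *\<^sub>R m + \<theta>) $ j) * c m"

definition mom_sq :: "real^3 \<Rightarrow> (real^3 \<Rightarrow> complex) \<Rightarrow> real^3 \<Rightarrow> complex" where
  "mom_sq \<theta> c m = (\<Sum>j\<in>UNIV. mom \<theta> j (mom \<theta> j c) m)"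

definition green :: "real^3 \<Rightarrow> (real^3 \<Rightarrow> complex) \<Rightarrow> real^3 \<Rightarrow> complex" where
  "green \<theta> c m = c m / complex_of_real ((norm ((2 * pi) *\<^sub>R m + \<theta>))\<^sup>2)"

definition H2_T :: "L2_T set" where
  "H2_T = {f. (\<lambda>m. (1 + (norm m)\<^sup>2)\<^sup>2 * (cmod (fcoeff (fun_of_L2 f) m))\<^sup>2) summable_on Z3}"

definition H0_tilde :: "real^3 \<Rightarrow> L2_T \<Rightarrow> L2_T" where
  "H0_tilde \<theta> f = (1/2) *\<^sub>R of_fcoeff (mom_sq \<theta> (fcoeff (fun_of_L2 f)))"

definition G_tilde :: "real^3 \<Rightarrow> L2_T \<Rightarrow> L2_T" where
  "G_tilde \<theta> f = of_fcoeff (green \<theta> (fcoeff (fun_of_L2 f)))"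

definition sigma_tilde :: "(real^3 \<Rightarrow> real) \<Rightarrow> real^3 \<Rightarrow> real^3 \<Rightarrow> complex" where
  "sigma_tilde \<sigma> \<theta> y = (\<Sum>\<^sub>\<infinity>n\<in>Z3. cis (\<theta> \<bullet> (n + y)) * complex_of_real (\<sigma> (n + y)))"

definition S_tilde ::
    "real \<Rightarrow> real \<Rightarrow> (real^3 \<Rightarrow> real) \<Rightarrow> real^3 \<Rightarrow> complex^3 \<Rightarrow> L2_T" where
  "S_tilde e Z\<^sub>0 \<sigma> \<theta> q = (e * sqrt Z\<^sub>0) *\<^sub>R of_fcoeff (green \<theta>
    (\<lambda>m. \<Sum>j\<in>UNIV. - \<i> * mom \<theta> j (fcoeff (sigma_tilde \<sigma> \<theta>)) m * q $ j))"

definition S_tilde_adj ::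
    "real \<Rightarrow> real \<Rightarrow> (real^3 \<Rightarrow> real) \<Rightarrow> real^3 \<Rightarrow> L2_T \<Rightarrow> complex^3" where
  "S_tilde_adj e Z\<^sub>0 \<sigma> \<theta> f = (THE r. \<forall>q. cinner (S_tilde e Z\<^sub>0 \<sigma> \<theta> q) f = cinner q r)"

definition T_tilde :: "(real^3 \<Rightarrow> real) \<Rightarrow> real^3 \<Rightarrow> complex^3 \<Rightarrow> complex^3" where
  "T_tilde \<sigma> \<theta> q = (\<chi> i j. complex_of_real (Sigma_mat \<sigma> \<theta> $ i $ j)) *v q"

definition B_tilde ::
    "real \<Rightarrow> real \<Rightarrow> real \<Rightarrow> (real^3 \<Rightarrow> real) \<Rightarrow> real^3 \<Rightarrow> (X0_T \<times> X0_T) set" where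
  "B_tilde e M Z\<^sub>0 \<sigma> \<theta> =
    {((\<Psi>\<^sub>1, \<Psi>\<^sub>2, q, p),
      (2 *\<^sub>R H0_tilde \<theta> \<Psi>\<^sub>1 + (4 * e\<^sup>2 * sqrt Z\<^sub>0) *\<^sub>R G_tilde \<theta> (sqrt Z\<^sub>0 *\<^sub>R \<Psi>\<^sub>1)
         + 2 *\<^sub>R S_tilde e Z\<^sub>0 \<sigma> \<theta> q,
       2 *\<^sub>R H0_tilde \<theta> \<Psi>\<^sub>2,
       2 *\<^sub>R S_tilde_adj e Z\<^sub>0 \<sigma> \<theta> \<Psi>\<^sub>1 + T_tilde \<sigma> \<theta> q,
       (1 / M) *\<^sub>R p))
     | \<Psi>\<^sub>1 \<Psi>\<^sub>2 q p. \<Psi>\<^sub>1 \<in> H2_T \<and> \<Psi>\<^sub>2 \<in> H2_T}"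

definition J_mat :: "X0_T \<Rightarrow> X0_T" where
  "J_mat = (\<lambda>(\<Psi>\<^sub>1, \<Psi>\<^sub>2, q, p). ((1/2) *\<^sub>R \<Psi>\<^sub>2, - (1/2) *\<^sub>R \<Psi>\<^sub>1, p, - q))"

definition K_tilde ::
    "real \<Rightarrow> real \<Rightarrow> real \<Rightarrow> (real^3 \<Rightarrow> real) \<Rightarrow> real^3 \<Rightarrow> (X0_T \<times> X0_T) set" where
  "K_tilde e M Z\<^sub>0 \<sigma> \<theta> =
    (let \<Lambda> = sqrt_op (B_tilde e M Z\<^sub>0 \<sigma> \<theta>) in \<Lambda> O graph_of (\<lambda>Y. \<i> *\<^sub>C J_mat Y) O \<Lambda>)"

section \<open>The Bloch transform and the operator $K$\<close>

definition bloch_term :: "X0_R3 \<Rightarrow> real^3 \<Rightarrow> real^3 \<Rightarrow> X0_T" where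
  "bloch_term = (\<lambda>(\<Psi>\<^sub>1, \<Psi>\<^sub>2, q, p) n \<theta>.
    (to_L2 (\<lambda>y. cis (\<theta> \<bullet> (n + y)) * fun_of_L2 \<Psi>\<^sub>1 (n + y)),
     to_L2 (\<lambda>y. cis (\<theta> \<bullet> (n + y)) * fun_of_L2 \<Psi>\<^sub>2 (n + y)),
     cis (\<theta> \<bullet> n) *\<^sub>C fun_of_L2 q n,
     cis (\<theta> \<bullet> n) *\<^sub>C fun_of_L2 p n))"

text \<open>The series converges in $L^2(\Pi^*, X^0(T))$, not pointwise in \<open>\<theta>\<close>.\<close>

definition bloch :: "X0_R3 \<Rightarrow> (brillouin, X0_T) L2" where
  "bloch Y = (\<Sum>\<^sub>\<infinity>n\<in>Z3. to_L2 (bloch_term Y n))"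

text \<open>The maximal operator of multiplication by \<open>A \<theta>\<close>.\<close>

definition mult_op ::
    "(real^3 \<Rightarrow> ('b \<times> 'b) set) \<Rightarrow> ((brillouin, 'b::real_inner) L2 \<times> (brillouin, 'b) L2) set" where
  "mult_op A = {(U, V). AE \<theta> in tag_measure TYPE(brillouin). (fun_of_L2 U \<theta>, fun_of_L2 V \<theta>) \<in> A \<theta>}"

definition K_op :: "real \<Rightarrow> real \<Rightarrow> real \<Rightarrow> (real^3 \<Rightarrow> real) \<Rightarrow> (X0_R3 \<times> X0_R3) set" where
  "K_op e M Z\<^sub>0 \<sigma> = {(Y, V). (bloch Y, bloch V) \<in> mult_op (K_tilde e M Z\<^sub>0 \<sigma>)}"

definition nonconstant_branch ::
    "real \<Rightarrow> real \<Rightarrow> real \<Rightarrow> (real^3 \<Rightarrow> real) \<Rightarrow>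
      (real^3) set \<Rightarrow> (real^3 \<Rightarrow> real) \<Rightarrow> (real^3 \<Rightarrow> X0_T \<Rightarrow>\<^sub>L X0_T) \<Rightarrow> bool" where
  "nonconstant_branch e M Z\<^sub>0 \<sigma> W \<omega> P \<longleftrightarrow>
    open W \<and> W \<subseteq> Pi_star_plus \<sigma> \<and> real_analytic_on \<omega> W \<and> real_analytic_on P W \<and>
    (\<forall>\<theta>\<in>W. eigenvalue (K_tilde e M Z\<^sub>0 \<sigma> \<theta>) (complex_of_real (\<omega> \<theta>)) \<and> gradient \<omega> \<theta> \<noteq> 0 \<and>
      orthogonal_projection (P \<theta>)
        (eigenspace (K_tilde e M Z\<^sub>0 \<sigma> \<theta>) (complex_of_real (\<omega> \<theta>))))"

definition branch_vectors :: "real \<Rightarrow> real \<Rightarrow> real \<Rightarrow> (real^3 \<Rightarrow> real) \<Rightarrow> X0_R3 set" where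
  "branch_vectors e M Z\<^sub>0 \<sigma> =
    {Y. \<exists>W \<omega> P. \<exists>D\<in>test_functions W. nonconstant_branch e M Z\<^sub>0 \<sigma> W \<omega> P \<and>
      (AE \<theta> in tag_measure TYPE(brillouin).
        fun_of_L2 (bloch Y) \<theta> = (if \<theta> \<in> W then blinfun_apply (P \<theta>) (D \<theta>) else 0))}"

section \<open>Weighted spaces\<close>

text \<open>For negative \<open>\<alpha>\<close> the weighted space is larger than $X^0(R^3)$; its elements are
  quadruples of functions (identified if their norm distance is zero), of which the last two matter
  on $Z^3$ only.\<close>

type_synonym quadruple =
  "(real^3 \<Rightarrow> complex) \<times> (real^3 \<Rightarrow> complex) \<times> (real^3 \<Rightarrow> complex^3) \<times> (real^3 \<Rightarrow> complex^3)"

definition quad_of :: "X0_R3 \<Rightarrow> quadruple" where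
  "quad_of = (\<lambda>(\<Psi>\<^sub>1, \<Psi>\<^sub>2, q, p). (fun_of_L2 \<Psi>\<^sub>1, fun_of_L2 \<Psi>\<^sub>2, fun_of_L2 q, fun_of_L2 p))"

definition cell :: "quadruple \<Rightarrow> real^3 \<Rightarrow> X0_T" where
  "cell = (\<lambda>(\<Psi>\<^sub>1, \<Psi>\<^sub>2, q, p) n.
    (to_L2 (\<lambda>y. \<Psi>\<^sub>1 (n + y)), to_L2 (\<lambda>y. \<Psi>\<^sub>2 (n + y)), q n, p n))"

definition X_weighted :: "real \<Rightarrow> quadruple set" where
  "X_weighted \<alpha> = {Y. (\<forall>n\<in>Z3. \<forall>\<Psi>\<in>{fst Y, fst (snd Y)}.
        square_integrable (tag_measure TYPE(torus)) (\<lambda>y. \<Psi> (n + y))) \<and>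
      (\<lambda>n. (1 + norm n) powr (2 * \<alpha>) * (norm (cell Y n))\<^sup>2) summable_on Z3}"

definition norm_weighted :: "real \<Rightarrow> quadruple \<Rightarrow> real" where
  "norm_weighted \<alpha> Y =
    sqrt (\<Sum>\<^sub>\<infinity>n\<in>Z3. (1 + norm n) powr (2 * \<alpha>) * (norm (cell Y n))\<^sup>2)"

end

theory Submission
  imports Defs "HOL-Real_Asymp.Real_Asymp"
begin

text \<open>For every selfadjoint $\Lambda$ the operator $\Lambda\,iJ\,\Lambda$ is symmetric, so
  $(K-z)^{-1}$ is determined by any solution of the resolvent equation, and on a branch the solution is
  multiplication by $(\omega_l-z)^{-1}$. It lies in the range of the Bloch transform because this
  multiplier, cut off, is a uniform limit of trigonometric polynomials, which act as lattice
  translations. Its $n$-th cell is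
  $$(2\pi)^{-3}\int e^{-i\theta\cdot n}\,\frac{G(\theta)}{\epsilon\pm i(\omega_l(\theta)-\omega)}\,d\theta$$
  with $G$ smooth and compactly supported. Since $\nabla\omega_l\ne 0$, two integrations by parts along
  $\nabla\omega_l$ replace $1/v$, where $v=\epsilon\pm i(\omega_l-\omega)$, by $v\log v-v$. This function is
  continuous up to $\mathrm{Re}\,v=0$, while the derivatives cost a factor $(1+|n|)^2$. Hence the cells
  converge as $\epsilon\to+0$ and are $O((1+|n|)^2)$ uniformly in $\epsilon$, and
  $\sum_n(1+|n|)^{2\alpha+4}<\infty$ for $\alpha<-7/2$.\<close>

section \<open>Square integrable functions\<close>

text \<open>One integration by parts would leave log v, which is unbounded where u = 0. The second
  leaves a function that is continuous on a compact rectangle including the edge Re v = 0, so the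
  uniform bounds and the limit both come from plain uniform continuity. Writing v = \<epsilon> + i s
  (\<omega>_l - \<omega>) with a sign s keeps both limits in the right half-plane, away from the cut
  of \<open>Ln\<close>. The Bloch factor e^{i\<theta>(n+y)} is not periodic in \<theta>: it splits
  into e^{i\<theta>n} and a unitary operator \<open>phase \<theta>\<close> in y. Recovering a cell
  means undoing this operator, so \<open>phase (- \<theta>)\<close> must be absorbed into G and has
  to be smooth in \<theta> in operator norm; it is, because the cell is bounded. Functions take
  values in the Hilbert space \<open>X0_T\<close>, where Borel measurability alone does not yield
  the simple approximants that \<open>strongly_measurable\<close> asks for; separability of ranges
  is therefore tracked separately. The limit exists cell by cell only and may leave X^0(R^3). It is
  assembled from the limits of the cells, and dominated convergence over the lattice gives
  convergence in the weighted norm.\<close>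

lemma strongly_measurable_separable:
  fixes f :: "'a \<Rightarrow> 'b::topological_space"
  assumes "strongly_measurable M f"
  shows "\<exists>D. countable D \<and> f ` space M \<subseteq> closure D"
proof -
  from assms obtain s where s: "\<And>i::nat. simple_function M (s i)"
    "\<And>x. x \<in> space M \<Longrightarrow> (\<lambda>i. s i x) \<longlonglongrightarrow> f x"
    unfolding strongly_measurable_def by blast
  let ?D = "\<Union>i. s i ` space M"
  have "countable ?D"
    using s(1) by (intro countable_UN) (auto simp: simple_function_def countable_finite)
  moreover have "f x \<in> closure ?D" if x: "x \<in> space M" for x
  proof (rule Lim_in_closed_set[OF closed_closure _ _ s(2)[OF x]])
    have "s i x \<in> ?D" for i using x by auto
    then show "\<forall>\<^sub>F i in sequentially. s i x \<in> closure ?D"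
      using closure_subset[of ?D] by (intro always_eventually allI) (rule subsetD)
  qed simp
  ultimately show ?thesis by blast
qed

text \<open>Pettis' criterion. The n-th simple function sends x to a point nearest to f x among the
  first n + 1 members of an enumeration of D, ties being broken by the least index.\<close>

lemma strongly_measurableI:
  fixes f :: "'a \<Rightarrow> 'b::metric_space"
  assumes f: "f \<in> borel_measurable M" and D: "countable D" "f ` space M \<subseteq> closure D"
  shows "strongly_measurable M f"
proof (cases "space M = {}")
  case True
  then show ?thesis
    by (auto simp: strongly_measurable_def simple_function_def)
next
  case False
  then have "D \<noteq> {}" using D(2) by auto
  define d where "d = from_nat_into D"
  have rd: "range d = D"
    unfolding d_def by (rule range_from_nat_into[OF \<open>D \<noteq> {}\<close> D(1)])
  define P where "P n j x \<longleftrightarrow> j \<le> n \<and> (\<forall>k\<le>n. dist (f x) (d j) \<le> dist (f x) (d k))" for n j :: nat and x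
  have exP: "\<exists>j. P n j x" for n x
  proof -
    have "Min ((\<lambda>k. dist (f x) (d k)) ` {..n}) \<in> (\<lambda>k. dist (f x) (d k)) ` {..n}"
      by (rule Min_in) auto
    then obtain j where j: "j \<in> {..n}" "Min ((\<lambda>k. dist (f x) (d k)) ` {..n}) = dist (f x) (d j)"
      by (rule imageE)
    have "dist (f x) (d j) \<le> dist (f x) (d k)" if "k \<le> n" for k
      unfolding j(2)[symmetric] using that by (intro Min_le) auto
    then show ?thesis unfolding P_def using j(1) by (intro exI[of _ j]) auto
  qed
  define idx where "idx n x = (LEAST j. P n j x)" for n x
  have P_idx: "P n (idx n x) x" for n x
    unfolding idx_def by (rule LeastI_ex[OF exP])
  have dist_meas: "(\<lambda>x. dist (f x) c) \<in> borel_measurable M" for c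
    by (rule measurable_compose[OF f borel_measurable_continuous_onI[of "\<lambda>y. dist y c"]])
      (intro continuous_intros)
  have P_meas: "Measurable.pred M (P n j)" for n j
  proof -
    note [measurable] = dist_meas
    show ?thesis unfolding P_def[abs_def] by measurable
  qed
  have idx_meas: "idx n \<in> measurable M (count_space UNIV)" for n
    unfolding idx_def[abs_def] by (rule measurable_Least[OF P_meas])
  have "simple_function M (\<lambda>x. d (idx n x))" for n
  proof (rule simple_function_compose1[of M "idx n" d])
    show "simple_function M (idx n)"
      unfolding simple_function_def
    proof (intro conjI ballI)
      have "idx n ` space M \<subseteq> {..n}" using P_idx by (auto simp: P_def)
      then show "finite (idx n ` space M)" by (rule finite_subset) simp
      show "idx n -` {x} \<inter> space M \<in> sets M" for x
        by (rule measurable_sets[OF idx_meas]) simp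
    qed
  qed
  moreover have "(\<lambda>n. d (idx n x)) \<longlonglongrightarrow> f x" if x: "x \<in> space M" for x
  proof (rule metric_LIMSEQ_I)
    fix r :: real assume "r > 0"
    then obtain y where "y \<in> D" "dist y (f x) < r"
      using D(2) x closure_approachable by (metis image_subset_iff)
    then obtain j where j: "dist (f x) (d j) < r"
      using rd by (metis dist_commute image_iff)
    show "\<exists>no. \<forall>n\<ge>no. dist (d (idx n x)) (f x) < r"
    proof (intro exI[of _ j] allI impI)
      fix n assume "j \<le> n"
      then have "dist (f x) (d (idx n x)) \<le> dist (f x) (d j)"
        using P_idx[of n x] by (auto simp: P_def)
      then show "dist (d (idx n x)) (f x) < r" using j by (simp add: dist_commute)
    qed
  qed
  ultimately show ?thesis unfolding strongly_measurable_def by (intro exI[of _ "\<lambda>n x. d (idx n x)"]) auto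
qed

lemma strongly_measurable_iff_borel:
  fixes f :: "'a \<Rightarrow> 'b::{metric_space,second_countable_topology}"
  shows "strongly_measurable M f \<longleftrightarrow> f \<in> borel_measurable M"
proof
  assume f: "f \<in> borel_measurable M"
  obtain D :: "'b set" where D: "countable D" "\<And>X. open X \<Longrightarrow> X \<noteq> {} \<Longrightarrow> \<exists>d\<in>D. d \<in> X"
    using countable_dense_setE by blast
  have "closure D = UNIV"
    using D(2) by (auto simp: closure_iff_nhds_not_empty) (metis D(2) IntI empty_iff subsetD)
  then show "strongly_measurable M f"
    using strongly_measurableI[OF f D(1)] by simp
qed (rule strongly_measurable_imp_borel)

text \<open>Separability of ranges survives pointwise limits: the limit stays in the closure of the
  union of the countable sets that serve the approximants. Completeness of \<open>L2\<close> rests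
  on this.\<close>

lemma strongly_measurable_LIMSEQ:
  fixes f :: "'a \<Rightarrow> 'b::metric_space"
  assumes s: "\<And>k::nat. strongly_measurable M (s k)"
    and lim: "\<And>x. x \<in> space M \<Longrightarrow> (\<lambda>k. s k x) \<longlonglongrightarrow> f x"
  shows "strongly_measurable M f"
proof -
  have "\<exists>D. countable D \<and> s k ` space M \<subseteq> closure D" for k
    by (rule strongly_measurable_separable[OF s])
  then obtain D where D: "\<And>k. countable (D k)" "\<And>k. s k ` space M \<subseteq> closure (D k)"
    by metis
  show ?thesis
  proof (rule strongly_measurableI)
    show "f \<in> borel_measurable M"
      by (rule borel_measurable_LIMSEQ_metric[OF strongly_measurable_imp_borel[OF s] lim])
    show "countable (\<Union>k. D k)" using D(1) by simp
    show "f ` space M \<subseteq> closure (\<Union>k. D k)"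
    proof (intro image_subsetI)
      fix x assume x: "x \<in> space M"
      have "s k x \<in> closure (\<Union>k. D k)" for k
        using D(2)[of k] x closure_mono[of "D k" "\<Union>k. D k"] by auto
      then show "f x \<in> closure (\<Union>k. D k)"
        by (intro Lim_in_closed_set[OF closed_closure _ _ lim[OF x]]) auto
    qed
  qed
qed

lemma strongly_measurable_restrict:
  fixes f :: "'a \<Rightarrow> 'b::topological_space"
  assumes f: "strongly_measurable M f" and A: "A \<in> sets M"
  shows "strongly_measurable M (\<lambda>x. if x \<in> A then f x else c)"
proof -
  from f obtain s where s: "\<And>i::nat. simple_function M (s i)"
    "\<And>x. x \<in> space M \<Longrightarrow> (\<lambda>i. s i x) \<longlonglongrightarrow> f x"
    unfolding strongly_measurable_def by blast
  show ?thesis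
    unfolding strongly_measurable_def
  proof (intro exI[of _ "\<lambda>i x. if x \<in> A then s i x else c"] conjI allI ballI)
    have "A \<inter> space M = {x \<in> space M. x \<in> A}" by auto
    then show "simple_function M (\<lambda>x. if x \<in> A then s i x else c)" for i
      using A s(1) by (intro simple_function_If) (auto simp: simple_function_const sets.Int)
    show "(\<lambda>i. if x \<in> A then s i x else c) \<longlonglongrightarrow> (if x \<in> A then f x else c)" if "x \<in> space M" for x
      using s(2)[OF that] by simp
  qed
qed

text \<open>A countable dense subset of S has a dense image, so the range is separable whatever the
  target space is.\<close>

lemma strongly_measurable_continuous_on:
  fixes f :: "'a::{metric_space,second_countable_topology} \<Rightarrow> 'b::metric_space"
  assumes "continuous_on S f"
  shows "strongly_measurable (restrict_space borel S) f"
proof -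
  obtain T where T: "countable T" "T \<subseteq> S" "S \<subseteq> closure T"
    by (rule separable)
  show ?thesis
  proof (rule strongly_measurableI)
    show "f \<in> borel_measurable (restrict_space borel S)"
      by (rule borel_measurable_continuous_on_restrict[OF assms])
    show "countable (f ` T)" using T by simp
    show "f ` space (restrict_space borel S) \<subseteq> closure (f ` T)"
    proof (clarsimp simp: space_restrict_space)
      fix x assume x: "x \<in> S"
      then obtain t where t: "\<And>n::nat. t n \<in> T" "t \<longlonglongrightarrow> x"
        using T(3) closure_sequential by (metis subsetD)
      have "(\<lambda>n. f (t n)) \<longlonglongrightarrow> f x"
        using assms x t T(2) unfolding continuous_on_sequentially by (auto simp: comp_def)
      then show "f x \<in> closure (f ` T)"
        using t(1) unfolding closure_sequential by (intro exI[of _ "\<lambda>n. f (t n)"]) auto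
    qed
  qed
qed

lemma strongly_measurable_cong_sets:
  assumes "sets M = sets N" shows "strongly_measurable M f \<longleftrightarrow> strongly_measurable N f"
  using sets_eq_imp_space_eq[OF assms] assms
  by (simp add: strongly_measurable_def simple_function_def)

section \<open>Norms and inner products of classes, and completeness\<close>

lemma norm_power2_eq_L2:
  fixes F :: "('t::measure_tag, 'b::real_inner) L2"
  shows "(norm F)\<^sup>2 = (\<integral>x. (norm (fun_of_L2 F x))\<^sup>2 \<partial>tag_measure TYPE('t))"
  by (simp add: power2_norm_eq_inner inner_L2_def)

lemma inner_to_L2:
  fixes f g :: "real^3 \<Rightarrow> 'b::real_inner"
  assumes "square_integrable (tag_measure TYPE('t::measure_tag)) f"
    "square_integrable (tag_measure TYPE('t)) g"
  shows "(to_L2 f :: ('t,'b) L2) \<bullet> to_L2 g = (\<integral>x. f x \<bullet> g x \<partial>tag_measure TYPE('t))"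
  unfolding inner_L2_def
proof (rule integral_cong_AE)
  show "AE x in tag_measure TYPE('t). fun_of_L2 (to_L2 f :: ('t,'b) L2) x \<bullet> fun_of_L2 (to_L2 g :: ('t,'b) L2) x = f x \<bullet> g x"
    using fun_of_L2_to_L2[OF assms(1)] fun_of_L2_to_L2[OF assms(2)] by eventually_elim simp
  show "(\<lambda>x. f x \<bullet> g x) \<in> borel_measurable (tag_measure TYPE('t))"
    using square_integrable_inner[OF assms] by (rule borel_measurable_integrable)
  show "(\<lambda>x. fun_of_L2 (to_L2 f :: ('t,'b) L2) x \<bullet> fun_of_L2 (to_L2 g :: ('t,'b) L2) x) \<in> borel_measurable (tag_measure TYPE('t))"
    by (rule borel_measurable_integrable[OF square_integrable_inner[OF square_integrable_fun_of_L2 square_integrable_fun_of_L2]])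
qed

lemma norm_to_L2_power2:
  fixes f :: "real^3 \<Rightarrow> 'b::real_inner"
  assumes "square_integrable (tag_measure TYPE('t::measure_tag)) f"
  shows "(norm (to_L2 f :: ('t,'b) L2))\<^sup>2 = (\<integral>x. (norm (f x))\<^sup>2 \<partial>tag_measure TYPE('t))"
  using inner_to_L2[OF assms assms] by (simp add: power2_norm_eq_inner)

lemma nn_integral_norm_L2:
  fixes F :: "('t::measure_tag, 'b::real_inner) L2"
  shows "(\<integral>\<^sup>+x. ennreal ((norm (fun_of_L2 F x))\<^sup>2) \<partial>tag_measure TYPE('t)) = ennreal ((norm F)\<^sup>2)"
  unfolding norm_power2_eq_L2
  using square_integrable_fun_of_L2[of F] by (intro nn_integral_eq_integral) (auto simp: square_integrable_def)

lemma fun_of_L2_diff: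
  fixes F G :: "('t::measure_tag, 'b::real_inner) L2"
  shows "AE x in tag_measure TYPE('t). fun_of_L2 (F - G) x = fun_of_L2 F x - fun_of_L2 G x"
  using fun_of_L2_plus[of F "(-1) *\<^sub>R G"] fun_of_L2_scaleR[of "-1" G]
  by eventually_elim simp

lemma square_integrable_diff:
  fixes f g :: "'a \<Rightarrow> 'b::real_inner"
  assumes "square_integrable M f" "square_integrable M g"
  shows "square_integrable M (\<lambda>x. f x - g x)"
  using square_integrable_add[OF assms(1) square_integrable_scaleR[OF assms(2), of "-1"]] by simp

lemma to_L2_diff:
  fixes f g :: "real^3 \<Rightarrow> 'b::real_inner"
  assumes "square_integrable (tag_measure TYPE('t::measure_tag)) f"
    "square_integrable (tag_measure TYPE('t)) g"
  shows "(to_L2 (\<lambda>x. f x - g x) :: ('t,'b) L2) = to_L2 f - to_L2 g"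
proof (rule L2_eqI)
  show "AE x in tag_measure TYPE('t). fun_of_L2 (to_L2 (\<lambda>x. f x - g x) :: ('t,'b) L2) x = fun_of_L2 (to_L2 f - to_L2 g :: ('t,'b) L2) x"
    using fun_of_L2_to_L2[OF square_integrable_diff[OF assms]] fun_of_L2_to_L2[OF assms(1)]
      fun_of_L2_to_L2[OF assms(2)] fun_of_L2_diff[of "to_L2 f :: ('t,'b) L2" "to_L2 g"]
    by eventually_elim simp
qed

text \<open>Riesz--Fischer: along a subsequence with $\|f_{k+1}-f_k\|^2\le 16^{-k}$ the function
  $\sum_k 4^k|f_{k+1}-f_k|^2$ is integrable, which gives a pointwise limit almost everywhere.\<close>

instance L2 :: (measure_tag, "{real_inner,banach}") complete_space
proof
  fix X :: "nat \<Rightarrow> ('a, 'b) L2"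
  assume X: "Cauchy X"
  let ?M = "tag_measure TYPE('a)"
  have "\<exists>n. \<forall>m\<ge>n. \<forall>m'\<ge>n. dist (X m) (X m') < (1/4)^k" for k
    using X unfolding Cauchy_def by (meson zero_less_power zero_less_divide_1_iff zero_less_numeral)
  then obtain N where N: "\<And>k m m'. m \<ge> N k \<Longrightarrow> m' \<ge> N k \<Longrightarrow> dist (X m) (X m') < (1/4)^k"
    by metis
  \<comment> \<open>The summand k makes r strictly increasing, the sum makes it dominate N.\<close>
  define r where "r k = k + (\<Sum>j\<le>k. N j)" for k
  have rN: "N k \<le> r k" for k
    unfolding r_def by (simp add: member_le_sum trans_le_add2)
  have r_mono: "strict_mono r"
    by (rule strict_monoI_Suc) (simp add: r_def)
  define g where "g k = fun_of_L2 (X (r k))" for k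
  have gM: "strongly_measurable ?M (g k)" for k
    using square_integrable_fun_of_L2[of "X (r k)"] by (simp add: g_def square_integrable_def)
  have gdM: "strongly_measurable ?M (\<lambda>x. g j x - g k x)" for j k
    by (rule strongly_measurable_comp2[OF gM gM, where h = "(-)"]) (rule tendsto_diff)
  have dist_g: "(\<integral>\<^sup>+x. ennreal ((norm (g j x - g k x))\<^sup>2) \<partial>?M) = ennreal ((dist (X (r j)) (X (r k)))\<^sup>2)" for j k
  proof -
    have "(\<integral>\<^sup>+x. ennreal ((norm (g j x - g k x))\<^sup>2) \<partial>?M)
        = (\<integral>\<^sup>+x. ennreal ((norm (fun_of_L2 (X (r j) - X (r k)) x))\<^sup>2) \<partial>?M)"
      using fun_of_L2_diff[of "X (r j)" "X (r k)"]
      by (intro nn_integral_cong_AE) (auto simp: g_def elim!: eventually_mono)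
    then show ?thesis by (simp add: nn_integral_norm_L2 dist_norm)
  qed
  define S where "S x = (\<Sum>k. ennreal (4^k * (norm (g (Suc k) x - g k x))\<^sup>2))" for x
  have tm: "(\<lambda>x. ennreal (4^k * (norm (g j x - g i x))\<^sup>2)) \<in> borel_measurable ?M" for i j k
    using strongly_measurable_imp_borel[OF gdM[of j i]] by measurable
  have S_meas: "S \<in> borel_measurable ?M"
    unfolding S_def[abs_def] using tm by measurable
  have "(\<integral>\<^sup>+x. S x \<partial>?M) = (\<Sum>k. \<integral>\<^sup>+x. ennreal (4^k * (norm (g (Suc k) x - g k x))\<^sup>2) \<partial>?M)"
    unfolding S_def by (rule nn_integral_suminf) (rule tm)
  also have "\<dots> \<le> (\<Sum>k. ennreal ((1/4)^k))"
  proof (rule suminf_le)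
    fix k
    have "(\<integral>\<^sup>+x. ennreal (4^k * (norm (g (Suc k) x - g k x))\<^sup>2) \<partial>?M)
        = ennreal (4^k) * (\<integral>\<^sup>+x. ennreal ((norm (g (Suc k) x - g k x))\<^sup>2) \<partial>?M)"
      using tm[of 0] by (simp add: ennreal_mult nn_integral_cmult)
    also have "\<dots> = ennreal (4^k * (dist (X (r (Suc k))) (X (r k)))\<^sup>2)"
      by (simp add: dist_g ennreal_mult)
    also have "\<dots> \<le> ennreal (4^k * ((1/4)^k)\<^sup>2)"
    proof (intro ennreal_leI mult_left_mono power_mono)
      have "N k \<le> r (Suc k)" using rN[of k] r_mono by (meson le_trans lessI less_imp_le strict_mono_less_eq)
      then show "dist (X (r (Suc k))) (X (r k)) \<le> (1/4)^k"
        using N[of k "r (Suc k)" "r k"] rN[of k] by simp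
    qed auto
    also have "4^k * ((1/4)^k)\<^sup>2 = (1/4::real)^k"
    proof -
      have "4^k * ((1/4)^k)\<^sup>2 = (4 * (1/4) * (1/4::real))^k"
        unfolding power2_eq_square power_mult_distrib by simp
      then show ?thesis by simp
    qed
    finally show "(\<integral>\<^sup>+x. ennreal (4^k * (norm (g (Suc k) x - g k x))\<^sup>2) \<partial>?M) \<le> ennreal ((1/4)^k)" .
  qed auto
  also have "\<dots> < \<infinity>"
    by (subst suminf_ennreal2) (auto intro!: summable_geometric)
  finally have "AE x in ?M. S x \<noteq> \<infinity>"
    using S_meas by (intro nn_integral_PInf_AE) auto
  moreover define A where "A = {x \<in> space ?M. S x < \<infinity>}"
  ultimately have AE_A: "AE x in ?M. x \<in> A"
    by (auto elim!: eventually_mono[OF eventually_conj[OF _ AE_space]] simp: less_top)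
  have A: "A \<in> sets ?M" unfolding A_def using S_meas by measurable
  have conv: "convergent (\<lambda>k. g k x)" if x: "x \<in> A" for x
  proof -
    obtain B where B: "S x = ennreal B" "B \<ge> 0"
    proof (cases "S x" rule: ennreal_cases)
      case top
      then show ?thesis using x by (simp add: A_def)
    qed
    \<comment> \<open>A single term of S x is at most B, so the increments decay like 2^-k.\<close>
    have step: "norm (g (Suc k) x - g k x) \<le> sqrt B * (1/2)^k" for k
    proof -
      have "ennreal (4^k * (norm (g (Suc k) x - g k x))\<^sup>2) \<le> ennreal B"
      proof -
        have "(\<Sum>k\<in>{k}. ennreal (4^k * (norm (g (Suc k) x - g k x))\<^sup>2)) \<le> S x"
          unfolding S_def by (rule sum_le_suminf) auto
        then show ?thesis unfolding B(1) by simp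
      qed
      then have "4^k * (norm (g (Suc k) x - g k x))\<^sup>2 \<le> B"
        by (subst (asm) ennreal_le_iff) (rule B(2))
      moreover have four: "((2::real)^k)\<^sup>2 = 4^k"
        by (subst power_mult[symmetric], subst mult.commute, subst power_mult) simp
      ultimately have "(2^k * norm (g (Suc k) x - g k x))\<^sup>2 \<le> B"
        by (simp only: power_mult_distrib four)
      then have "2^k * norm (g (Suc k) x - g k x) \<le> sqrt B"
        by (rule real_le_rsqrt)
      then show ?thesis by (simp add: field_simps power_divide)
    qed
    have "summable (\<lambda>k. g (Suc k) x - g k x)"
      by (rule summable_comparison_test'[where g = "\<lambda>k. sqrt B * (1/2)^k" and N = 0, OF _ step])
        (intro summable_mult summable_geometric, simp)
    then have "convergent (\<lambda>n. g n x - g 0 x)"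
      by (simp add: summable_iff_convergent sum_lessThan_telescope[of "\<lambda>k. g k x"])
    then show ?thesis
      by (simp add: convergent_diff_const_right_iff)
  qed
  define G where "G x = (if x \<in> A then lim (\<lambda>k. g k x) else 0)" for x
  have G_lim: "(\<lambda>k. if x \<in> A then g k x else 0) \<longlonglongrightarrow> G x" for x
    using conv[of x] by (auto simp: G_def convergent_LIMSEQ_iff)
  have GM: "strongly_measurable ?M G"
    by (rule strongly_measurable_LIMSEQ[OF strongly_measurable_restrict[OF gM A] G_lim])
  \<comment> \<open>Fatou's lemma, applied in j to the distances between g j and g k.\<close>
  have bound: "(\<integral>\<^sup>+x. ennreal ((norm (G x - g k x))\<^sup>2) \<partial>?M) \<le> ennreal (((1/4)^k)\<^sup>2)" for k
  proof -
    have "(\<integral>\<^sup>+x. ennreal ((norm (G x - g k x))\<^sup>2) \<partial>?M)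
        = (\<integral>\<^sup>+x. liminf (\<lambda>j. ennreal ((norm (g j x - g k x))\<^sup>2)) \<partial>?M)"
    proof (rule nn_integral_cong_AE, use AE_A in eventually_elim)
      fix x assume x: "x \<in> A"
      have "(\<lambda>j. g j x) \<longlonglongrightarrow> G x" using G_lim[of x] x by simp
      then have "(\<lambda>j. ennreal ((norm (g j x - g k x))\<^sup>2)) \<longlonglongrightarrow> ennreal ((norm (G x - g k x))\<^sup>2)"
        by (intro tendsto_intros)
      then show "ennreal ((norm (G x - g k x))\<^sup>2) = liminf (\<lambda>j. ennreal ((norm (g j x - g k x))\<^sup>2))"
        using lim_imp_Liminf[OF sequentially_bot] by metis
    qed
    also have "\<dots> \<le> liminf (\<lambda>j. \<integral>\<^sup>+x. ennreal ((norm (g j x - g k x))\<^sup>2) \<partial>?M)"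
      using tm[of 0] by (intro nn_integral_liminf) simp
    also have "\<dots> \<le> ennreal (((1/4)^k)\<^sup>2)"
    proof (rule Liminf_le)
      show "\<forall>\<^sub>F j in sequentially. (\<integral>\<^sup>+x. ennreal ((norm (g j x - g k x))\<^sup>2) \<partial>?M) \<le> ennreal (((1/4)^k)\<^sup>2)"
        using eventually_ge_at_top[of k]
      proof eventually_elim
        fix j assume "j \<ge> k"
        then have "N k \<le> r j" using rN[of k] r_mono by (meson le_trans strict_mono_less_eq)
        then show "(\<integral>\<^sup>+x. ennreal ((norm (g j x - g k x))\<^sup>2) \<partial>?M) \<le> ennreal (((1/4)^k)\<^sup>2)"
          unfolding dist_g using N[of k "r j" "r k"] rN[of k] by (intro ennreal_leI power_mono) auto
      qed
    qed simp
    finally show ?thesis .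
  qed
  have diffM: "strongly_measurable ?M (\<lambda>x. G x - g k x)" for k
    by (rule strongly_measurable_comp2[OF GM gM, where h = "(-)"]) (rule tendsto_diff)
  have sq: "square_integrable ?M (\<lambda>x. G x - g k x)" for k
    unfolding square_integrable_def
  proof (intro conjI diffM integrableI_bounded)
    show "(\<lambda>x. (norm (G x - g k x))\<^sup>2) \<in> borel_measurable ?M"
      using strongly_measurable_imp_borel[OF diffM] by measurable
    show "(\<integral>\<^sup>+x. ennreal (norm ((norm (G x - g k x))\<^sup>2)) \<partial>?M) < \<infinity>"
      using bound[of k] by (simp add: le_less_trans[OF _ ennreal_less_top])
  qed
  \<comment> \<open>G is recovered as the sum of G - g 0 and g 0.\<close>
  have sqG: "square_integrable ?M G"
    using square_integrable_add[OF sq[of 0] square_integrable_fun_of_L2[of "X (r 0)"]]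
    by (simp add: g_def)
  have close: "dist (to_L2 G) (X (r k)) \<le> (1/4)^k" for k
  proof -
    have "to_L2 G - X (r k) = (to_L2 (\<lambda>x. G x - g k x) :: ('a,'b) L2)"
      unfolding g_def by (subst to_L2_diff[OF sqG square_integrable_fun_of_L2]) (simp add: to_L2_fun_of_L2)
    then have "ennreal ((norm (to_L2 G - X (r k)))\<^sup>2) = (\<integral>\<^sup>+x. ennreal ((norm (G x - g k x))\<^sup>2) \<partial>?M)"
      using sq[of k] by (simp add: norm_to_L2_power2 square_integrable_def nn_integral_eq_integral)
    then have "ennreal ((norm (to_L2 G - X (r k)))\<^sup>2) \<le> ennreal (((1/4)^k)\<^sup>2)"
      using bound[of k] by (rule ord_eq_le_trans)
    then have "(norm (to_L2 G - X (r k)))\<^sup>2 \<le> ((1/4)^k)\<^sup>2"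
      by (subst (asm) ennreal_le_iff) simp_all
    then show ?thesis unfolding dist_norm by (rule power2_le_imp_le) simp
  qed
  have "(\<lambda>k. X (r k)) \<longlonglongrightarrow> to_L2 G"
  proof (rule tendstoI)
    fix e :: real assume "e > 0"
    then have "\<forall>\<^sub>F k in sequentially. (1/4::real)^k < e"
      by (intro order_tendstoD(2)[OF LIMSEQ_power_zero]) auto
    then show "\<forall>\<^sub>F k in sequentially. dist (X (r k)) (to_L2 G) < e"
      by eventually_elim (use close in \<open>metis dist_commute le_less_trans\<close>)
  qed
  then have "(X \<circ> r) \<longlonglongrightarrow> to_L2 G" by (simp add: comp_def)
  then show "convergent X"
    using Cauchy_converges_subseq[OF X r_mono] by (auto simp: convergent_def)
qed

text \<open>With the product instances this makes \<open>X0_T\<close> a Banach space, so that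
  infinite sums and integrals with values in it are available.\<close>

instance L2 :: (measure_tag, "{real_inner,banach}") banach ..

section \<open>Complex structure and multiplication operators\<close>

lemma scaleC_one [simp]: "1 *\<^sub>C x = x" for x :: "'a::complex_inner"
  using scaleC_of_real[of 1 x] by simp

lemma scaleC_zero_left [simp]: "0 *\<^sub>C x = 0" for x :: "'a::complex_inner"
  using scaleC_of_real[of 0 x] by simp

lemma scaleC_zero_right [simp]: "c *\<^sub>C 0 = 0" for c :: complex
  by (metis add_cancel_right_right scaleC_add_right)

lemma scaleC_scaleR_commute: "c *\<^sub>C (r *\<^sub>R x) = r *\<^sub>R c *\<^sub>C x" for x :: "'a::complex_inner"
  by (metis scaleC_of_real scaleC_scaleC mult.commute)

lemma scaleC_minus_left: "(- c) *\<^sub>C x = - (c *\<^sub>C x)" for x :: "'a::complex_inner"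
  by (metis add.right_inverse add_eq_0_iff scaleC_add_left scaleC_zero_left)

lemma bounded_bilinear_scaleC: "bounded_bilinear ((*\<^sub>C) :: complex \<Rightarrow> 'a \<Rightarrow> 'a::complex_inner)"
proof
  show "(r *\<^sub>R c) *\<^sub>C x = r *\<^sub>R c *\<^sub>C x" for r c and x :: 'a
    by (metis scaleC_of_real scaleC_scaleC scaleR_conv_of_real)
  show "\<exists>K. \<forall>c (x :: 'a). norm (c *\<^sub>C x) \<le> norm c * norm x * K"
    by (intro exI[of _ 1]) (simp add: norm_scaleC)
qed (simp_all add: scaleC_add_left scaleC_add_right scaleC_scaleR_commute)

lemma bounded_linear_scaleC: "bounded_linear ((*\<^sub>C) c :: 'a \<Rightarrow> 'a::complex_inner)"
  by (rule bounded_bilinear.bounded_linear_right[OF bounded_bilinear_scaleC])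

lemma scaleC_eq: "c *\<^sub>C x = Re c *\<^sub>R x + Im c *\<^sub>R (\<i> *\<^sub>C x)" for x :: "'a::complex_inner"
proof -
  have "c *\<^sub>C x = (complex_of_real (Re c) + complex_of_real (Im c) * \<i>) *\<^sub>C x"
    by (rule arg_cong[of _ _ "\<lambda>c. c *\<^sub>C x"]) (simp add: complex_eq_iff)
  then show ?thesis
    by (metis scaleC_add_left scaleC_scaleC scaleC_of_real)
qed

lemma scaleC_ii_ii: "\<i> *\<^sub>C \<i> *\<^sub>C x = - x" for x :: "'a::complex_inner"
  using scaleC_of_real[of "-1" x] by (simp add: scaleC_scaleC)

lemma inner_ii_left: "(\<i> *\<^sub>C x) \<bullet> y = - (x \<bullet> (\<i> *\<^sub>C y))" for x y :: "'a::complex_inner"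
  using inner_imaginary[of x "\<i> *\<^sub>C y"] by (simp add: scaleC_ii_ii)

lemma inner_scaleC_left: "(c *\<^sub>C x) \<bullet> y = x \<bullet> (cnj c *\<^sub>C y)" for x y :: "'a::complex_inner"
  unfolding scaleC_eq[of c] scaleC_eq[of "cnj c"]
  by (simp add: inner_add_left inner_add_right inner_diff_right inner_ii_left)

lemma cinner_add_right: "cinner x (y + z) = cinner x y + cinner x z"
  by (simp add: cinner_def inner_add_right complex_eq_iff)

lemma cinner_scaleC_right: "cinner x (c *\<^sub>C y) = c * cinner x y"
  unfolding scaleC_eq[of c]
  by (simp add: cinner_def inner_add_right complex_eq_iff inner_ii_left[of x] scaleC_ii_ii
      inner_imaginary)

lemma cnj_cinner: "cnj (cinner x y) = cinner y x"
  using inner_ii_left[of x y] by (simp add: cinner_def complex_eq_iff inner_commute)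

lemma cinner_scaleC_left: "cinner (c *\<^sub>C x) y = cnj c * cinner x y"
  by (metis cinner_scaleC_right cnj_cinner complex_cnj_mult)

lemma cinner_self: "cinner x x = complex_of_real ((norm x)\<^sup>2)"
proof -
  have "(\<i> *\<^sub>C x) \<bullet> x = 0"
    using inner_ii_left[of x x] by (simp add: inner_commute)
  then show ?thesis
    by (simp add: cinner_def power2_norm_eq_inner complex_eq_iff)
qed

section \<open>Multiplication by bounded scalar functions\<close>

definition bounded_multiplier :: "'a measure \<Rightarrow> ('a \<Rightarrow> complex) \<Rightarrow> bool" where
  "bounded_multiplier M m \<longleftrightarrow> m \<in> borel_measurable M \<and> (\<exists>C. \<forall>x\<in>space M. cmod (m x) \<le> C)"

lemma bounded_multiplier_const: "bounded_multiplier M (\<lambda>_. c)"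
  by (auto simp: bounded_multiplier_def)

lemma bounded_multiplier_add:
  assumes "bounded_multiplier M m" "bounded_multiplier M m'"
  shows "bounded_multiplier M (\<lambda>x. m x + m' x)"
proof -
  from assms obtain C C' where C: "\<And>x. x \<in> space M \<Longrightarrow> cmod (m x) \<le> C" "\<And>x. x \<in> space M \<Longrightarrow> cmod (m' x) \<le> C'"
    by (auto simp: bounded_multiplier_def)
  have "\<forall>x\<in>space M. cmod (m x + m' x) \<le> C + C'"
    using C by (intro ballI norm_triangle_le add_mono)
  then show ?thesis using assms by (auto simp: bounded_multiplier_def intro!: borel_measurable_add)
qed

lemma bounded_multiplier_mult:
  assumes "bounded_multiplier M m" "bounded_multiplier M m'"
  shows "bounded_multiplier M (\<lambda>x. m x * m' x)"
proof -
  from assms obtain C C' where C: "\<And>x. x \<in> space M \<Longrightarrow> cmod (m x) \<le> C" "\<And>x. x \<in> space M \<Longrightarrow> cmod (m' x) \<le> C'"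
    by (auto simp: bounded_multiplier_def)
  have "\<forall>x\<in>space M. cmod (m x * m' x) \<le> \<bar>C\<bar> * \<bar>C'\<bar>"
    using C by (intro ballI order_trans[OF norm_mult_ineq] mult_mono) (auto intro: order_trans[OF _ abs_ge_self])
  then show ?thesis using assms by (auto simp: bounded_multiplier_def intro!: borel_measurable_times)
qed

lemma bounded_multiplier_scale:
  "bounded_multiplier M m \<Longrightarrow> bounded_multiplier M (\<lambda>x. c * m x)"
  by (rule bounded_multiplier_mult[OF bounded_multiplier_const])

lemma bounded_multiplier_diff:
  "bounded_multiplier M m \<Longrightarrow> bounded_multiplier M m' \<Longrightarrow> bounded_multiplier M (\<lambda>x. m x - m' x)"
  using bounded_multiplier_add[OF _ bounded_multiplier_scale[of M m' "-1"], of m] by simp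

lemma bounded_multiplier_cnj:
  "bounded_multiplier M m \<Longrightarrow> bounded_multiplier M (\<lambda>x. cnj (m x))"
  by (auto simp: bounded_multiplier_def intro: borel_measurable_continuous_onI[THEN measurable_compose[rotated]] continuous_intros)

lemma square_integrable_multiplier:
  fixes f :: "'a \<Rightarrow> 'b::complex_inner"
  assumes m: "bounded_multiplier M m" and f: "square_integrable M f"
  shows "square_integrable M (\<lambda>x. m x *\<^sub>C f x)"
  unfolding square_integrable_def
proof
  have mM: "m \<in> borel_measurable M" using m by (simp add: bounded_multiplier_def)
  then have "strongly_measurable M m" by (simp add: strongly_measurable_iff_borel)
  then show sM: "strongly_measurable M (\<lambda>x. m x *\<^sub>C f x)"
    using f unfolding square_integrable_def
    by (intro strongly_measurable_comp2[where h = "(*\<^sub>C)"] bounded_bilinear.tendsto[OF bounded_bilinear_scaleC]) auto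
  obtain C where C: "\<And>x. x \<in> space M \<Longrightarrow> cmod (m x) \<le> C"
    using m by (auto simp: bounded_multiplier_def)
  show "integrable M (\<lambda>x. (norm (m x *\<^sub>C f x))\<^sup>2)"
  proof (rule Bochner_Integration.integrable_bound)
    show "integrable M (\<lambda>x. C\<^sup>2 * (norm (f x))\<^sup>2)"
      using f by (simp add: square_integrable_def)
    show "(\<lambda>x. (norm (m x *\<^sub>C f x))\<^sup>2) \<in> borel_measurable M"
      using strongly_measurable_imp_borel[OF sM] by measurable
    show "AE x in M. norm ((norm (m x *\<^sub>C f x))\<^sup>2) \<le> norm (C\<^sup>2 * (norm (f x))\<^sup>2)"
      using C by (intro AE_I2) (simp add: norm_scaleC power_mult_distrib mult_right_mono power_mono)
  qed
qed

definition mult_L2 :: "(real^3 \<Rightarrow> complex) \<Rightarrow> ('t::measure_tag, 'b::complex_inner) L2 \<Rightarrow> ('t, 'b) L2" where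
  "mult_L2 m F = to_L2 (\<lambda>x. m x *\<^sub>C fun_of_L2 F x)"

lemma fun_of_mult_L2:
  fixes F :: "('t::measure_tag, 'b::complex_inner) L2"
  assumes "bounded_multiplier (tag_measure TYPE('t)) m"
  shows "AE x in tag_measure TYPE('t). fun_of_L2 (mult_L2 m F) x = m x *\<^sub>C fun_of_L2 F x"
  unfolding mult_L2_def
  by (intro fun_of_L2_to_L2 square_integrable_multiplier assms square_integrable_fun_of_L2)

lemma mult_L2_to_L2:
  fixes f :: "real^3 \<Rightarrow> 'b::complex_inner"
  assumes "square_integrable (tag_measure TYPE('t::measure_tag)) f"
  shows "mult_L2 m (to_L2 f :: ('t,'b) L2) = to_L2 (\<lambda>x. m x *\<^sub>C f x)"
  unfolding mult_L2_def
  by (rule to_L2_cong) (use fun_of_L2_to_L2[OF assms] in \<open>eventually_elim, simp\<close>)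

text \<open>The parameter \<open>dummy\<close> names the tag type in whose measure the bound on m is
  meant; m alone does not determine it.\<close>

context
  fixes m :: "real^3 \<Rightarrow> complex" and dummy :: "'t::measure_tag itself"
  assumes m: "bounded_multiplier (tag_measure TYPE('t)) m"
begin

lemma mult_L2_add: "mult_L2 m (F + G) = mult_L2 m F + mult_L2 m G"
  for F G :: "('t, 'b::complex_inner) L2"
  apply (rule L2_eqI)
  using fun_of_mult_L2[OF m, of "F + G"] fun_of_L2_plus[of F G] fun_of_mult_L2[OF m, of F]
    fun_of_mult_L2[OF m, of G] fun_of_L2_plus[of "mult_L2 m F" "mult_L2 m G"]
  by eventually_elim (simp add: scaleC_add_right)

lemma mult_L2_scaleC: "mult_L2 m (c *\<^sub>C F) = c *\<^sub>C mult_L2 m F"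
  for F :: "('t, 'b::complex_inner) L2"
  apply (rule L2_eqI)
  using fun_of_mult_L2[OF m, of "c *\<^sub>C F"] fun_of_L2_scaleC[of c F] fun_of_mult_L2[OF m, of F]
    fun_of_L2_scaleC[of c "mult_L2 m F"]
  by eventually_elim (simp add: scaleC_scaleC mult.commute)

lemma mult_L2_scaleR: "mult_L2 m (r *\<^sub>R F) = r *\<^sub>R mult_L2 m F"
  for F :: "('t, 'b::complex_inner) L2"
  using mult_L2_scaleC[of "complex_of_real r" F] by (simp add: scaleC_of_real)

lemma inner_mult_L2: "mult_L2 m F \<bullet> G = F \<bullet> mult_L2 (\<lambda>x. cnj (m x)) G"
  for F G :: "('t, 'b::complex_inner) L2"
proof -
  note m' = bounded_multiplier_cnj[OF m]
  note sq = square_integrable_fun_of_L2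
  have "mult_L2 m F \<bullet> to_L2 (fun_of_L2 G) = (\<integral>x. (m x *\<^sub>C fun_of_L2 F x) \<bullet> fun_of_L2 G x \<partial>tag_measure TYPE('t))"
    unfolding mult_L2_def by (rule inner_to_L2[OF square_integrable_multiplier[OF m sq] sq])
  also have "\<dots> = (\<integral>x. fun_of_L2 F x \<bullet> (cnj (m x) *\<^sub>C fun_of_L2 G x) \<partial>tag_measure TYPE('t))"
    by (simp add: inner_scaleC_left)
  also have "\<dots> = to_L2 (fun_of_L2 F) \<bullet> mult_L2 (\<lambda>x. cnj (m x)) G"
    unfolding mult_L2_def by (rule inner_to_L2[OF sq square_integrable_multiplier[OF m' sq], symmetric])
  finally show ?thesis by (simp add: to_L2_fun_of_L2)
qed

lemma norm_mult_L2_le: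
  fixes F :: "('t, 'b::complex_inner) L2"
  assumes "\<And>x. x \<in> space (tag_measure TYPE('t)) \<Longrightarrow> cmod (m x) \<le> C" "C \<ge> 0"
  shows "norm (mult_L2 m F) \<le> C * norm F"
proof (rule power2_le_imp_le)
  let ?M = "tag_measure TYPE('t)"
  have sq: "square_integrable ?M (\<lambda>x. m x *\<^sub>C fun_of_L2 F x)"
    by (rule square_integrable_multiplier[OF m square_integrable_fun_of_L2])
  have "(norm (mult_L2 m F))\<^sup>2 = (\<integral>x. (norm (m x *\<^sub>C fun_of_L2 F x))\<^sup>2 \<partial>?M)"
    unfolding mult_L2_def by (rule norm_to_L2_power2[OF sq])
  also have "\<dots> \<le> (\<integral>x. C\<^sup>2 * (norm (fun_of_L2 F x))\<^sup>2 \<partial>?M)"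
  proof (rule integral_mono)
    show "(norm (m x *\<^sub>C fun_of_L2 F x))\<^sup>2 \<le> C\<^sup>2 * (norm (fun_of_L2 F x))\<^sup>2" if "x \<in> space ?M" for x
      using assms(1)[OF that] by (simp add: norm_scaleC power_mult_distrib mult_right_mono power_mono)
  qed (use sq square_integrable_fun_of_L2[of F] in \<open>auto simp: square_integrable_def\<close>)
  also have "\<dots> = (C * norm F)\<^sup>2"
    by (simp add: norm_power2_eq_L2 power_mult_distrib)
  finally show "(norm (mult_L2 m F))\<^sup>2 \<le> (C * norm F)\<^sup>2" .
qed (use assms in simp)

lemma bounded_linear_mult_L2: "bounded_linear (mult_L2 m :: ('t, 'b::complex_inner) L2 \<Rightarrow> _)"
proof -
  obtain C where "\<And>x. x \<in> space (tag_measure TYPE('t)) \<Longrightarrow> cmod (m x) \<le> C"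
    using m by (auto simp: bounded_multiplier_def)
  then have "cmod (m x) \<le> \<bar>C\<bar>" if "x \<in> space (tag_measure TYPE('t))" for x
    using that by (meson abs_ge_self order_trans)
  then have "norm (mult_L2 m F) \<le> \<bar>C\<bar> * norm F" for F :: "('t, 'b) L2"
    by (rule norm_mult_L2_le) auto
  then show ?thesis
    by (intro bounded_linear_intro[of _ "\<bar>C\<bar>"]) (simp_all add: mult_L2_add mult_L2_scaleR mult.commute)
qed

end

lemma mult_L2_mult:
  fixes F :: "('t::measure_tag, 'b::complex_inner) L2"
  assumes "bounded_multiplier (tag_measure TYPE('t)) m'"
  shows "mult_L2 m (mult_L2 m' F) = mult_L2 (\<lambda>x. m x * m' x) F"
  unfolding mult_L2_def[of m] mult_L2_def[of "\<lambda>x. m x * m' x"]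
  by (rule to_L2_cong) (use fun_of_mult_L2[OF assms, of F] in \<open>eventually_elim, simp add: scaleC_scaleC\<close>)

lemma mult_L2_plus_multiplier:
  fixes F :: "('t::measure_tag, 'b::complex_inner) L2"
  assumes m: "bounded_multiplier (tag_measure TYPE('t)) m" and m': "bounded_multiplier (tag_measure TYPE('t)) m'"
  shows "mult_L2 (\<lambda>x. m x + m' x) F = mult_L2 m F + mult_L2 m' F"
  apply (rule L2_eqI)
  using fun_of_mult_L2[OF bounded_multiplier_add[OF m m'], of F] fun_of_mult_L2[OF m, of F]
    fun_of_mult_L2[OF m', of F] fun_of_L2_plus[of "mult_L2 m F" "mult_L2 m' F"]
  by eventually_elim (simp add: scaleC_add_left)

lemma mult_L2_scale_multiplier:
  fixes F :: "('t::measure_tag, 'b::complex_inner) L2"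
  assumes m: "bounded_multiplier (tag_measure TYPE('t)) m"
  shows "mult_L2 (\<lambda>x. c * m x) F = c *\<^sub>C mult_L2 m F"
  apply (rule L2_eqI)
  using fun_of_mult_L2[OF bounded_multiplier_scale[OF m, of c], of F] fun_of_mult_L2[OF m, of F]
    fun_of_L2_scaleC[of c "mult_L2 m F"]
  by eventually_elim (simp add: scaleC_scaleC)

lemma mult_L2_diff_multiplier:
  fixes F :: "('t::measure_tag, 'b::complex_inner) L2"
  assumes "bounded_multiplier (tag_measure TYPE('t)) m" "bounded_multiplier (tag_measure TYPE('t)) m'"
  shows "mult_L2 (\<lambda>x. m x - m' x) F = mult_L2 m F - mult_L2 m' F"
  using mult_L2_plus_multiplier[OF assms(1) bounded_multiplier_scale[OF assms(2), of "-1"], of F]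
    mult_L2_scale_multiplier[OF assms(2), of "-1" F] by (simp add: scaleC_minus_left)

lemma mult_L2_const: "mult_L2 (\<lambda>_. c) F = c *\<^sub>C F"
  by (simp add: mult_L2_def scaleC_L2_def)

section \<open>Smooth and analytic functions\<close>

text \<open>A local version of \<open>C_k\<close>, because branches are analytic only on their set
  W. It runs through coordinate partials, so that products, inverses and zero extensions can be
  treated by induction on k with the function left general.\<close>

primrec smooth :: "nat \<Rightarrow> (real^3 \<Rightarrow> 'b::real_normed_vector) \<Rightarrow> (real^3) set \<Rightarrow> bool" where
  "smooth 0 f W \<longleftrightarrow> continuous_on W f"
| "smooth (Suc k) f W \<longleftrightarrow> (\<forall>x\<in>W. f differentiable at x) \<and> (\<forall>i. smooth k (partial i f) W)"

lemma partial_eq: "(f has_derivative f') (at x) \<Longrightarrow> partial i f x = f' (axis i 1)"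
  unfolding partial_def by (subst frechet_derivative_at[symmetric]) auto

lemma has_derivative_cong_open:
  assumes "open W" "x \<in> W" "\<And>y. y \<in> W \<Longrightarrow> f y = g y"
  shows "(f has_derivative f') (at x) \<longleftrightarrow> (g has_derivative f') (at x)"
  using assms by (metis has_derivative_transform_within_open)

lemma partial_cong:
  assumes "open W" "x \<in> W" "\<And>y. y \<in> W \<Longrightarrow> f y = g y"
  shows "partial i f x = partial i g x"
  unfolding partial_def frechet_derivative_def using has_derivative_cong_open[OF assms] by simp

lemma smooth_cong:
  assumes "open W" "\<And>x. x \<in> W \<Longrightarrow> f x = g x"
  shows "smooth k f W \<longleftrightarrow> smooth k g W"
  using assms(2)
proof (induction k arbitrary: f g)
  case 0
  then show ?case by (auto intro: continuous_on_cong[THEN iffD1])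
next
  case (Suc k)
  have "smooth k (partial i f) W \<longleftrightarrow> smooth k (partial i g) W" for i
    by (rule Suc.IH) (use partial_cong[OF assms(1)] Suc.prems in metis)
  then show ?case
    using has_derivative_cong_open[OF assms(1) _ Suc.prems] by (auto simp: differentiable_def)
qed

lemma smooth_Suc_imp: "smooth (Suc k) f W \<Longrightarrow> smooth k f W"
proof (induction k arbitrary: f)
  case 0
  then show ?case
    by (auto intro!: continuous_at_imp_continuous_on differentiable_imp_continuous_within)
next
  case (Suc k)
  then show ?case by (metis smooth.simps(2))
qed

lemma smooth_mono: "smooth k f W \<Longrightarrow> j \<le> k \<Longrightarrow> smooth j f W"
  by (induction k) (auto simp: le_Suc_eq smooth_Suc_imp simp del: smooth.simps)

lemma smooth_imp_continuous_on: "smooth k f W \<Longrightarrow> continuous_on W f"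
  using smooth_mono[of k f W 0] by simp

lemma smooth_subset: "smooth k f W \<Longrightarrow> V \<subseteq> W \<Longrightarrow> smooth k f V"
  by (induction k arbitrary: f) (auto intro: continuous_on_subset)

lemma smooth_Un:
  "open U \<Longrightarrow> open V \<Longrightarrow> smooth k f U \<Longrightarrow> smooth k f V \<Longrightarrow> smooth k f (U \<union> V)"
  by (induction k arbitrary: f) (auto intro: continuous_on_open_Un)

lemma smooth_const: "smooth k (\<lambda>x. c) W"
proof (induction k arbitrary: c)
  case (Suc k)
  have "partial i (\<lambda>x. c) = (\<lambda>x. 0)" for i
    by (rule ext) (rule partial_eq[OF has_derivative_const])
  then show ?case using Suc by simp
qed simp

lemma partial_bilinear:
  assumes "bounded_bilinear B" "f differentiable at x" "g differentiable at x"
  shows "(\<lambda>x. B (f x) (g x)) differentiable at x"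
    "partial i (\<lambda>x. B (f x) (g x)) x = B (f x) (partial i g x) + B (partial i f x) (g x)"
proof -
  have *: "((\<lambda>x. B (f x) (g x)) has_derivative
      (\<lambda>h. B (f x) (frechet_derivative g (at x) h) + B (frechet_derivative f (at x) h) (g x))) (at x)"
    using assms by (intro bounded_bilinear.FDERIV) (simp_all add: frechet_derivative_works)
  then show "(\<lambda>x. B (f x) (g x)) differentiable at x" by (rule differentiableI)
  show "partial i (\<lambda>x. B (f x) (g x)) x = B (f x) (partial i g x) + B (partial i f x) (g x)"
    using partial_eq[OF *] by (simp add: partial_def)
qed

lemma smooth_add:
  assumes "open W" "smooth k f W" "smooth k g W"
  shows "smooth k (\<lambda>x. f x + g x) W"
  using assms(2,3)
proof (induction k arbitrary: f g)
  case 0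
  then show ?case by (auto intro: continuous_on_add)
next
  case (Suc k)
  have "smooth k (partial i (\<lambda>x. f x + g x)) W" for i
  proof (subst smooth_cong[OF assms(1)])
    show "smooth k (\<lambda>x. partial i f x + partial i g x) W"
      using Suc by auto
    fix x assume "x \<in> W"
    then have "((\<lambda>x. f x + g x) has_derivative
        (\<lambda>h. frechet_derivative f (at x) h + frechet_derivative g (at x) h)) (at x)"
      using Suc.prems by (intro has_derivative_add) (simp_all add: frechet_derivative_works)
    then show "partial i (\<lambda>x. f x + g x) x = partial i f x + partial i g x"
      using partial_eq by (simp add: partial_def)
  qed
  then show ?case using Suc.prems by auto
qed

lemma smooth_sum:
  assumes "open W" "\<And>i. i \<in> I \<Longrightarrow> smooth k (f i) W"
  shows "smooth k (\<lambda>x. \<Sum>i\<in>I. f i x) W"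
  using assms(2)
  by (induction I rule: infinite_finite_induct) (auto intro: smooth_const smooth_add[OF assms(1)])

lemma smooth_bilinear:
  assumes B: "bounded_bilinear B" and W: "open W" and "smooth k f W" "smooth k g W"
  shows "smooth k (\<lambda>x. B (f x) (g x)) W"
  using assms(3,4)
proof (induction k arbitrary: f g)
  case 0
  then show ?case using bounded_bilinear.continuous_on[OF B] by simp
next
  case (Suc k)
  have "smooth k (partial i (\<lambda>x. B (f x) (g x))) W" for i
  proof (subst smooth_cong[OF W])
    show "smooth k (\<lambda>x. B (f x) (partial i g x) + B (partial i f x) (g x)) W"
      using Suc.prems smooth_Suc_imp[OF Suc.prems(1)] smooth_Suc_imp[OF Suc.prems(2)]
      by (intro smooth_add W Suc.IH) simp_all
  qed (use Suc.prems partial_bilinear(2)[OF B] in auto)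
  then show ?case using Suc.prems partial_bilinear(1)[OF B] by auto
qed

lemma smooth_linear:
  assumes "bounded_linear L" "open W" "smooth k f W"
  shows "smooth k (\<lambda>x. L (f x)) W"
  using assms(3)
proof (induction k arbitrary: f)
  case 0
  then show ?case using linear_continuous_on_compose assms(1) bounded_linear.continuous_on by auto
next
  case (Suc k)
  have D: "((\<lambda>x. L (f x)) has_derivative (\<lambda>h. L (frechet_derivative f (at x) h))) (at x)" if "x \<in> W" for x
    using Suc.prems that by (intro bounded_linear.has_derivative[OF assms(1)]) (simp add: frechet_derivative_works)
  have "smooth k (partial i (\<lambda>x. L (f x))) W" for i
  proof (subst smooth_cong[OF assms(2)])
    show "smooth k (\<lambda>x. L (partial i f x)) W" using Suc by auto
  qed (use partial_eq[OF D] in \<open>auto simp: partial_def\<close>)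
  then show ?case using D by (auto simp: differentiable_def)
qed

lemma smooth_inverse:
  fixes f :: "real^3 \<Rightarrow> real"
  assumes W: "open W" and "smooth k f W" and nz: "\<And>x. x \<in> W \<Longrightarrow> f x \<noteq> 0"
  shows "smooth k (\<lambda>x. inverse (f x)) W"
  using assms(2)
proof (induction k)
  case 0
  then show ?case using nz by (auto intro: continuous_on_inverse)
next
  case (Suc k)
  have D: "((\<lambda>x. inverse (f x)) has_derivative
      (\<lambda>h. - (inverse (f x) * frechet_derivative f (at x) h * inverse (f x)))) (at x)" if "x \<in> W" for x
    using Suc.prems that nz
    by (intro Deriv.has_derivative_inverse) (auto simp: frechet_derivative_works)
  have IH: "smooth k (\<lambda>x. inverse (f x)) W"
    using Suc smooth_Suc_imp by blast
  have "smooth k (partial i (\<lambda>x. inverse (f x))) W" for i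
  proof (subst smooth_cong[OF W])
    show "smooth k (\<lambda>x. - (inverse (f x) * partial i f x * inverse (f x))) W"
      using Suc.prems
      by (intro smooth_linear[OF bounded_linear_minus[OF bounded_linear_ident] W]
          smooth_bilinear[OF bounded_bilinear_mult W] IH) auto
  qed (use partial_eq[OF D] in \<open>auto simp: partial_def\<close>)
  then show ?case using D by (auto simp: differentiable_def)
qed

lemma C_k_imp_smooth: "C_k k f \<Longrightarrow> smooth k f W"
  by (induction k arbitrary: f) (auto simp: partial_def[abs_def] intro: continuous_on_subset)

section \<open>Termwise differentiation of multivariate power series\<close>

text \<open>A finite set of vectors lies in a finite product I x ... x I, over which the sum
  factorises into sums over I. It serves twice: for multi-indices in power series and for lattice
  points in the weighted norm.\<close>

lemma summable_on_prod_vec: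
  fixes f :: "'a \<Rightarrow> real"
  assumes nonneg: "\<And>x. x \<in> S \<Longrightarrow> f x \<ge> 0" and f: "f summable_on S"
  shows "(\<lambda>n :: 'a^'k::finite. \<Prod>i\<in>UNIV. f (n $ i)) summable_on {n. \<forall>i. n $ i \<in> S}"
proof (rule nonneg_bdd_above_summable_on)
  show "(\<Prod>i\<in>UNIV. f (n $ i)) \<ge> 0" if "n \<in> {n. \<forall>i. n $ i \<in> S}" for n :: "'a^'k"
    using that nonneg by (intro prod_nonneg) auto
  show "bdd_above (sum (\<lambda>n :: 'a^'k. \<Prod>i\<in>UNIV. f (n $ i)) ` {F. F \<subseteq> {n. \<forall>i. n $ i \<in> S} \<and> finite F})"
  proof (rule bdd_aboveI2[where M = "(infsum f S) ^ CARD('k)"])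
    fix F :: "('a^'k) set" assume "F \<in> {F. F \<subseteq> {n. \<forall>i. n $ i \<in> S} \<and> finite F}"
    then have F: "F \<subseteq> {n. \<forall>i. n $ i \<in> S}" "finite F" by auto
    define I where "I = (\<Union>i. (\<lambda>n. n $ i) ` F)"
    have I: "finite I" "I \<subseteq> S" using F by (auto simp: I_def)
    have "(\<Sum>n\<in>F. \<Prod>i\<in>UNIV. f (n $ i)) = (\<Sum>g\<in>vec_nth ` F. \<Prod>i\<in>UNIV. f (g i))"
      by (subst sum.reindex) (auto intro: inj_onI simp: vec_nth_inject)
    also have "\<dots> \<le> (\<Sum>g\<in>PiE (UNIV :: 'k set) (\<lambda>_. I). \<Prod>i\<in>UNIV. f (g i))"
    proof (rule sum_mono2)
      show "finite (PiE (UNIV :: 'k set) (\<lambda>_. I))" using I by (intro finite_PiE) auto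
      show "vec_nth ` F \<subseteq> PiE UNIV (\<lambda>_. I)" by (auto simp: I_def)
      show "0 \<le> (\<Prod>i\<in>UNIV. f (g i))" if "g \<in> PiE UNIV (\<lambda>_. I) - vec_nth ` F" for g
        using that I nonneg by (intro prod_nonneg) (auto simp: PiE_iff)
    qed
    also have "\<dots> = (\<Prod>i\<in>(UNIV::'k set). \<Sum>x\<in>I. f x)"
      by (rule prod_sum_PiE[symmetric]) (use I in auto)
    also have "\<dots> \<le> (\<Prod>i\<in>(UNIV::'k set). infsum f S)"
      using I nonneg by (intro prod_mono conjI sum_nonneg finite_sum_le_infsum f) auto
    finally show "(\<Sum>n\<in>F. \<Prod>i\<in>UNIV. f (n $ i)) \<le> (infsum f S) ^ CARD('k)" by simp
  qed
qed

text \<open>Beyond a suitable finite F, one more term is the difference of two partial sums that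
  both lie within 1 of the limit. For a power series this is the bound that starts Abel's
  argument.\<close>

lemma summable_on_norm_bounded:
  fixes f :: "'a \<Rightarrow> 'b::real_normed_vector"
  assumes "f summable_on A"
  shows "\<exists>B. \<forall>x\<in>A. norm (f x) \<le> B"
proof -
  obtain l where "(f has_sum l) A" using assms by (auto simp: summable_on_def)
  then have "\<forall>\<^sub>F F in finite_subsets_at_top A. dist (sum f F) l < 1"
    unfolding has_sum_def by (rule tendstoD) simp
  then have "\<exists>F. finite F \<and> F \<subseteq> A \<and> (\<forall>G. finite G \<and> F \<subseteq> G \<and> G \<subseteq> A \<longrightarrow> dist (sum f G) l < 1)"
    by (simp only: eventually_finite_subsets_at_top)
  then obtain F where F: "finite F" "F \<subseteq> A"
    "\<And>G. finite G \<Longrightarrow> F \<subseteq> G \<Longrightarrow> G \<subseteq> A \<Longrightarrow> dist (sum f G) l < 1"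
    by metis
  have "norm (f x) \<le> (\<Sum>y\<in>F. norm (f y)) + 2" if x: "x \<in> A" for x
  proof (cases "x \<in> F")
    case True
    then have "norm (f x) \<le> (\<Sum>y\<in>F. norm (f y))"
      using F(1) by (intro member_le_sum) auto
    then show ?thesis by simp
  next
    case False
    have "norm (f x) = dist (sum f (insert x F)) (sum f F)"
      using False F(1) by (simp add: dist_norm)
    also have "\<dots> \<le> dist (sum f (insert x F)) l + dist (sum f F) l"
      by (rule dist_triangle2)
    also have "\<dots> \<le> 2"
    proof -
      have "dist (sum f (insert x F)) l < 1" "dist (sum f F) l < 1"
        using F(1,2) x by (auto intro!: F(3))
      then show ?thesis by linarith
    qed
    also have "\<dots> \<le> (\<Sum>y\<in>F. norm (f y)) + 2" by (simp add: sum_nonneg)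
    finally show ?thesis .
  qed
  then show ?thesis by blast
qed

text \<open>The Weierstrass test for derivatives. An enumeration of the countable index set turns
  the unordered sums into series, and the tails of the majorant M give the uniform convergence of
  the derivatives.\<close>

lemma has_derivative_has_sum:
  fixes t :: "'k::countable \<Rightarrow> 'a::real_normed_vector \<Rightarrow> 'b::banach"
  assumes inf: "infinite (UNIV :: 'k set)" and S: "open S" "convex S"
    and t: "\<And>k x. x \<in> S \<Longrightarrow> (t k has_derivative t' k x) (at x)"
    and bound: "\<And>k x h. x \<in> S \<Longrightarrow> norm (t' k x h) \<le> M k * norm h"
    and M: "M summable_on UNIV"
    and f: "\<And>x. x \<in> S \<Longrightarrow> ((\<lambda>k. t k x) has_sum f x) UNIV"
    and x: "x \<in> S"
  shows "f differentiable at x" "((\<lambda>k. t' k x h) has_sum frechet_derivative f (at x) h) UNIV"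
proof -
  define e where "e = from_nat_into (UNIV :: 'k set)"
  have e: "bij_betw e UNIV UNIV"
    unfolding e_def by (rule bij_betw_from_nat_into) (auto simp: inf)
  have Me: "summable (\<lambda>n. M (e n))"
    by (rule summable_on_imp_summable) (use M summable_on_reindex_bij_betw[OF e, of M] in simp)
  have abs_t': "(\<lambda>k. t' k x h) summable_on UNIV" if "x \<in> S" for x h
  proof (rule abs_summable_summable, rule summable_on_comparison_test)
    show "(\<lambda>k. M k * norm h) summable_on UNIV" using M by (rule summable_on_cmult_left)
  qed (use bound[OF that] in auto)
  define g' where "g' x h = infsum (\<lambda>k. t' k x h) UNIV" for x h
  have hs: "((\<lambda>k. t' k x h) has_sum g' x h) UNIV" if "x \<in> S" for x h
    unfolding g'_def by (rule has_sum_infsum[OF abs_t'[OF that]])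
  have sums_t': "(\<lambda>n. t' (e n) x h) sums g' x h" if "x \<in> S" for x h
    by (rule has_sum_imp_sums) (use hs[OF that] has_sum_reindex_bij_betw[OF e, of "\<lambda>k. t' k x h"] in simp)
  have sums_t: "(\<lambda>n. t (e n) x) sums f x" if "x \<in> S" for x
    by (rule has_sum_imp_sums) (use f[OF that] has_sum_reindex_bij_betw[OF e, of "\<lambda>k. t k x"] in simp)
  have "\<exists>g. \<forall>x\<in>S. (\<lambda>n. t (e n) x) sums (g x) \<and> (g has_derivative g' x) (at x within S)"
  proof (rule has_derivative_series[where f = "\<lambda>n. t (e n)" and f' = "\<lambda>n. t' (e n)", OF S(2) _ _ x sums_t[OF x]])
    show "(t (e n) has_derivative t' (e n) x) (at x within S)" if "x \<in> S" for n x
      by (rule has_derivative_at_withinI[OF t[OF that]])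
    fix r :: real assume "r > 0"
    then obtain N where N: "\<And>n. n \<ge> N \<Longrightarrow> norm (\<Sum>i. M (e (i + n))) < r"
      using suminf_exist_split[OF _ Me] by blast
    show "\<forall>\<^sub>F n in sequentially. \<forall>x\<in>S. \<forall>h. norm ((\<Sum>i<n. t' (e i) x h) - g' x h) \<le> r * norm h"
      using eventually_ge_at_top[of N]
    proof (eventually_elim, intro ballI allI)
      fix n x h assume n: "n \<ge> N" and x: "x \<in> S"
      have sm: "summable (\<lambda>i. t' (e i) x h)" using sums_t'[OF x] by (rule sums_summable)
      have Mh: "summable (\<lambda>i. M (e (i + n)) * norm h)"
        by (intro summable_mult2 summable_ignore_initial_segment Me)
      have sn: "summable (\<lambda>i. norm (t' (e (i + n)) x h))"
        by (rule summable_comparison_test'[OF Mh, of 0]) (use bound[OF x] in auto)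
      have "norm ((\<Sum>i<n. t' (e i) x h) - g' x h) = norm (\<Sum>i. t' (e (i + n)) x h)"
        using suminf_minus_initial_segment[OF sm, of n] sums_unique[OF sums_t'[OF x, of h]]
        by (simp add: norm_minus_commute)
      also have "\<dots> \<le> (\<Sum>i. norm (t' (e (i + n)) x h))"
        by (rule summable_norm[OF sn])
      also have "\<dots> \<le> (\<Sum>i. M (e (i + n)) * norm h)"
        by (rule suminf_le[OF bound[OF x] sn Mh])
      also have "\<dots> = (\<Sum>i. M (e (i + n))) * norm h"
        by (rule suminf_mult2[symmetric]) (intro summable_ignore_initial_segment Me)
      also have "\<dots> \<le> r * norm h"
        using N[OF n] by (intro mult_right_mono) auto
      finally show "norm ((\<Sum>i<n. t' (e i) x h) - g' x h) \<le> r * norm h" .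
    qed
  qed
  then obtain g where g: "\<And>x. x \<in> S \<Longrightarrow> (\<lambda>n. t (e n) x) sums (g x)"
    "\<And>x. x \<in> S \<Longrightarrow> (g has_derivative g' x) (at x within S)" by blast
  have "g y = f y" if "y \<in> S" for y
    using g(1)[OF that] sums_t[OF that] by (rule sums_unique2)
  moreover have "(g has_derivative g' x) (at x)"
    using g(2)[OF x] unfolding at_within_open[OF x S(1)] .
  ultimately have "(f has_derivative g' x) (at x)"
    using has_derivative_cong_open[OF S(1) x] by blast
  then show "f differentiable at x" "((\<lambda>k. t' k x h) has_sum frechet_derivative f (at x) h) UNIV"
    using hs[OF x, of h] by (auto simp: differentiable_def dest: frechet_derivative_at)
qed

text \<open>The factor k + 1 pays for the exponent that differentiation brings down; 1/2 is the
  ratio between the half-width of the small cube and the distance at which the coefficients are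
  bounded.\<close>

lemma summable_on_Suc_div_power2: "(\<lambda>k::nat. real (Suc k) * (1/2)^k) summable_on UNIV"
proof -
  have "summable (\<lambda>k. real (Suc k) * (1/2)^k)"
  proof -
    have "(\<lambda>n. (1/2::real)^n * of_nat (n + 1)) sums (1 / (1 - 1/2)\<^sup>2)"
      using geometric_deriv_sums[of "1/2 :: real"] by (simp add: mult.commute)
    then show ?thesis by (auto simp: sums_iff mult.commute)
  qed
  then show ?thesis by (subst summable_on_UNIV_nonneg_real_iff) auto
qed

text \<open>Bounded at $a+\rho(1,1,1)$, the terms of the power series and of its derivative are dominated
  by a convergent series on the cube of half this size.\<close>

lemma real_analytic_on_partial:
  fixes f :: "real^3 \<Rightarrow> 'b::banach"
  assumes "real_analytic_on f W"
  shows "x \<in> W \<Longrightarrow> f differentiable at x" "real_analytic_on (partial i f) W"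
proof -
  have key: "\<exists>r>0. \<exists>c' :: nat^3 \<Rightarrow> 'b. \<forall>x\<in>ball a r. f differentiable at x \<and>
      ((\<lambda>k. (\<Prod>j\<in>UNIV. (x $ j - a $ j) ^ (k $ j)) *\<^sub>R c' k) has_sum partial i f x) UNIV"
    if a: "a \<in> W" for a i
  proof -
    obtain r c where r: "r > 0" and c: "\<And>x. x \<in> ball a r \<Longrightarrow>
        ((\<lambda>k. (\<Prod>j\<in>UNIV. (x $ j - a $ j) ^ (k $ j)) *\<^sub>R c k) has_sum f x) (UNIV :: (nat^3) set)"
      using assms a unfolding real_analytic_on_def by blast
    \<comment> \<open>The corner a + \<rho>(1,1,1) is within 3\<rho> < r of a, so the series
      converges there.\<close>
    define \<rho> where "\<rho> = r / 4"
    have \<rho>: "\<rho> > 0" using r by (simp add: \<rho>_def)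
    define x0 where "x0 = (\<chi> j. a $ j + \<rho>)"
    have "x0 \<in> ball a r"
    proof -
      have "dist a x0 \<le> (\<Sum>j\<in>UNIV. \<bar>(a - x0) $ j\<bar>)"
        unfolding dist_norm by (rule norm_le_l1_cart)
      also have "\<dots> = 3 * \<rho>" using \<rho> by (simp add: x0_def)
      also have "\<dots> < r" using r by (simp add: \<rho>_def)
      finally show ?thesis by simp
    qed
    from summable_on_norm_bounded[OF has_sum_imp_summable[OF c[OF this]]]
    obtain B where B: "\<And>k. norm ((\<Prod>j\<in>UNIV. \<rho> ^ (k $ j)) *\<^sub>R c k) \<le> B"
      by (auto simp: x0_def)
    have B0: "B \<ge> 0" using B[of 0] norm_ge_zero order_trans by blast
    define S where "S = box (\<chi> j. a $ j - \<rho>/2) (\<chi> j. a $ j + \<rho>/2)"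
    have S_iff: "x \<in> S \<longleftrightarrow> (\<forall>j. \<bar>x $ j - a $ j\<bar> < \<rho>/2)" for x
    proof -
      have "a $ j - \<rho>/2 < x $ j \<and> x $ j < a $ j + \<rho>/2 \<longleftrightarrow> \<bar>x $ j - a $ j\<bar> < \<rho>/2" for j by linarith
      then show ?thesis by (simp add: S_def mem_box_cart)
    qed
    have S_sub: "S \<subseteq> ball a r"
    proof
      fix x assume x: "x \<in> S"
      have "dist a x \<le> (\<Sum>j\<in>UNIV. \<bar>(a - x) $ j\<bar>)"
        unfolding dist_norm by (rule norm_le_l1_cart)
      also have "\<dots> \<le> (\<Sum>j\<in>(UNIV::3 set). \<rho>)"
      proof (rule sum_mono)
        fix j :: 3
        have "\<bar>x $ j - a $ j\<bar> < \<rho>/2" using x by (simp add: S_iff)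
        then show "\<bar>(a - x) $ j\<bar> \<le> \<rho>" using \<rho> by (simp add: abs_minus_commute)
      qed
      also have "\<dots> < r" using r by (simp add: \<rho>_def)
      finally show "x \<in> ball a r" by simp
    qed
    define t where "t k x = (\<Prod>j\<in>UNIV. (x $ j - a $ j) ^ (k $ j)) *\<^sub>R c k" for k :: "nat^3" and x
    \<comment> \<open>The i-th partial of the monomial. If k $ i = 0, the leading factor 0 makes the
      truncated exponent k $ i - 1 harmless.\<close>
    define d where "d k i x = of_nat (k $ i) * (x $ i - a $ i) ^ (k $ i - 1) *
        (\<Prod>j\<in>UNIV - {i}. (x $ j - a $ j) ^ (k $ j))" for k :: "nat^3" and i and x :: "real^3"
    define t' where "t' k x h = (\<Sum>i\<in>UNIV. h $ i * d k i x) *\<^sub>R c k" for k :: "nat^3" and x h :: "real^3"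
    have t_deriv: "(t k has_derivative t' k x) (at x)" for k x
      unfolding t_def t'_def
      by (rule has_derivative_eq_rhs, (rule derivative_intros bounded_linear.has_derivative[OF bounded_linear_vec_nth])+)
        (auto simp: fun_eq_iff d_def sum_distrib_right mult_ac intro!: sum.cong)
    define q where "q k = (\<Prod>j\<in>(UNIV::3 set). real (Suc (k $ j)) * (1/2) ^ (k $ j))" for k :: "nat^3"
    have q: "q summable_on UNIV"
      using summable_on_prod_vec[OF _ summable_on_Suc_div_power2] by (simp add: q_def[abs_def])
    have d_bound: "\<bar>d k i x\<bar> * norm (c k) \<le> 2 / \<rho> * B * q k" if x: "x \<in> S" for k i x
    proof -
      let ?u = "\<lambda>j. real (Suc (k $ j)) * (1/2) ^ (k $ j) * \<rho> ^ (k $ j)"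
      have le: "\<bar>x $ j - a $ j\<bar> \<le> \<rho>/2" for j using x by (simp add: S_iff less_imp_le)
      \<comment> \<open>The power lost in direction i costs the factor 2 / \<rho>.\<close>
      have 1: "\<bar>of_nat (k $ i) * (x $ i - a $ i) ^ (k $ i - 1)\<bar> \<le> 2 / \<rho> * ?u i"
      proof (cases "k $ i")
        case (Suc n)
        have "\<bar>x $ i - a $ i\<bar> ^ n \<le> (\<rho>/2) ^ n" by (intro power_mono le) simp
        then have "real (Suc n) * \<bar>x $ i - a $ i\<bar> ^ n \<le> real (Suc (Suc n)) * (\<rho>/2) ^ n"
          using \<rho> by (intro mult_mono) auto
        also have "\<dots> = 2 / \<rho> * (real (Suc (Suc n)) * (1/2) ^ Suc n * \<rho> ^ Suc n)"
          using \<rho> by (simp add: field_simps power_divide)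
        finally show ?thesis by (simp add: Suc abs_mult power_abs)
      qed (use \<rho> in simp)
      have 2: "\<bar>\<Prod>j\<in>UNIV - {i}. (x $ j - a $ j) ^ (k $ j)\<bar> \<le> (\<Prod>j\<in>UNIV - {i}. ?u j)"
        unfolding abs_prod
      proof (intro prod_mono conjI)
        fix j
        have "\<bar>x $ j - a $ j\<bar> ^ (k $ j) \<le> (\<rho>/2) ^ (k $ j)" by (intro power_mono le) simp
        also have "\<dots> \<le> real (Suc (k $ j)) * (\<rho>/2) ^ (k $ j)"
          using \<rho> mult_right_mono[of 1 "real (Suc (k $ j))" "(\<rho>/2) ^ (k $ j)"] by simp
        finally show "\<bar>(x $ j - a $ j) ^ (k $ j)\<bar> \<le> ?u j"
          by (simp add: power_abs power_divide field_simps)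
      qed simp
      have "\<bar>d k i x\<bar> \<le> (2 / \<rho> * ?u i) * (\<Prod>j\<in>UNIV - {i}. ?u j)"
        unfolding d_def abs_mult[of "_ * _"] using 1 2 by (intro mult_mono) (auto simp: \<rho> less_imp_le)
      also have "\<dots> = 2 / \<rho> * (\<Prod>j\<in>UNIV. ?u j)"
        by (simp add: prod.remove[of UNIV i])
      also have "\<dots> = 2 / \<rho> * q k * (\<Prod>j\<in>UNIV. \<rho> ^ (k $ j))"
        by (simp add: q_def prod.distrib)
      finally have "\<bar>d k i x\<bar> * norm (c k) \<le> 2 / \<rho> * q k * ((\<Prod>j\<in>UNIV. \<rho> ^ (k $ j)) * norm (c k))"
        by (metis mult.assoc mult_right_mono norm_ge_zero)
      also have "\<dots> \<le> 2 / \<rho> * q k * B"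
      proof (intro mult_left_mono)
        have "\<bar>\<Prod>j\<in>UNIV. \<rho> ^ (k $ j)\<bar> = (\<Prod>j\<in>UNIV. \<rho> ^ (k $ j))"
          using \<rho> by (intro abs_of_nonneg prod_nonneg) auto
        then show "(\<Prod>j\<in>UNIV. \<rho> ^ (k $ j)) * norm (c k) \<le> B" using B[of k] by simp
        show "0 \<le> 2 / \<rho> * q k"
          unfolding q_def using \<rho> by (intro mult_nonneg_nonneg prod_nonneg) auto
      qed
      finally show ?thesis by (simp add: mult_ac)
    qed
    have t'_bound: "norm (t' k x h) \<le> (3 * (2 / \<rho> * B) * q k) * norm h" if x: "x \<in> S" for k x h
    proof -
      have "norm (t' k x h) \<le> (\<Sum>i\<in>UNIV. \<bar>h $ i\<bar> * \<bar>d k i x\<bar>) * norm (c k)"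
        unfolding t'_def norm_scaleR
        by (intro mult_right_mono order_trans[OF sum_abs]) (auto simp: abs_mult)
      also have "\<dots> = (\<Sum>i\<in>UNIV. \<bar>h $ i\<bar> * (\<bar>d k i x\<bar> * norm (c k)))"
        by (simp add: sum_distrib_right mult.assoc)
      also have "\<dots> \<le> (\<Sum>i\<in>(UNIV::3 set). norm h * (2 / \<rho> * B * q k))"
        by (intro sum_mono mult_mono component_le_norm_cart d_bound x) auto
      finally show ?thesis by (simp add: mult_ac)
    qed
    have inf: "infinite (UNIV :: (nat^3) set)"
      using range_inj_infinite[of "\<lambda>n. (\<chi> i. n) :: nat^3"] finite_subset[OF subset_UNIV]
      by (auto simp: inj_def vec_eq_iff)
    have oc: "open S" "convex S" by (simp_all add: S_def open_box convex_box)
    have S_t: "((\<lambda>k. t k x) has_sum f x) UNIV" if "x \<in> S" for x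
      unfolding t_def using c S_sub that by blast
    note D = has_derivative_has_sum[where S = S and t = t and t' = t',
        OF inf oc t_deriv t'_bound summable_on_cmult_right[OF q] S_t]
    have D1: "f differentiable at x" and
      D2: "((\<lambda>k. t' k x h) has_sum frechet_derivative f (at x) h) UNIV" if "x \<in> S" for x h
      using D that by blast+
    \<comment> \<open>Coefficients of the differentiated series after shifting the index by one in
      direction i.\<close>
    define c' where "c' k = real (Suc (k $ i)) *\<^sub>R c (k + axis i 1)" for k
    have "((\<lambda>k. (\<Prod>j\<in>UNIV. (x $ j - a $ j) ^ (k $ j)) *\<^sub>R c' k) has_sum partial i f x) UNIV"
      if x: "x \<in> S" for x
    proof -
      let ?s = "\<lambda>k :: nat^3. k + axis i 1"
      have inj: "inj ?s" by (auto simp: inj_def)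
      have t'_eq: "t' k x (axis i 1) = d k i x *\<^sub>R c k" for k
      proof -
        have "(\<Sum>j\<in>UNIV. axis i 1 $ j * d k j x) = (\<Sum>j\<in>UNIV. if j = i then d k i x else 0)"
          by (intro sum.cong) (auto simp: axis_def)
        then show ?thesis by (simp add: t'_def)
      qed
      have "((\<lambda>k. d k i x *\<^sub>R c k) has_sum partial i f x) UNIV"
        using D2[OF x, of "axis i 1"] by (simp add: t'_eq partial_def)
      \<comment> \<open>Indices outside the range of the shift have k $ i = 0, and their monomials
        do not depend on the i-th variable.\<close>
      also have "?this \<longleftrightarrow> ((\<lambda>k. d k i x *\<^sub>R c k) has_sum partial i f x) (range ?s)"
      proof (rule has_sum_cong_neutral)
        fix k assume "k \<in> UNIV - range ?s"
        then have "k $ i = 0"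
        proof (rule contrapos_pp)
          assume "k $ i \<noteq> 0"
          then have "k = ?s (\<chi> j. if j = i then k $ i - 1 else k $ j)"
            by (auto simp: vec_eq_iff axis_def)
          then show "k \<notin> UNIV - range ?s" by blast
        qed
        then show "d k i x *\<^sub>R c k = 0" by (simp add: d_def)
      qed auto
      also have "\<dots> \<longleftrightarrow> (((\<lambda>k. d k i x *\<^sub>R c k) \<circ> ?s) has_sum partial i f x) UNIV"
        by (rule has_sum_reindex[OF inj])
      also have "(\<lambda>k. d k i x *\<^sub>R c k) \<circ> ?s = (\<lambda>k. (\<Prod>j\<in>UNIV. (x $ j - a $ j) ^ (k $ j)) *\<^sub>R c' k)"
      proof
        fix k
        have "(\<Prod>j\<in>UNIV - {i}. (x $ j - a $ j) ^ (?s k $ j)) = (\<Prod>j\<in>UNIV - {i}. (x $ j - a $ j) ^ (k $ j))"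
          by (intro prod.cong) (auto simp: axis_def)
        then have "d (?s k) i x = real (Suc (k $ i)) * (\<Prod>j\<in>UNIV. (x $ j - a $ j) ^ (k $ j))"
          by (simp add: d_def axis_def prod.remove[of UNIV i])
        then show "((\<lambda>k. d k i x *\<^sub>R c k) \<circ> ?s) k = (\<Prod>j\<in>UNIV. (x $ j - a $ j) ^ (k $ j)) *\<^sub>R c' k"
          by (simp add: c'_def mult.commute)
      qed
      finally show ?thesis .
    qed
    moreover have "ball a (\<rho>/2) \<subseteq> S"
    proof
      fix x assume "x \<in> ball a (\<rho>/2)"
      then have "\<bar>x $ j - a $ j\<bar> < \<rho>/2" for j
        using component_le_norm_cart[of "x - a" j] by (simp add: dist_norm norm_minus_commute)
      then show "x \<in> S" by (simp add: S_iff)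
    qed
    ultimately show ?thesis
      using D1 \<rho> by (intro exI[of _ "\<rho>/2"] conjI exI[of _ c']) auto
  qed
  show "f differentiable at x" if "x \<in> W" using key[OF that] by force
  show "real_analytic_on (partial i f) W"
    unfolding real_analytic_on_def using key by meson
qed

lemma real_analytic_on_imp_smooth:
  fixes f :: "real^3 \<Rightarrow> 'b::banach"
  shows "real_analytic_on f W \<Longrightarrow> smooth k f W"
proof (induction k arbitrary: f)
  case 0
  then show ?case
    using real_analytic_on_partial(1)[OF 0]
    by (auto intro!: continuous_at_imp_continuous_on differentiable_imp_continuous_within)
next
  case (Suc k)
  then show ?case
    using Suc.IH[OF real_analytic_on_partial(2)[OF Suc.prems]] real_analytic_on_partial(1)[OF Suc.prems]
    by simp
qed

section \<open>Integration by parts\<close>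

text \<open>W and the complement of K form an open cover, and f is smooth on both members: on the
  second it is zero.\<close>

lemma smooth_extend_zero:
  assumes "open W" "closed K" "K \<subseteq> W" "smooth k f W" "\<And>x. x \<notin> K \<Longrightarrow> f x = 0"
  shows "smooth k f UNIV"
proof -
  have "smooth k f (- K)"
    using smooth_cong[of "- K" f "\<lambda>_. 0" k] assms smooth_const[of k 0] by (auto simp: open_Compl)
  then have "smooth k f (W \<union> - K)"
    using assms by (intro smooth_Un) (auto simp: open_Compl)
  moreover have "W \<union> - K = UNIV" using assms(3) by auto
  ultimately show ?thesis by simp
qed

lemma partial_zero_outside:
  fixes f :: "real^3 \<Rightarrow> 'b::real_normed_vector"
  assumes "closed K" "\<And>x. x \<notin> K \<Longrightarrow> f x = 0" "x \<notin> K"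
  shows "partial i f x = 0"
proof -
  have "partial i f x = partial i (\<lambda>_. 0) x"
    by (rule partial_cong[of "- K"]) (use assms in \<open>auto simp: open_Compl\<close>)
  then show ?thesis using partial_eq[OF has_derivative_const, of i "0 :: 'b" x] by simp
qed

text \<open>Translation invariance makes the integral of every difference quotient vanish. The
  quotients converge to the partial derivative, dominated through the mean value theorem, so no
  iterated integral has to be formed.\<close>

lemma integral_partial_real_eq_0:
  fixes g :: "real^3 \<Rightarrow> real"
  assumes g: "smooth 1 g UNIV" and K: "compact K" "K \<subseteq> Pi_star" and zero: "\<And>x. x \<notin> K \<Longrightarrow> g x = 0"
  shows "integral Pi_star (partial i g) = 0"
proof -
  let ?e = "axis i 1 :: real^3"
  have diff: "g differentiable at x" for x using g by simp
  have cont_p: "continuous_on UNIV (partial i g)" using g by simp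
  have cont_g: "continuous_on UNIV g" by (rule smooth_imp_continuous_on[OF g])
  have zero_p: "partial i g x = 0" if "x \<notin> K" for x
    using partial_zero_outside[of K g] K zero that by (auto simp: compact_imp_closed)
  obtain C where C: "\<And>x. \<bar>partial i g x\<bar> \<le> C"
  proof -
    have "compact (partial i g ` K)"
      by (rule compact_continuous_image[OF continuous_on_subset[OF cont_p] K(1)]) simp
    then obtain C where "\<And>x. x \<in> K \<Longrightarrow> \<bar>partial i g x\<bar> \<le> C" "C > 0"
      using compact_imp_bounded bounded_pos by (metis imageI real_norm_def)
    then have "\<bar>partial i g x\<bar> \<le> C" for x using zero_p[of x] by (cases "x \<in> K") auto
    then show ?thesis by (rule that)
  qed
  have C0: "C \<ge> 0" using C[of 0] by linarith
  obtain R where R: "\<And>x. x \<in> K \<Longrightarrow> norm x \<le> R"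
    using compact_imp_bounded[OF K(1)] bounded_iff by blast
  have int_g: "integrable lborel g"
  proof -
    have "(\<lambda>x. indicator K x *\<^sub>R g x) = g" using zero by (auto simp: indicator_def fun_eq_iff)
    then show ?thesis
      using borel_integrable_compact[OF K(1) continuous_on_subset[OF cont_g]] by simp
  qed
  define t where "t n = inverse (real (Suc n))" for n
  have t: "t \<longlonglongrightarrow> 0" "t n > 0" "t n \<le> 1" for n
    unfolding t_def using LIMSEQ_inverse_real_of_nat by (auto simp: inverse_eq_divide)
  define q where "q n x = (g (x + t n *\<^sub>R ?e) - g x) / t n" for n x
  have line: "((\<lambda>s. g (x + s *\<^sub>R ?e)) has_real_derivative partial i g (x + s *\<^sub>R ?e)) (at s)" for x s
  proof -
    let ?D = "frechet_derivative g (at (x + s *\<^sub>R ?e))"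
    have D: "(g has_derivative ?D) (at (x + s *\<^sub>R ?e))"
      using diff by (simp add: frechet_derivative_works)
    have "((\<lambda>s. x + s *\<^sub>R ?e) has_derivative (\<lambda>h. h *\<^sub>R ?e)) (at s)"
      by (auto intro!: derivative_eq_intros)
    from has_derivative_compose[OF this D]
    have "((\<lambda>s. g (x + s *\<^sub>R ?e)) has_derivative (\<lambda>h. ?D (h *\<^sub>R ?e))) (at s)" .
    moreover have "?D (h *\<^sub>R ?e) = partial i g (x + s *\<^sub>R ?e) * h" for h
      using has_derivative_bounded_linear[OF D]
      by (simp add: linear_simps bounded_linear.linear linear_cmul partial_def)
    ultimately show ?thesis
      by (simp add: has_field_derivative_def)
  qed
  have q_mvt: "\<exists>s. 0 < s \<and> s < t n \<and> q n x = partial i g (x + s *\<^sub>R ?e)" for n x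
  proof -
    obtain s where "0 < s" "s < t n"
      "g (x + t n *\<^sub>R ?e) - g (x + 0 *\<^sub>R ?e) = (t n - 0) * partial i g (x + s *\<^sub>R ?e)"
      using MVT2[OF t(2)[of n], of "\<lambda>s. g (x + s *\<^sub>R ?e)" "\<lambda>s. partial i g (x + s *\<^sub>R ?e)"] line by blast
    then show ?thesis using t(2)[of n] by (intro exI[of _ s]) (simp add: q_def)
  qed
  have int_shift: "integrable lborel (\<lambda>x. g (x + c))" "(\<integral>x. g (x + c) \<partial>lborel) = (\<integral>x. g x \<partial>lborel)" for c
  proof -
    have gm: "g \<in> borel_measurable borel" using cont_g by (rule borel_measurable_continuous_onI)
    have "integrable (distr lborel borel ((+) c)) g"
      using int_g by (simp add: lborel_distr_plus)
    then show "integrable lborel (\<lambda>x. g (x + c))"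
      by (subst (asm) integrable_distr_eq) (auto simp: gm add.commute)
    show "(\<integral>x. g (x + c) \<partial>lborel) = (\<integral>x. g x \<partial>lborel)"
      using integral_distr[of "(+) c" lborel borel g] gm by (simp add: lborel_distr_plus add.commute)
  qed
  have int_q: "(\<integral>x. q n x \<partial>lborel) = 0" for n
    unfolding q_def using int_shift[of "t n *\<^sub>R ?e"] int_g by simp
  have "(\<lambda>n. \<integral>x. q n x \<partial>lborel) \<longlonglongrightarrow> (\<integral>x. partial i g x \<partial>lborel)"
  proof (rule integral_dominated_convergence)
    \<comment> \<open>The steps t n are at most 1, so all quotients vanish outside the ball of
      radius R + 1.\<close>
    let ?w = "\<lambda>x. indicator (cball 0 (R + 1)) x *\<^sub>R C"
    show "integrable lborel ?w" by (rule borel_integrable_compact) auto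
    show "partial i g \<in> borel_measurable lborel"
      using cont_p by (simp add: borel_measurable_continuous_onI)
    show "q n \<in> borel_measurable lborel" for n
      unfolding q_def using int_shift(1)[of "t n *\<^sub>R ?e"] int_g
      by (intro borel_measurable_divide borel_measurable_diff) (auto dest: borel_measurable_integrable)
    show "AE x in lborel. norm (q n x) \<le> ?w x" for n
    proof (rule AE_I2)
      fix x
      obtain s where s: "0 < s" "s < t n" "q n x = partial i g (x + s *\<^sub>R ?e)"
        using q_mvt by blast
      show "norm (q n x) \<le> ?w x"
      proof (cases "x + s *\<^sub>R ?e \<in> K")
        case True
        have "norm x \<le> norm (x + s *\<^sub>R ?e) + norm (s *\<^sub>R ?e)"
          using norm_triangle_ineq4[of "x + s *\<^sub>R ?e" "s *\<^sub>R ?e"] by simp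
        also have "\<dots> \<le> R + 1"
          using R[OF True] s(1,2) t(3)[of n] by (intro add_mono) (auto simp: norm_axis_1)
        finally show ?thesis using C[of "x + s *\<^sub>R ?e"] s(3) by (simp add: indicator_def)
      next
        case False
        then show ?thesis using zero_p s(3) C0 by (simp add: indicator_def)
      qed
    qed
    show "AE x in lborel. (\<lambda>n. q n x) \<longlonglongrightarrow> partial i g x"
    proof (rule AE_I2)
      fix x
      have "((\<lambda>h. (g (x + h *\<^sub>R ?e) - g x) / h) \<longlongrightarrow> partial i g x) (at 0)"
        using line[of x 0] by (simp add: has_field_derivative_iff)
      moreover have "filterlim t (at 0) sequentially"
        using t by (auto simp: filterlim_at intro!: always_eventually) (metis less_irrefl)
      ultimately show "(\<lambda>n. q n x) \<longlonglongrightarrow> partial i g x"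
        unfolding q_def by (rule filterlim_compose)
    qed
  qed
  then have "(\<integral>x. partial i g x \<partial>lborel) = 0"
    using int_q LIMSEQ_unique[OF _ tendsto_const] by simp
  moreover have "(\<integral>x. partial i g x \<partial>lborel) = integral Pi_star (partial i g)"
  proof -
    have eq: "(\<lambda>x. indicator Pi_star x *\<^sub>R partial i g x) = partial i g"
      using zero_p K(2) by (force simp: indicator_def)
    have "set_integrable lborel Pi_star (partial i g)"
      unfolding set_integrable_def Pi_star_def
      by (rule borel_integrable_compact) (auto intro: continuous_on_subset[OF cont_p])
    from set_borel_integral_eq_integral(2)[OF this] show ?thesis
      by (simp only: set_lebesgue_integral_def eq)
  qed
  ultimately show ?thesis by simp
qed

lemma integrable_on_Pi_star:
  fixes f :: "real^3 \<Rightarrow> 'b::banach"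
  shows "continuous_on Pi_star f \<Longrightarrow> f integrable_on Pi_star"
  unfolding Pi_star_def by (rule integrable_continuous)

text \<open>Pairing f with the value ?v of the integral itself reduces to the scalar case and shows
  that ?v is orthogonal to itself.\<close>

lemma integral_partial_eq_0:
  fixes f :: "real^3 \<Rightarrow> 'b::{real_inner,banach}"
  assumes f: "smooth 1 f UNIV" and K: "compact K" "K \<subseteq> Pi_star" and zero: "\<And>x. x \<notin> K \<Longrightarrow> f x = 0"
  shows "integral Pi_star (partial i f) = 0"
proof -
  let ?v = "integral Pi_star (partial i f)"
  have int: "partial i f integrable_on Pi_star"
    using f by (intro integrable_on_Pi_star) (auto intro: continuous_on_subset)
  have p: "partial i (\<lambda>x. f x \<bullet> ?v) = (\<lambda>x. partial i f x \<bullet> ?v)"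
  proof
    fix x
    have "((\<lambda>x. f x \<bullet> ?v) has_derivative (\<lambda>h. frechet_derivative f (at x) h \<bullet> ?v)) (at x)"
      using f by (intro has_derivative_inner_left) (simp add: frechet_derivative_works)
    from partial_eq[OF this] show "partial i (\<lambda>x. f x \<bullet> ?v) x = partial i f x \<bullet> ?v"
      by (simp add: partial_def)
  qed
  have "?v \<bullet> ?v = integral Pi_star (\<lambda>x. partial i f x \<bullet> ?v)"
    using integral_linear[OF int bounded_linear_inner_left[of ?v]] by (simp add: comp_def)
  also have "\<dots> = integral Pi_star (partial i (\<lambda>x. f x \<bullet> ?v))" by (simp add: p)
  also have "\<dots> = 0"
    by (rule integral_partial_real_eq_0[OF _ K])
      (use zero smooth_linear[OF bounded_linear_inner_left open_UNIV f] in auto)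
  finally show ?thesis by simp
qed

section \<open>Exponential factors and the logarithmic primitive\<close>

lemma smooth_cis: "smooth k (\<lambda>x. cis (x \<bullet> n)) W"
proof (induction k arbitrary: W)
  case 0
  show ?case by (auto intro!: continuous_intros)
next
  case (Suc k)
  have D: "((\<lambda>x. cis (x \<bullet> n)) has_derivative (\<lambda>h. (\<i> * of_real (h \<bullet> n)) * cis (x \<bullet> n))) (at x)" for x
    by (rule has_derivative_eq_rhs, (rule derivative_intros)+) (auto simp: scaleR_conv_of_real mult_ac)
  have "partial i (\<lambda>x. cis (x \<bullet> n)) = (\<lambda>x. (\<i> * of_real (n $ i)) * cis (x \<bullet> n))" for i
    by (rule ext, subst partial_eq[OF D]) (simp add: inner_axis')
  then have "smooth k (partial i (\<lambda>x. cis (x \<bullet> n))) UNIV" for i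
    using smooth_linear[OF bounded_linear_mult_right open_UNIV Suc.IH, of "\<i> * of_real (n $ i)"] by simp
  then show ?case using D by (auto simp: differentiable_def intro: smooth_subset)
qed

text \<open>The second primitive of $1/v$, which stays bounded as $\mathrm{Re}\,v\to 0$.\<close>

definition Ln_prim :: "complex \<Rightarrow> complex" where
  "Ln_prim v = v * Ln v - v"

lemma Ln_prim_has_derivative:
  "Re v > 0 \<Longrightarrow> (Ln_prim has_field_derivative Ln v) (at v)"
  unfolding Ln_prim_def[abs_def]
proof -
  assume v: "Re v > 0"
  then have "v \<notin> \<real>\<^sub>\<le>\<^sub>0" "v \<noteq> 0" by (auto simp: complex_nonpos_Reals_iff)
  then have "((\<lambda>v. v * Ln v - v) has_field_derivative (1 * Ln v + inverse v * v) - 1) (at v)"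
    by (intro DERIV_diff DERIV_mult DERIV_ident has_field_derivative_Ln)
  then show "((\<lambda>v. v * Ln v - v) has_field_derivative Ln v) (at v)"
    using \<open>v \<noteq> 0\<close> by simp
qed

text \<open>Away from 0 the closed right half-plane does not meet the cut of \<open>Ln\<close>. At 0
  the product v log v tends to 0, because |log v| is at most |ln |v|| + pi.\<close>

lemma continuous_on_Ln_prim: "continuous_on {v. Re v \<ge> 0} Ln_prim"
proof -
  have "continuous (at v within {v. Re v \<ge> 0}) (\<lambda>v. v * Ln v)" if v: "Re v \<ge> 0" for v
  proof (cases "v = 0")
    case False
    then have "v \<notin> \<real>\<^sub>\<le>\<^sub>0" using v by (simp add: complex_nonpos_Reals_iff complex_eq_iff)
    then show ?thesis
      by (rule continuous_at_imp_continuous_at_within[OF isCont_mult[OF continuous_ident continuous_at_Ln]])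
  next
    case True
    have "((\<lambda>v. v * Ln v) \<longlongrightarrow> 0) (at 0)"
    proof (rule Lim_null_comparison)
      have lim: "((\<lambda>x::real. x * (\<bar>ln x\<bar> + pi)) \<longlongrightarrow> 0) (at_right 0)" by real_asymp
      have "filterlim (\<lambda>v::complex. norm v) (at_right 0) (at 0)"
        unfolding filterlim_at by (auto intro!: tendsto_eq_intros simp: eventually_at_filter)
      from filterlim_compose[OF lim this]
      show "((\<lambda>v::complex. norm v * (\<bar>ln (norm v)\<bar> + pi)) \<longlongrightarrow> 0) (at 0)" .
      show "\<forall>\<^sub>F v in at 0. norm (v * Ln v) \<le> norm v * (\<bar>ln (norm v)\<bar> + pi)"
      proof (rule always_eventually, rule allI)
        fix v :: complex
        have "norm (Ln v) \<le> \<bar>ln (norm v)\<bar> + pi" if "v \<noteq> 0"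
        proof -
          have "norm (Ln v) \<le> \<bar>Re (Ln v)\<bar> + \<bar>Im (Ln v)\<bar>" by (rule cmod_le)
          also have "\<dots> \<le> \<bar>ln (norm v)\<bar> + pi"
            using that mpi_less_Im_Ln[of v] Im_Ln_le_pi[of v] by (intro add_mono) (auto simp: abs_le_iff)
          finally show ?thesis .
        qed
        then show "norm (v * Ln v) \<le> norm v * (\<bar>ln (norm v)\<bar> + pi)"
          by (cases "v = 0") (auto simp: norm_mult mult_left_mono)
      qed
    qed
    then have "((\<lambda>v. v * Ln v) \<longlongrightarrow> 0) (at 0 within {v. Re v \<ge> 0})"
      by (rule tendsto_mono[OF at_le[OF subset_UNIV]])
    then show ?thesis using True by (simp add: continuous_within)
  qed
  then have "continuous_on {v. Re v \<ge> 0} (\<lambda>v. v * Ln v)"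
    by (auto simp: continuous_on_eq_continuous_within)
  then show ?thesis unfolding Ln_prim_def[abs_def] by (intro continuous_on_diff continuous_on_id)
qed


section \<open>Transport along the gradient and oscillatory integrals\<close>

text \<open>The i-th component of grad u / |grad u|^2. It is smooth where the gradient does not
  vanish, and is always multiplied by functions supported there.\<close>

definition normal_weight :: "(real^3 \<Rightarrow> real) \<Rightarrow> 3 \<Rightarrow> real^3 \<Rightarrow> real" where
  "normal_weight u i x = partial i u x * inverse (\<Sum>j\<in>UNIV. partial j u x * partial j u x)"

text \<open>The formal adjoint, up to sign, of the field $\nabla u\cdot\nabla/|\nabla u|^2$, which maps $u$ to $1$.\<close>

definition transport :: "(real^3 \<Rightarrow> real) \<Rightarrow> (real^3 \<Rightarrow> 'b::real_normed_vector) \<Rightarrow> real^3 \<Rightarrow> 'b" where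
  "transport u \<Phi> x = (\<Sum>i\<in>UNIV. partial i (\<lambda>x. normal_weight u i x *\<^sub>R \<Phi> x) x)"

text \<open>Smoothness is required on W and vanishing off K separately, so that every operation
  below keeps the same K. For a compact K inside the open set W such a function is smooth on the
  whole space.\<close>

definition cut_smooth :: "(real^3) set \<Rightarrow> (real^3) set \<Rightarrow> (real^3 \<Rightarrow> 'b::real_normed_vector) \<Rightarrow> bool" where
  "cut_smooth W K \<Phi> \<longleftrightarrow> (\<forall>k. smooth k \<Phi> W) \<and> (\<forall>x. x \<notin> K \<longrightarrow> \<Phi> x = 0)"

lemma integral_scaleC:
  fixes f :: "real^3 \<Rightarrow> 'b::{complex_inner,banach}"
  assumes "f integrable_on S"
  shows "integral S (\<lambda>x. c *\<^sub>C f x) = c *\<^sub>C integral S f"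
  using integral_linear[OF assms bounded_linear_scaleC[of c]] by (simp add: comp_def)

context
  fixes u :: "real^3 \<Rightarrow> real" and W K :: "(real^3) set"
  assumes W: "open W" and K: "compact K" "K \<subseteq> W" "K \<subseteq> Pi_star"
    and u: "\<And>k. smooth k u W" and grad: "\<And>x. x \<in> W \<Longrightarrow> \<exists>i. partial i u x \<noteq> 0"
begin

lemma smooth_partial: "smooth k (partial i u) W"
  using u[of "Suc k"] by simp

lemma grad_pos: "x \<in> W \<Longrightarrow> (\<Sum>j\<in>UNIV. partial j u x * partial j u x) > 0"
proof -
  assume "x \<in> W"
  then obtain i where "partial i u x \<noteq> 0" using grad by blast
  then have "0 < partial i u x * partial i u x" by (simp add: zero_less_mult_iff linorder_neq_iff disj_commute)
  also have "\<dots> \<le> (\<Sum>j\<in>UNIV. partial j u x * partial j u x)"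
    by (rule member_le_sum) auto
  finally show ?thesis .
qed

lemma smooth_normal_weight: "smooth k (normal_weight u i) W"
proof -
  have "smooth k (\<lambda>x. inverse (\<Sum>j\<in>UNIV. partial j u x * partial j u x)) W"
  proof (rule smooth_inverse[OF W smooth_sum[OF W]])
    show "smooth k (\<lambda>x. partial j u x * partial j u x) W" for j
      by (rule smooth_bilinear[OF bounded_bilinear_mult W smooth_partial smooth_partial])
    show "(\<Sum>j\<in>UNIV. partial j u x * partial j u x) \<noteq> 0" if "x \<in> W" for x
      by (rule less_imp_neq[symmetric, OF grad_pos[OF that]])
  qed
  then show ?thesis
    unfolding normal_weight_def[abs_def]
    by (rule smooth_bilinear[OF bounded_bilinear_mult W smooth_partial])
qed

lemma sum_normal_weight: "x \<in> W \<Longrightarrow> (\<Sum>i\<in>UNIV. partial i u x * normal_weight u i x) = 1"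
  using grad_pos[of x]
  by (simp add: normal_weight_def mult.assoc[symmetric] flip: sum_distrib_right)

lemma cut_smooth_UNIV: "cut_smooth W K \<Phi> \<Longrightarrow> smooth k \<Phi> UNIV"
  using smooth_extend_zero[OF W compact_imp_closed[OF K(1)] K(2)] by (auto simp: cut_smooth_def)

lemma cut_smooth_zero: "cut_smooth W K \<Phi> \<Longrightarrow> x \<notin> K \<Longrightarrow> \<Phi> x = 0"
  by (simp add: cut_smooth_def)

lemma cut_smooth_differentiable: "cut_smooth W K \<Phi> \<Longrightarrow> \<Phi> differentiable (at x)"
  using cut_smooth_UNIV[of \<Phi> 1] by simp

lemma cut_smooth_bounded:
  assumes "cut_smooth W K \<Phi>" shows "\<exists>C. \<forall>x. norm (\<Phi> x) \<le> C"
proof -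
  have "compact (\<Phi> ` K)"
    using cut_smooth_UNIV[OF assms, of 0] K(1)
    by (intro compact_continuous_image) (auto intro: continuous_on_subset)
  then obtain C where C: "\<And>x. x \<in> K \<Longrightarrow> norm (\<Phi> x) \<le> C" "C > 0"
    using compact_imp_bounded bounded_pos by (metis imageI)
  have "norm (\<Phi> x) \<le> C" for x using C cut_smooth_zero[OF assms, of x] by (cases "x \<in> K") auto
  then show ?thesis by blast
qed

lemma cut_smooth_add: "cut_smooth W K \<Phi> \<Longrightarrow> cut_smooth W K \<Psi> \<Longrightarrow> cut_smooth W K (\<lambda>x. \<Phi> x + \<Psi> x)"
  by (auto simp: cut_smooth_def intro: smooth_add[OF W])

lemma cut_smooth_sum: "(\<And>i. i \<in> I \<Longrightarrow> cut_smooth W K (\<Phi> i)) \<Longrightarrow> cut_smooth W K (\<lambda>x. \<Sum>i\<in>I. \<Phi> i x)"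
  by (auto simp: cut_smooth_def intro!: smooth_sum[OF W] sum.neutral)

lemma cut_smooth_linear: "bounded_linear L \<Longrightarrow> cut_smooth W K \<Phi> \<Longrightarrow> cut_smooth W K (\<lambda>x. L (\<Phi> x))"
  using smooth_linear[OF _ W] by (auto simp: cut_smooth_def linear_simps)

lemma cut_smooth_normal_weight: "cut_smooth W K \<Phi> \<Longrightarrow> cut_smooth W K (\<lambda>x. normal_weight u i x *\<^sub>R \<Phi> x)"
  by (auto simp: cut_smooth_def intro: smooth_bilinear[OF bounded_bilinear_scaleR W smooth_normal_weight])

lemma cut_smooth_partial: "cut_smooth W K \<Phi> \<Longrightarrow> cut_smooth W K (partial i \<Phi>)"
  unfolding cut_smooth_def
proof (intro conjI allI impI)
  fix k assume "(\<forall>k. smooth k \<Phi> W) \<and> (\<forall>x. x \<notin> K \<longrightarrow> \<Phi> x = 0)"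
  then have "smooth (Suc k) \<Phi> W" by blast
  then show "smooth k (partial i \<Phi>) W" by simp
qed (use partial_zero_outside[OF compact_imp_closed[OF K(1)]] in blast)

lemma cut_smooth_transport: "cut_smooth W K \<Phi> \<Longrightarrow> cut_smooth W K (transport u \<Phi>)"
  unfolding transport_def[abs_def]
  by (intro cut_smooth_sum cut_smooth_partial cut_smooth_normal_weight)

lemma cut_smooth_cis:
  fixes \<Phi> :: "real^3 \<Rightarrow> 'b::complex_inner"
  shows "cut_smooth W K \<Phi> \<Longrightarrow> cut_smooth W K (\<lambda>x. cis (x \<bullet> n) *\<^sub>C \<Phi> x)"
  by (auto simp: cut_smooth_def intro: smooth_bilinear[OF bounded_bilinear_scaleC W smooth_cis])

text \<open>The multiplier may be badly behaved off W: the product is zero on the complement of K,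
  which is open and together with W covers the space.\<close>

lemma continuous_on_cut_smooth:
  fixes \<Phi> :: "real^3 \<Rightarrow> 'b::complex_inner"
  assumes "continuous_on W m" "cut_smooth W K \<Phi>"
  shows "continuous_on S (\<lambda>x. m x *\<^sub>C \<Phi> x)"
proof -
  have "smooth 0 (\<lambda>x. m x *\<^sub>C \<Phi> x) W"
    by (rule smooth_bilinear[OF bounded_bilinear_scaleC W]) (use assms in \<open>auto simp: cut_smooth_def smooth_imp_continuous_on\<close>)
  then have "smooth 0 (\<lambda>x. m x *\<^sub>C \<Phi> x) UNIV"
    by (rule smooth_extend_zero[OF W compact_imp_closed[OF K(1)] K(2)])
      (use cut_smooth_zero[OF assms(2)] in simp)
  then show ?thesis by (auto intro: continuous_on_subset)
qed

lemma transport_add: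
  assumes "cut_smooth W K \<Phi>" "cut_smooth W K \<Psi>"
  shows "transport u (\<lambda>x. \<Phi> x + \<Psi> x) x = transport u \<Phi> x + transport u \<Psi> x"
proof -
  have "partial i (\<lambda>x. normal_weight u i x *\<^sub>R (\<Phi> x + \<Psi> x)) x =
      partial i (\<lambda>x. normal_weight u i x *\<^sub>R \<Phi> x) x + partial i (\<lambda>x. normal_weight u i x *\<^sub>R \<Psi> x) x" for i
  proof -
    let ?f = "\<lambda>x. normal_weight u i x *\<^sub>R \<Phi> x" and ?g = "\<lambda>x. normal_weight u i x *\<^sub>R \<Psi> x"
    have "((\<lambda>x. ?f x + ?g x) has_derivative (\<lambda>h. frechet_derivative ?f (at x) h + frechet_derivative ?g (at x) h)) (at x)"
      using assms
      by (intro has_derivative_add) (simp_all add: cut_smooth_differentiable cut_smooth_normal_weight flip: frechet_derivative_works)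
    from partial_eq[OF this] show ?thesis by (simp add: partial_def scaleR_add_right)
  qed
  then show ?thesis by (simp add: transport_def sum.distrib)
qed

lemma transport_linear:
  assumes "bounded_linear L" "cut_smooth W K \<Phi>"
  shows "transport u (\<lambda>x. L (\<Phi> x)) x = L (transport u \<Phi> x)"
proof -
  have "partial i (\<lambda>x. normal_weight u i x *\<^sub>R L (\<Phi> x)) x = L (partial i (\<lambda>x. normal_weight u i x *\<^sub>R \<Phi> x) x)" for i
  proof -
    let ?f = "\<lambda>x. normal_weight u i x *\<^sub>R \<Phi> x"
    have "((\<lambda>x. L (?f x)) has_derivative (\<lambda>h. L (frechet_derivative ?f (at x) h))) (at x)"
      using assms
      by (intro bounded_linear.has_derivative[OF assms(1)])
        (simp add: cut_smooth_differentiable cut_smooth_normal_weight flip: frechet_derivative_works)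
    from partial_eq[OF this] show ?thesis
      using assms(1) by (simp add: partial_def linear_simps)
  qed
  then show ?thesis by (simp add: transport_def linear_sum[OF bounded_linear.linear[OF assms(1)]])
qed

lemma transport_sum:
  assumes "finite I" "\<And>i. i \<in> I \<Longrightarrow> cut_smooth W K (\<Phi> i)"
  shows "transport u (\<lambda>x. \<Sum>i\<in>I. \<Phi> i x) x = (\<Sum>i\<in>I. transport u (\<Phi> i) x)"
  using assms
proof (induction I rule: finite_induct)
  case empty
  show ?case using transport_linear[OF bounded_linear_zero, of "\<lambda>_. 0"]
    by (simp add: cut_smooth_def smooth_const)
next
  case (insert i I)
  then show ?case by (simp add: transport_add cut_smooth_sum)
qed

text \<open>This is \<open>transport u\<close> conjugated by e^{i x.n}; the factors i n_j come from
  differentiating the exponential (\<open>transport_cis\<close>).\<close>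

definition phase_transport :: "real^3 \<Rightarrow> (real^3 \<Rightarrow> 'b::complex_inner) \<Rightarrow> real^3 \<Rightarrow> 'b" where
  "phase_transport n \<Phi> x = transport u \<Phi> x + (\<Sum>i\<in>UNIV. (\<i> * of_real (n $ i)) *\<^sub>C (normal_weight u i x *\<^sub>R \<Phi> x))"

lemma transport_cis:
  fixes \<Phi> :: "real^3 \<Rightarrow> 'b::complex_inner"
  assumes "cut_smooth W K \<Phi>"
  shows "transport u (\<lambda>x. cis (x \<bullet> n) *\<^sub>C \<Phi> x) x = cis (x \<bullet> n) *\<^sub>C phase_transport n \<Phi> x"
proof -
  have "partial i (\<lambda>x. normal_weight u i x *\<^sub>R cis (x \<bullet> n) *\<^sub>C \<Phi> x) x =
    cis (x \<bullet> n) *\<^sub>C (partial i (\<lambda>x. normal_weight u i x *\<^sub>R \<Phi> x) x + (\<i> * of_real (n $ i)) *\<^sub>C (normal_weight u i x *\<^sub>R \<Phi> x))" for i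
  proof -
    have D: "((\<lambda>x. cis (x \<bullet> n)) has_derivative (\<lambda>h. (\<i> * of_real (h \<bullet> n)) * cis (x \<bullet> n))) (at x)"
      by (rule has_derivative_eq_rhs, (rule derivative_intros)+) (auto simp: scaleR_conv_of_real mult_ac)
    have "partial i (\<lambda>x. cis (x \<bullet> n)) x = (\<i> * of_real (n $ i)) * cis (x \<bullet> n)"
      by (subst partial_eq[OF D]) (simp add: inner_axis')
    moreover have "(\<lambda>x. normal_weight u i x *\<^sub>R cis (x \<bullet> n) *\<^sub>C \<Phi> x) = (\<lambda>x. cis (x \<bullet> n) *\<^sub>C (normal_weight u i x *\<^sub>R \<Phi> x))"
      by (simp add: scaleC_scaleR_commute)
    ultimately show ?thesis
      using partial_bilinear(2)[OF bounded_bilinear_scaleC differentiableI[OF D]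
          cut_smooth_differentiable[OF cut_smooth_normal_weight[OF assms, of i]], of i]
      by (simp add: scaleC_add_right scaleC_scaleC mult.commute)
  qed
  then show ?thesis
    by (simp add: transport_def phase_transport_def sum.distrib scaleC_add_right
        linear_sum[OF bounded_linear.linear[OF bounded_linear_scaleC]])
qed

lemma cut_smooth_phase_transport:
  fixes \<Phi> :: "real^3 \<Rightarrow> 'b::complex_inner"
  shows "cut_smooth W K \<Phi> \<Longrightarrow> cut_smooth W K (phase_transport n \<Phi>)"
  unfolding phase_transport_def[abs_def]
  by (intro cut_smooth_add cut_smooth_transport cut_smooth_sum
      cut_smooth_linear[OF bounded_linear_scaleC] cut_smooth_normal_weight)

text \<open>With a_j the multiplication by \<open>normal_weight u j\<close>, the square of T + i
  (n_1 a_1 + n_2 a_2 + n_3 a_3) expands into terms T T, T a_j, a_i T and a_i a_j. None of these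
  depends on n, each yields a bounded function when applied to \<Phi>, and the coefficients are at
  most quadratic in n. This is where the factor (1 + |n|)^2 originates.\<close>

lemma phase_transport_twice_bound:
  fixes \<Phi> :: "real^3 \<Rightarrow> 'b::complex_inner"
  assumes \<Phi>: "cut_smooth W K \<Phi>"
  shows "\<exists>C. \<forall>n x. norm (phase_transport n (phase_transport n \<Phi>) x) \<le> C * (1 + norm n)\<^sup>2"
proof -
  let ?a = "\<lambda>i (\<Psi> :: real^3 \<Rightarrow> 'b) x. normal_weight u i x *\<^sub>R \<Psi> x"
  note cuts = cut_smooth_transport cut_smooth_normal_weight \<Phi>
  obtain B0 where B0: "\<And>x. norm (transport u (transport u \<Phi>) x) \<le> B0"
    using cut_smooth_bounded[of "transport u (transport u \<Phi>)"] cuts by blast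
  have "\<exists>B. \<forall>x. norm (transport u (?a j \<Phi>) x) \<le> B" for j
    using cut_smooth_bounded[of "transport u (?a j \<Phi>)"] cuts by blast
  then obtain B1 where B1: "\<And>j x. norm (transport u (?a j \<Phi>) x) \<le> B1 j" by metis
  have "\<exists>B. \<forall>x. norm (?a j (transport u \<Phi>) x) \<le> B" for j
    using cut_smooth_bounded[of "?a j (transport u \<Phi>)"] cuts by blast
  then obtain B2 where B2: "\<And>j x. norm (?a j (transport u \<Phi>) x) \<le> B2 j" by metis
  have "\<exists>B. \<forall>x. norm (?a i (?a j \<Phi>) x) \<le> B" for i j
    using cut_smooth_bounded[of "?a i (?a j \<Phi>)"] cuts by blast
  then obtain B3 where B3: "\<And>i j x. norm (?a i (?a j \<Phi>) x) \<le> B3 i j" by metis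
  show ?thesis
  proof (intro exI allI)
    fix n x :: "real^3"
    let ?t = "1 + norm n"
    \<comment> \<open>As ?t is at least 1, the terms linear in n fit under the quadratic bound
      too.\<close>
    have n1: "\<bar>n $ i\<bar> \<le> ?t\<^sup>2" for i
    proof -
      have "\<bar>n $ i\<bar> \<le> ?t" using component_le_norm_cart[of n i] by simp
      also have "?t \<le> ?t\<^sup>2" by (rule self_le_power) auto
      finally show ?thesis .
    qed
    have n2: "\<bar>n $ i\<bar> * \<bar>n $ j\<bar> \<le> ?t\<^sup>2" for i j
      unfolding power2_eq_square using component_le_norm_cart[of n i] component_le_norm_cart[of n j]
      by (intro mult_mono) auto
    have sumC: "c *\<^sub>C (\<Sum>i\<in>I. f i) = (\<Sum>i\<in>I. c *\<^sub>C f i)" for c and f :: "3 \<Rightarrow> 'b" and I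
      by (rule linear_sum[OF bounded_linear.linear[OF bounded_linear_scaleC]])
    let ?A = "transport u (transport u \<Phi>) x"
    let ?B = "\<Sum>j\<in>UNIV. (\<i> * of_real (n $ j)) *\<^sub>C transport u (?a j \<Phi>) x"
    let ?C = "\<Sum>i\<in>UNIV. (\<i> * of_real (n $ i)) *\<^sub>C ?a i (transport u \<Phi>) x"
    let ?D = "\<Sum>i\<in>UNIV. \<Sum>j\<in>UNIV. (\<i> * of_real (n $ i) * (\<i> * of_real (n $ j))) *\<^sub>C ?a i (?a j \<Phi>) x"
    have eq: "phase_transport n (phase_transport n \<Phi>) x = ?A + ?B + (?C + ?D)"
    proof -
      have "transport u (phase_transport n \<Phi>) x
          = transport u (transport u \<Phi>) x + (\<Sum>j\<in>UNIV. (\<i> * of_real (n $ j)) *\<^sub>C transport u (?a j \<Phi>) x)"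
        unfolding phase_transport_def[abs_def]
        by (simp add: transport_add transport_sum cuts cut_smooth_sum cut_smooth_linear[OF bounded_linear_scaleC]
            transport_linear[OF bounded_linear_scaleC])
      moreover have "(\<Sum>i\<in>UNIV. (\<i> * of_real (n $ i)) *\<^sub>C (normal_weight u i x *\<^sub>R phase_transport n \<Phi> x))
        = (\<Sum>i\<in>UNIV. (\<i> * of_real (n $ i)) *\<^sub>C ?a i (transport u \<Phi>) x)
        + (\<Sum>i\<in>UNIV. \<Sum>j\<in>UNIV. (\<i> * of_real (n $ i) * (\<i> * of_real (n $ j))) *\<^sub>C ?a i (?a j \<Phi>) x)"
        unfolding phase_transport_def[of n \<Phi>]
        by (simp add: scaleR_add_right scaleC_add_right sum.distrib scaleR_sum_right sumC scaleC_scaleC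
            flip: scaleC_scaleR_commute)
      ultimately show ?thesis by (simp add: phase_transport_def[of n "phase_transport n \<Phi>"])
    qed
    have "norm (?A + ?B + (?C + ?D)) \<le> B0 * ?t\<^sup>2 + (\<Sum>j\<in>UNIV. B1 j * ?t\<^sup>2) + ((\<Sum>i\<in>UNIV. B2 i * ?t\<^sup>2) + (\<Sum>i\<in>UNIV. \<Sum>j\<in>UNIV. B3 i j * ?t\<^sup>2))"
    proof (intro norm_triangle_le add_mono sum_norm_le)
      have nn: "0 \<le> B0" "0 \<le> B1 j" "0 \<le> B2 j" "0 \<le> B3 i j" for i j
        using order_trans[OF norm_ge_zero B0] order_trans[OF norm_ge_zero B1]
          order_trans[OF norm_ge_zero B2] order_trans[OF norm_ge_zero B3] by auto
      have "B0 * 1 \<le> B0 * ?t\<^sup>2" using nn by (intro mult_left_mono) auto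
      then show "norm (transport u (transport u \<Phi>) x) \<le> B0 * ?t\<^sup>2" using B0[of x] by simp
      show "norm ((\<i> * of_real (n $ j)) *\<^sub>C transport u (?a j \<Phi>) x) \<le> B1 j * ?t\<^sup>2" for j
        unfolding norm_scaleC mult.commute[of "cmod _"] using n1 nn B1 by (intro mult_mono) (auto simp: norm_mult)
      show "norm ((\<i> * of_real (n $ j)) *\<^sub>C ?a j (transport u \<Phi>) x) \<le> B2 j * ?t\<^sup>2" for j
        unfolding norm_scaleC mult.commute[of "cmod _"] using n1 nn B2 by (intro mult_mono) (auto simp: norm_mult)
      show "norm ((\<i> * of_real (n $ i) * (\<i> * of_real (n $ j))) *\<^sub>C ?a i (?a j \<Phi>) x) \<le> B3 i j * ?t\<^sup>2" for i j
        unfolding norm_scaleC mult.commute[of "cmod _"] using n2 nn B3 by (intro mult_mono) (auto simp: norm_mult)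
    qed
    also have "\<dots> = (B0 + sum B1 UNIV + (sum B2 UNIV + (\<Sum>i\<in>UNIV. \<Sum>j\<in>UNIV. B3 i j))) * ?t\<^sup>2"
      by (simp add: distrib_right sum_distrib_right)
    finally show "norm (phase_transport n (phase_transport n \<Phi>) x)
        \<le> (B0 + sum B1 UNIV + (sum B2 UNIV + (\<Sum>i\<in>UNIV. \<Sum>j\<in>UNIV. B3 i j))) * ?t\<^sup>2"
      unfolding eq .
  qed
qed

text \<open>Along the field grad u / |grad u|^2 the function h1(\<epsilon> + iu) has derivative i
  h0(\<epsilon> + iu), since the field maps u to 1. The divergence of this field times h1(\<epsilon>
  + iu) \<Phi> has integral zero. Keeping h0 and h1 general allows both passages, from 1/v to log v
  and from log v to v log v - v.\<close>

lemma integration_by_parts_transport: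
  fixes \<Phi> :: "real^3 \<Rightarrow> 'b::{complex_inner,banach}"
  assumes \<Phi>: "cut_smooth W K \<Phi>" and \<epsilon>: "\<epsilon> > 0"
    and h: "\<And>v. Re v > 0 \<Longrightarrow> (h1 has_field_derivative h0 v) (at v)" and h0: "continuous_on {v. Re v > 0} h0"
  shows "integral Pi_star (\<lambda>x. h0 (Complex \<epsilon> (u x)) *\<^sub>C \<Phi> x)
    = \<i> *\<^sub>C integral Pi_star (\<lambda>x. h1 (Complex \<epsilon> (u x)) *\<^sub>C transport u \<Phi> x)"
proof -
  let ?v = "\<lambda>x. Complex \<epsilon> (u x)"
  let ?H = "\<lambda>x. h1 (?v x)"
  have h1: "continuous_on {v. Re v > 0} h1"
    using h by (auto intro!: continuous_at_imp_continuous_on DERIV_isCont)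
  have v_cont: "continuous_on W ?v"
    unfolding Complex_eq using smooth_imp_continuous_on[OF u[of 0]] by (intro continuous_intros)
  have cH: "continuous_on W ?H" and ch0: "continuous_on W (\<lambda>x. h0 (?v x))"
    using \<epsilon> by (auto intro: continuous_on_compose2[OF h1 v_cont] continuous_on_compose2[OF h0 v_cont])
  have DH: "(?H has_derivative (\<lambda>t. h0 (?v x) * (\<i> * of_real (frechet_derivative u (at x) t)))) (at x)" if "x \<in> W" for x
  proof -
    have "(u has_derivative frechet_derivative u (at x)) (at x)"
      using u[of 1] that by (simp add: frechet_derivative_works)
    then have "(?v has_derivative (\<lambda>t. \<i> * of_real (frechet_derivative u (at x) t))) (at x)"
      unfolding Complex_eq by (auto intro!: derivative_eq_intros)
    moreover have "(h1 has_derivative (\<lambda>t. h0 (?v x) * t)) (at (?v x))"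
      using h[of "?v x"] \<epsilon> by (simp add: has_field_derivative_def)
    ultimately show ?thesis by (rule has_derivative_compose)
  qed
  have pH: "partial i ?H x = h0 (?v x) * (\<i> * of_real (partial i u x))" if "x \<in> W" for i x
    using partial_eq[OF DH[OF that], of i] by (simp add: partial_def)
  have sH: "smooth 1 ?H W"
  proof -
    have "continuous_on W (partial i ?H)" for i
      by (subst continuous_on_cong[OF refl pH])
        (use smooth_imp_continuous_on[OF smooth_partial[of 0 i]] ch0 in \<open>auto intro!: continuous_intros\<close>)
    then show ?thesis using DH by (auto simp: differentiable_def)
  qed
  \<comment> \<open>The components of the compactly supported vector field whose divergence is
    integrated.\<close>
  define f where "f i x = ?H x *\<^sub>C (normal_weight u i x *\<^sub>R \<Phi> x)" for i x
  have f_zero: "f i x = 0" if "x \<notin> K" for i x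
    using cut_smooth_zero[OF \<Phi> that] by (simp add: f_def)
  have f_smooth: "smooth 1 (f i) UNIV" for i
    unfolding f_def[abs_def]
  proof (rule smooth_extend_zero[OF W compact_imp_closed[OF K(1)] K(2)])
    show "smooth 1 (\<lambda>x. ?H x *\<^sub>C (normal_weight u i x *\<^sub>R \<Phi> x)) W"
      using cut_smooth_normal_weight[OF \<Phi>, of i]
      by (intro smooth_bilinear[OF bounded_bilinear_scaleC W sH]) (simp add: cut_smooth_def)
  qed (use cut_smooth_zero[OF \<Phi>] in simp)
  have "(\<Sum>i\<in>UNIV. integral Pi_star (partial i (f i))) = 0"
    using integral_partial_eq_0[OF f_smooth K(1,3) f_zero] by simp
  moreover have "(\<Sum>i\<in>UNIV. integral Pi_star (partial i (f i))) = integral Pi_star (\<lambda>x. \<Sum>i\<in>UNIV. partial i (f i) x)"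
    using f_smooth by (subst integral_sum) (auto intro!: integrable_on_Pi_star intro: continuous_on_subset)
  moreover have "(\<lambda>x. \<Sum>i\<in>UNIV. partial i (f i) x) = (\<lambda>x. ?H x *\<^sub>C transport u \<Phi> x + \<i> *\<^sub>C (h0 (?v x) *\<^sub>C \<Phi> x))"
  proof
    fix x
    show "(\<Sum>i\<in>UNIV. partial i (f i) x) = ?H x *\<^sub>C transport u \<Phi> x + \<i> *\<^sub>C (h0 (?v x) *\<^sub>C \<Phi> x)"
    proof (cases "x \<in> K")
      case False
      then show ?thesis
        using partial_zero_outside[OF compact_imp_closed[OF K(1)] f_zero] cut_smooth_zero[OF \<Phi>]
          cut_smooth_zero[OF cut_smooth_transport[OF \<Phi>]] by simp
    next
      case True
      then have x: "x \<in> W" using K(2) by auto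
      have "partial i (f i) x = ?H x *\<^sub>C partial i (\<lambda>x. normal_weight u i x *\<^sub>R \<Phi> x) x
          + (partial i u x * normal_weight u i x) *\<^sub>R (\<i> *\<^sub>C (h0 (?v x) *\<^sub>C \<Phi> x))" for i
        unfolding f_def[abs_def] partial_bilinear(2)[OF bounded_bilinear_scaleC differentiableI[OF DH[OF x]]
          cut_smooth_differentiable[OF cut_smooth_normal_weight[OF \<Phi>]]] pH[OF x]
        by (simp add: scaleC_scaleC scaleC_scaleR_commute mult_ac flip: scaleC_of_real)
      then show ?thesis
        using sum_normal_weight[OF x]
        by (simp add: transport_def sum.distrib linear_sum[OF bounded_linear.linear[OF bounded_linear_scaleC]]
            flip: scaleR_sum_left)
    qed
  qed
  moreover have iA: "(\<lambda>x. ?H x *\<^sub>C transport u \<Phi> x) integrable_on Pi_star"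
    by (intro integrable_on_Pi_star continuous_on_cut_smooth cH cut_smooth_transport \<Phi>)
  moreover have iB: "(\<lambda>x. h0 (?v x) *\<^sub>C \<Phi> x) integrable_on Pi_star"
    by (intro integrable_on_Pi_star continuous_on_cut_smooth ch0 \<Phi>)
  moreover have "(\<lambda>x. \<i> *\<^sub>C (h0 (?v x) *\<^sub>C \<Phi> x)) integrable_on Pi_star"
    using integrable_linear[OF iB bounded_linear_scaleC[of \<i>]] by (simp add: comp_def)
  ultimately have "integral Pi_star (\<lambda>x. ?H x *\<^sub>C transport u \<Phi> x)
      + \<i> *\<^sub>C integral Pi_star (\<lambda>x. h0 (?v x) *\<^sub>C \<Phi> x) = 0"
    by (simp add: integral_add integral_scaleC)
  \<comment> \<open>Since i * i = -1, multiplication by i isolates the integral with h0.\<close>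
  then have "\<i> *\<^sub>C (integral Pi_star (\<lambda>x. ?H x *\<^sub>C transport u \<Phi> x)
      + \<i> *\<^sub>C integral Pi_star (\<lambda>x. h0 (?v x) *\<^sub>C \<Phi> x)) = 0"
    by simp
  then show ?thesis by (simp add: scaleC_add_right scaleC_ii_ii)
qed

text \<open>In \<open>I_eq\<close> the parameter \<epsilon> enters only through
  \<open>Ln_prim\<close>, and n only through an amplitude of quadratic growth. Boundedness of
  \<open>Ln_prim\<close> on a compact rectangle gives the first claim, its uniform continuity there
  the second.\<close>

lemma oscillatory_integral:
  fixes F :: "real^3 \<Rightarrow> 'b::{complex_inner,banach}"
  assumes F: "cut_smooth W K F"
  defines "I n \<epsilon> \<equiv> integral Pi_star (\<lambda>x. (cis (x \<bullet> n) / Complex \<epsilon> (u x)) *\<^sub>C F x)"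
  shows "\<exists>C. \<forall>n. \<forall>\<epsilon>\<in>{0<..1}. norm (I n \<epsilon>) \<le> C * (1 + norm n)\<^sup>2"
    and "\<exists>l. (I n \<longlongrightarrow> l) (at_right 0)"
proof -
  define \<Psi> where "\<Psi> n x = cis (x \<bullet> n) *\<^sub>C phase_transport n (phase_transport n F) x" for n x
  note cut_pt = cut_smooth_phase_transport[OF F] cut_smooth_phase_transport[OF cut_smooth_phase_transport[OF F]]
  have cut_\<Psi>: "cut_smooth W K (\<Psi> n)" for n
    unfolding \<Psi>_def[abs_def] by (intro cut_smooth_cis cut_pt)
  have I_eq: "I n \<epsilon> = - integral Pi_star (\<lambda>x. Ln_prim (Complex \<epsilon> (u x)) *\<^sub>C \<Psi> n x)" if \<epsilon>: "\<epsilon> > 0" for n \<epsilon>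
  proof -
    define \<Phi> where "\<Phi> x = cis (x \<bullet> n) *\<^sub>C F x" for x
    have \<Phi>: "cut_smooth W K \<Phi>" unfolding \<Phi>_def[abs_def] by (rule cut_smooth_cis[OF F])
    have t1: "transport u \<Phi> = (\<lambda>x. cis (x \<bullet> n) *\<^sub>C phase_transport n F x)"
      unfolding \<Phi>_def[abs_def] by (rule ext) (rule transport_cis[OF F])
    have t2: "transport u (transport u \<Phi>) = \<Psi> n"
      unfolding t1 \<Psi>_def[abs_def] by (rule ext) (rule transport_cis[OF cut_pt(1)])
    have "I n \<epsilon> = integral Pi_star (\<lambda>x. inverse (Complex \<epsilon> (u x)) *\<^sub>C \<Phi> x)"
      unfolding I_def \<Phi>_def by (simp add: scaleC_scaleC divide_inverse mult.commute)
    also have "\<dots> = \<i> *\<^sub>C integral Pi_star (\<lambda>x. Ln (Complex \<epsilon> (u x)) *\<^sub>C transport u \<Phi> x)"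
    proof (rule integration_by_parts_transport[OF \<Phi> \<epsilon>])
      show "(Ln has_field_derivative inverse v) (at v)" if "Re v > 0" for v
        using that by (intro has_field_derivative_Ln) (auto simp: complex_nonpos_Reals_iff)
      show "continuous_on {v. Re v > 0} inverse"
        by (intro continuous_on_inverse continuous_on_id) auto
    qed
    also have "integral Pi_star (\<lambda>x. Ln (Complex \<epsilon> (u x)) *\<^sub>C transport u \<Phi> x)
      = \<i> *\<^sub>C integral Pi_star (\<lambda>x. Ln_prim (Complex \<epsilon> (u x)) *\<^sub>C transport u (transport u \<Phi>) x)"
    proof (rule integration_by_parts_transport[OF cut_smooth_transport[OF \<Phi>] \<epsilon> Ln_prim_has_derivative])
      show "continuous_on {v. Re v > 0} Ln"
        by (intro continuous_on_Ln continuous_on_id) (auto simp: complex_nonpos_Reals_iff)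
    qed
    finally show ?thesis by (simp add: t2 scaleC_ii_ii)
  qed
  have u_cont: "continuous_on K u"
    using smooth_imp_continuous_on[OF u[of 0]] K(2) by (rule continuous_on_subset)
  then have "bounded (u ` K)"
    using K(1) by (intro compact_imp_bounded compact_continuous_image)
  then obtain R where R: "\<And>x. x \<in> K \<Longrightarrow> \<bar>u x\<bar> \<le> R"
    unfolding bounded_iff by auto
  \<comment> \<open>All values of \<epsilon> + iu over K for 0 \<le> \<epsilon> \<le> 1. The edge
    \<epsilon> = 0 is included, because the limit is the integral at \<epsilon> = 0.\<close>
  define Q where "Q = cbox (Complex 0 (- R)) (Complex 1 R)"
  have Q: "compact Q" "continuous_on Q Ln_prim"
    by (auto simp: Q_def in_cbox_complex_iff intro: continuous_on_subset[OF continuous_on_Ln_prim])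
  have in_Q: "Complex \<epsilon> (u x) \<in> Q" if "0 \<le> \<epsilon>" "\<epsilon> \<le> 1" "x \<in> K" for \<epsilon> x
    using that R[of x] by (auto simp: Q_def in_cbox_complex_iff abs_le_iff)
  obtain L where L: "\<And>v. v \<in> Q \<Longrightarrow> norm (Ln_prim v) \<le> L" "L > 0"
    using compact_imp_bounded[OF compact_continuous_image[OF Q(2,1)]] bounded_pos
    by (metis imageI)
  define V where "V = measure lborel (cbox 0 ((2 * pi) *\<^sub>R 1 :: real^3))"
  have V: "V \<ge> 0" by (simp add: V_def)
  have int: "(\<lambda>x. Ln_prim (Complex \<epsilon> (u x)) *\<^sub>C \<Psi> n x) integrable_on Pi_star" if "0 \<le> \<epsilon>" for \<epsilon> n
  proof (intro integrable_on_Pi_star continuous_on_cut_smooth cut_\<Psi>)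
    have "continuous_on W (\<lambda>x. Complex \<epsilon> (u x))"
      unfolding Complex_eq using smooth_imp_continuous_on[OF u[of 0]] by (intro continuous_intros)
    then show "continuous_on W (\<lambda>x. Ln_prim (Complex \<epsilon> (u x)))"
      by (rule continuous_on_compose2[OF continuous_on_Ln_prim]) (use that in auto)
  qed
  have bound: "norm (integral Pi_star f) \<le> B * V" if "f integrable_on Pi_star" "B \<ge> 0" "\<And>x. norm (f x) \<le> B"
    for f :: "real^3 \<Rightarrow> 'b" and B
    using has_integral_bound[OF that(2) integrable_integral[OF that(1), unfolded Pi_star_def]] that(3)
    unfolding V_def Pi_star_def by blast
  show "\<exists>C. \<forall>n. \<forall>\<epsilon>\<in>{0<..1}. norm (I n \<epsilon>) \<le> C * (1 + norm n)\<^sup>2"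
  proof -
    obtain C where C: "\<And>n x. norm (phase_transport n (phase_transport n F) x) \<le> C * (1 + norm n)\<^sup>2"
      using phase_transport_twice_bound[OF F] by blast
    have C0: "0 \<le> C * (1 + norm n)\<^sup>2" for n :: "real^3"
      using order_trans[OF norm_ge_zero C] .
    have "norm (I n \<epsilon>) \<le> L * V * C * (1 + norm n)\<^sup>2" if \<epsilon>: "\<epsilon> \<in> {0<..1}" for n \<epsilon>
    proof -
      have "norm (integral Pi_star (\<lambda>x. Ln_prim (Complex \<epsilon> (u x)) *\<^sub>C \<Psi> n x)) \<le> (L * (C * (1 + norm n)\<^sup>2)) * V"
      proof (rule bound)
        fix x
        show "norm (Ln_prim (Complex \<epsilon> (u x)) *\<^sub>C \<Psi> n x) \<le> L * (C * (1 + norm n)\<^sup>2)"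
        proof (cases "x \<in> K")
          case True
          then show ?thesis
            unfolding norm_scaleC using L C \<epsilon> in_Q[of \<epsilon> x]
            by (intro mult_mono) (auto simp: \<Psi>_def norm_scaleC)
        next
          case False
          then show ?thesis using cut_smooth_zero[OF cut_\<Psi>] C0[of n] L(2) by simp
        qed
      qed (use int \<epsilon> L(2) C0 in auto)
      then show ?thesis using \<epsilon> by (simp add: I_eq mult_ac)
    qed
    then show ?thesis by (intro exI[of _ "L * V * C"]) auto
  qed
  show "\<exists>l. (I n \<longlongrightarrow> l) (at_right 0)"
  proof -
    obtain B where B: "\<And>x. norm (\<Psi> n x) \<le> B" using cut_smooth_bounded[OF cut_\<Psi>] by blast
    have B0: "B \<ge> 0" using order_trans[OF norm_ge_zero B] .
    let ?J = "\<lambda>\<epsilon>. integral Pi_star (\<lambda>x. Ln_prim (Complex \<epsilon> (u x)) *\<^sub>C \<Psi> n x)"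
    have "(?J \<longlongrightarrow> ?J 0) (at_right 0)"
    proof (rule tendstoI)
      fix e :: real assume e: "e > 0"
      \<comment> \<open>The summand 1 keeps the denominator positive when B * V is zero.\<close>
      define e' where "e' = e / (B * V + 1)"
      have e': "e' > 0" using e B0 V by (simp add: e'_def add_nonneg_pos)
      obtain d where d: "d > 0" "\<And>v w. v \<in> Q \<Longrightarrow> w \<in> Q \<Longrightarrow> dist w v < d \<Longrightarrow> dist (Ln_prim w) (Ln_prim v) < e'"
        using compact_uniformly_continuous[OF Q(2,1)] e' unfolding uniformly_continuous_on_def by metis
      have "dist (?J \<epsilon>) (?J 0) < e" if \<epsilon>: "0 < \<epsilon>" "\<epsilon> < min d 1" for \<epsilon>
      proof -
        have "?J \<epsilon> - ?J 0 = integral Pi_star (\<lambda>x. (Ln_prim (Complex \<epsilon> (u x)) - Ln_prim (Complex 0 (u x))) *\<^sub>C \<Psi> n x)"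
          using int[of \<epsilon> n] int[of 0 n] \<epsilon>
          by (subst integral_diff[symmetric]) (auto simp: bounded_bilinear.diff_left[OF bounded_bilinear_scaleC])
        also have "norm \<dots> \<le> (e' * B) * V"
        proof (rule bound)
          show "(\<lambda>x. (Ln_prim (Complex \<epsilon> (u x)) - Ln_prim (Complex 0 (u x))) *\<^sub>C \<Psi> n x) integrable_on Pi_star"
            using integrable_diff[OF int[of \<epsilon> n] int[of 0 n]] \<epsilon>
            by (simp add: bounded_bilinear.diff_left[OF bounded_bilinear_scaleC])
          fix x
          show "norm ((Ln_prim (Complex \<epsilon> (u x)) - Ln_prim (Complex 0 (u x))) *\<^sub>C \<Psi> n x) \<le> e' * B"
          proof (cases "x \<in> K")
            case True
            have "dist (Complex \<epsilon> (u x)) (Complex 0 (u x)) < d"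
            proof -
              have "Complex \<epsilon> (u x) - Complex 0 (u x) = complex_of_real \<epsilon>" by (simp add: complex_eq_iff)
              then show ?thesis using \<epsilon> by (simp add: dist_norm)
            qed
            then have "dist (Ln_prim (Complex \<epsilon> (u x))) (Ln_prim (Complex 0 (u x))) < e'"
              using in_Q[of \<epsilon> x] in_Q[of 0 x] True \<epsilon> by (intro d(2)) auto
            then show ?thesis
              unfolding norm_scaleC using B e' by (intro mult_mono) (auto simp: dist_norm)
          next
            case False
            then show ?thesis using cut_smooth_zero[OF cut_\<Psi>] e' B0 by simp
          qed
        qed (use e' B0 in auto)
        also have "\<dots> < e"
        proof -
          have "e' * (B * V) < e' * (B * V + 1)" using e' by simp
          also have "\<dots> = e" using B0 V by (simp add: e'_def add_nonneg_eq_0_iff)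
          finally show ?thesis by (simp add: mult.assoc)
        qed
        finally show ?thesis by (simp add: dist_norm)
      qed
      then show "\<forall>\<^sub>F \<epsilon> in at_right 0. dist (?J \<epsilon>) (?J 0) < e"
        unfolding eventually_at_right_field using d(1) by (intro exI[of _ "min d 1"]) auto
    qed
    then have "((\<lambda>\<epsilon>. - ?J \<epsilon>) \<longlongrightarrow> - ?J 0) (at_right 0)" by (rule tendsto_minus)
    moreover have "\<forall>\<^sub>F \<epsilon> in at_right 0. - ?J \<epsilon> = I n \<epsilon>"
      using eventually_at_right_less[of 0] by eventually_elim (simp add: I_eq)
    ultimately show ?thesis using Lim_transform_eventually by blast
  qed
qed

end

section \<open>Cells\<close>

lemma tag_measure_torus: "tag_measure TYPE(torus) = restrict_space lborel Pi_cell"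
  and tag_measure_whole: "tag_measure TYPE(whole_space) = lborel"
  and tag_measure_lattice: "tag_measure TYPE(integer_lattice) = count_space Z3"
  and tag_measure_brillouin: "tag_measure TYPE(brillouin) = restrict_space lborel Pi_star"
  by (simp_all add: tag_measure_torus_def tag_measure_whole_space_def tag_measure_integer_lattice_def
      tag_measure_brillouin_def)

lemma Pi_cell_borel [measurable]: "Pi_cell \<in> sets borel"
  by (simp add: Pi_cell_def)

lemma Pi_star_borel [measurable]: "Pi_star \<in> sets borel"
  by (simp add: Pi_star_def)

lemma countable_Z3: "countable Z3"
proof -
  have "Z3 \<subseteq> range (\<lambda>k :: int^3. \<chi> i. of_int (k $ i))"
  proof
    fix n assume "n \<in> Z3"
    then have "n = (\<chi> i. of_int (\<lfloor>n $ i\<rfloor>))"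
      by (auto simp: Z3_def vec_eq_iff)
    then show "n \<in> range (\<lambda>k :: int^3. \<chi> i. of_int (k $ i))"
      by (intro image_eqI[of _ _ "\<chi> i. \<lfloor>n $ i\<rfloor>"]) simp_all
  qed
  then show ?thesis by (rule countable_subset) simp
qed

definition floor_vec :: "real^3 \<Rightarrow> real^3" where
  "floor_vec x = (\<chi> i. of_int \<lfloor>x $ i\<rfloor>)"

lemma floor_vec_Z3: "floor_vec x \<in> Z3"
  by (simp add: floor_vec_def Z3_def)

lemma floor_vec_add: "n \<in> Z3 \<Longrightarrow> floor_vec (n + y) = n + floor_vec y"
  by (auto simp: floor_vec_def Z3_def vec_eq_iff elim!: Ints_cases)

lemma floor_vec_diff_in_cell: "x - floor_vec x \<in> Pi_cell"
  by (auto simp: floor_vec_def Pi_cell_def mem_box_cart) linarith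

lemma floor_vec_0_in_cell: "floor_vec y = 0 \<Longrightarrow> y \<in> Pi_cell"
  using floor_vec_diff_in_cell[of y] by simp

lemma measurable_floor_vec [measurable]: "floor_vec \<in> measurable borel (count_space Z3)"
proof (subst measurable_count_space_eq_countable)
  show "floor_vec \<in> space borel \<rightarrow> Z3 \<and> (\<forall>a\<in>Z3. floor_vec -` {a} \<inter> space borel \<in> sets borel)"
  proof (intro conjI ballI)
    fix a :: "real^3"
    have "floor_vec -` {a} = (\<Inter>i. {x. of_int \<lfloor>x $ i\<rfloor> = a $ i})"
      by (auto simp: floor_vec_def vec_eq_iff)
    also have "\<dots> \<in> sets borel" by measurable
    finally show "floor_vec -` {a} \<inter> space borel \<in> sets borel" by simp
  qed (simp add: floor_vec_Z3)
qed (rule countable_Z3)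

text \<open>\<open>Pi_cell\<close> is closed, so its translates share faces. The exceptional points
  have a coordinate equal to 1 and lie on three hyperplanes.\<close>

lemma AE_cell_floor: "AE y in restrict_space lborel Pi_cell. floor_vec y = 0"
proof (subst AE_restrict_space_iff)
  have "AE y::real^3 in lborel. y $ i \<noteq> 1" for i
  proof -
    have "negligible {y::real^3. y \<bullet> axis i 1 = 1}"
      by (rule negligible_standard_hyperplane) (simp add: axis_in_Basis_iff)
    then have "{y::real^3. y $ i = 1} \<in> null_sets lebesgue"
      by (simp add: inner_axis negligible_iff_null_sets)
    then have "{y::real^3. y $ i = 1} \<in> null_sets lborel"
      by (subst (asm) null_sets_completion_iff) auto
    then show ?thesis by (intro AE_I'[where N = "{y. y $ i = 1}"]) auto
  qed
  then have "AE y::real^3 in lborel. \<forall>i. y $ i \<noteq> 1" by (simp add: AE_all_countable)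
  then show "AE y in lborel. y \<in> Pi_cell \<longrightarrow> floor_vec y = 0"
  proof eventually_elim
    case (elim y)
    show ?case
    proof
      assume "y \<in> Pi_cell"
      then have "0 \<le> y $ i \<and> y $ i < 1" for i
        using elim by (auto simp: Pi_cell_def mem_box_cart order_less_le)
      then show "floor_vec y = 0" by (simp add: floor_vec_def vec_eq_iff floor_eq_iff)
    qed
  qed
qed simp

lemma AE_translate:
  assumes "AE x in lborel. P x"
  shows "AE y in lborel. P (n + y :: real^3)"
proof -
  obtain N where N: "N \<in> null_sets lborel" "{x. \<not> P x} \<subseteq> N"
    using assms by (auto elim!: AE_E simp: null_sets_def)
  have "AE x in distr lborel borel ((+) n). x \<notin> N"
    unfolding lborel_distr_plus by (rule AE_not_in[OF N(1)])
  then have "AE y in lborel. n + y \<notin> N"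
    by (subst (asm) AE_distr_iff) (use N in auto)
  then show ?thesis by eventually_elim (use N in auto)
qed

lemma AE_translate_cell:
  assumes "AE x in lborel. P x"
  shows "AE y in restrict_space lborel Pi_cell. P (n + y :: real^3)"
proof (subst AE_restrict_space_iff)
  show "AE y in lborel. y \<in> Pi_cell \<longrightarrow> P (n + y)"
    using AE_translate[OF assms, of n] by eventually_elim simp
qed simp

text \<open>Every point has exactly one lattice point as its floor, so f is the sum of its
  restrictions to the half-open cells. Tonelli exchanges sum and integral, and translation by n
  carries each half-open cell to \<open>Pi_cell\<close> up to a null set.\<close>

lemma nn_integral_cells:
  fixes f :: "real^3 \<Rightarrow> ennreal"
  assumes f: "f \<in> borel_measurable borel"
  shows "(\<integral>\<^sup>+x. f x \<partial>lborel) = (\<integral>\<^sup>+n. (\<integral>\<^sup>+y. f (n + y) \<partial>restrict_space lborel Pi_cell) \<partial>count_space Z3)"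
proof -
  have m: "(\<lambda>x. f x * indicator {x. floor_vec x = n} x) \<in> borel_measurable lborel" for n
  proof -
    have "{x. floor_vec x = n} = (\<Inter>i. {x. of_int \<lfloor>x $ i\<rfloor> = n $ i})"
      by (auto simp: floor_vec_def vec_eq_iff)
    also have "\<dots> \<in> sets borel" by measurable
    finally show ?thesis using f by simp
  qed
  have "(\<integral>\<^sup>+x. f x \<partial>lborel) = (\<integral>\<^sup>+x. (\<integral>\<^sup>+n. f x * indicator {x. floor_vec x = n} x \<partial>count_space Z3) \<partial>lborel)"
  proof (rule nn_integral_cong)
    fix x
    have "(\<integral>\<^sup>+n. f x * indicator {x. floor_vec x = n} x \<partial>count_space Z3)
        = (\<integral>\<^sup>+n. f x * indicator {floor_vec x} n \<partial>count_space Z3)"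
      by (intro nn_integral_cong) (auto simp: indicator_def)
    also have "\<dots> = f x"
      using floor_vec_Z3[of x] by (subst nn_integral_indicator_singleton) (auto simp: emeasure_count_space_finite)
    finally show "f x = (\<integral>\<^sup>+n. f x * indicator {x. floor_vec x = n} x \<partial>count_space Z3)" by simp
  qed
  also have "\<dots> = (\<integral>\<^sup>+n. (\<integral>\<^sup>+x. f x * indicator {x. floor_vec x = n} x \<partial>lborel) \<partial>count_space Z3)"
    by (rule nn_integral_count_space_nn_integral[OF countable_Z3 m])
  also have "\<dots> = (\<integral>\<^sup>+n. (\<integral>\<^sup>+y. f (n + y) \<partial>restrict_space lborel Pi_cell) \<partial>count_space Z3)"
  proof (rule nn_integral_cong)
    fix n assume "n \<in> space (count_space Z3)"
    then have n: "n \<in> Z3" by simp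
    have "(\<integral>\<^sup>+x. f x * indicator {x. floor_vec x = n} x \<partial>lborel)
        = (\<integral>\<^sup>+x. f x * indicator {x. floor_vec x = n} x \<partial>distr lborel borel ((+) n))"
      by (simp add: lborel_distr_plus)
    also have "\<dots> = (\<integral>\<^sup>+y. f (n + y) * indicator {x. floor_vec x = n} (n + y) \<partial>lborel)"
      by (rule nn_integral_distr) (use m[of n] in simp_all)
    also have "\<dots> = (\<integral>\<^sup>+y. f (n + y) * indicator Pi_cell y \<partial>lborel)"
    proof (rule nn_integral_cong_AE)
      have "AE y in lborel. y \<in> Pi_cell \<longrightarrow> floor_vec y = 0"
        using AE_cell_floor by (subst (asm) AE_restrict_space_iff) auto
      then show "AE y in lborel. f (n + y) * indicator {x. floor_vec x = n} (n + y) = f (n + y) * indicator Pi_cell y"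
        by eventually_elim (auto simp: floor_vec_add[OF n] floor_vec_0_in_cell indicator_def)
    qed
    also have "\<dots> = (\<integral>\<^sup>+y. f (n + y) \<partial>restrict_space lborel Pi_cell)"
      by (rule nn_integral_restrict_space[symmetric]) simp
    finally show "(\<integral>\<^sup>+x. f x * indicator {x. floor_vec x = n} x \<partial>lborel)
        = (\<integral>\<^sup>+y. f (n + y) \<partial>restrict_space lborel Pi_cell)" .
  qed
  finally show ?thesis .
qed

lemma summable_on_iff_nn_integral:
  fixes f :: "'a \<Rightarrow> real"
  assumes "\<And>x. x \<in> A \<Longrightarrow> f x \<ge> 0"
  shows "f summable_on A \<longleftrightarrow> (\<integral>\<^sup>+x. ennreal (f x) \<partial>count_space A) < \<infinity>"
proof -
  have "f summable_on A \<longleftrightarrow> (\<lambda>x. norm (f x)) summable_on A"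
    using assms by (intro summable_on_cong) simp
  also have "\<dots> \<longleftrightarrow> integrable (count_space A) f"
    by (rule abs_summable_equivalent[unfolded abs_summable_on_def])
  also have "\<dots> \<longleftrightarrow> (\<integral>\<^sup>+x. ennreal (norm (f x)) \<partial>count_space A) < \<infinity>"
    by (simp add: integrable_iff_bounded)
  also have "(\<integral>\<^sup>+x. ennreal (norm (f x)) \<partial>count_space A) = (\<integral>\<^sup>+x. ennreal (f x) \<partial>count_space A)"
    using assms by (intro nn_integral_cong) simp
  finally show ?thesis .
qed

section \<open>Cutting a function into cells and gluing it back\<close>

definition cell_part :: "(whole_space, complex) L2 \<Rightarrow> real^3 \<Rightarrow> L2_T" where
  "cell_part \<Psi> n = to_L2 (\<lambda>y. fun_of_L2 \<Psi> (n + y))"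

lemma fun_of_L2_whole_borel:
  "fun_of_L2 (\<Psi> :: (whole_space, complex) L2) \<in> borel_measurable borel"
  using square_integrable_fun_of_L2[of \<Psi>]
  by (simp add: square_integrable_def strongly_measurable_iff_borel tag_measure_whole)

lemma square_integrable_translate:
  fixes \<Psi> :: "(whole_space, complex) L2"
  shows "square_integrable (tag_measure TYPE(torus)) (\<lambda>y. fun_of_L2 \<Psi> (n + y))"
  unfolding square_integrable_def
proof
  note [measurable] = fun_of_L2_whole_borel[of \<Psi>]
  show "strongly_measurable (tag_measure TYPE(torus)) (\<lambda>y. fun_of_L2 \<Psi> (n + y))"
    unfolding strongly_measurable_iff_borel tag_measure_torus
    by (intro measurable_restrict_space1) measurable
  have "integrable lborel (\<lambda>x. (norm (fun_of_L2 \<Psi> x))\<^sup>2)"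
    using square_integrable_fun_of_L2[of \<Psi>] by (simp add: square_integrable_def tag_measure_whole)
  then have "integrable (distr lborel borel ((+) n)) (\<lambda>x. (norm (fun_of_L2 \<Psi> x))\<^sup>2)"
    by (simp add: lborel_distr_plus)
  then have "integrable lborel (\<lambda>y. (norm (fun_of_L2 \<Psi> (n + y)))\<^sup>2)"
    by (subst (asm) integrable_distr_eq) auto
  then show "integrable (tag_measure TYPE(torus)) (\<lambda>y. (norm (fun_of_L2 \<Psi> (n + y)))\<^sup>2)"
    unfolding tag_measure_torus
    by (subst integrable_restrict_space) (simp, rule integrable_mult_indicator, simp_all)
qed

lemma fun_of_cell_part:
  "AE y in tag_measure TYPE(torus). fun_of_L2 (cell_part \<Psi> n) y = fun_of_L2 \<Psi> (n + y)"
  unfolding cell_part_def by (rule fun_of_L2_to_L2[OF square_integrable_translate])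

text \<open>Stated with nonnegative integrals, it gives the summability of the squared norms
  together with their sum.\<close>

lemma nn_integral_cell_parts:
  fixes \<Psi> :: "(whole_space, complex) L2"
  shows "(\<integral>\<^sup>+n. ennreal ((norm (cell_part \<Psi> n))\<^sup>2) \<partial>count_space Z3) = ennreal ((norm \<Psi>)\<^sup>2)"
proof -
  note [measurable] = fun_of_L2_whole_borel[of \<Psi>]
  have "ennreal ((norm \<Psi>)\<^sup>2) = (\<integral>\<^sup>+x. ennreal ((norm (fun_of_L2 \<Psi> x))\<^sup>2) \<partial>lborel)"
    using nn_integral_norm_L2[of \<Psi>] by (simp add: tag_measure_whole)
  also have "\<dots> = (\<integral>\<^sup>+n. (\<integral>\<^sup>+y. ennreal ((norm (fun_of_L2 \<Psi> (n + y)))\<^sup>2) \<partial>restrict_space lborel Pi_cell) \<partial>count_space Z3)"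
    by (rule nn_integral_cells) measurable
  also have "\<dots> = (\<integral>\<^sup>+n. ennreal ((norm (cell_part \<Psi> n))\<^sup>2) \<partial>count_space Z3)"
  proof (rule nn_integral_cong)
    fix n
    have "(\<integral>\<^sup>+y. ennreal ((norm (fun_of_L2 \<Psi> (n + y)))\<^sup>2) \<partial>tag_measure TYPE(torus))
        = (\<integral>\<^sup>+y. ennreal ((norm (fun_of_L2 (cell_part \<Psi> n) y))\<^sup>2) \<partial>tag_measure TYPE(torus))"
      using fun_of_cell_part[of \<Psi> n] by (intro nn_integral_cong_AE) (auto elim!: eventually_mono)
    then show "(\<integral>\<^sup>+y. ennreal ((norm (fun_of_L2 \<Psi> (n + y)))\<^sup>2) \<partial>restrict_space lborel Pi_cell)
        = ennreal ((norm (cell_part \<Psi> n))\<^sup>2)"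
      unfolding nn_integral_norm_L2 unfolding tag_measure_torus .
  qed
  finally show ?thesis by simp
qed

lemma summable_cell_parts: "(\<lambda>n. (norm (cell_part \<Psi> n))\<^sup>2) summable_on Z3"
  by (subst summable_on_iff_nn_integral) (simp_all add: nn_integral_cell_parts)

lemma cell_part_add: "cell_part (\<Psi> + \<Phi>) n = cell_part \<Psi> n + cell_part \<Phi> n"
proof (rule L2_eqI)
  have "AE y in tag_measure TYPE(torus). fun_of_L2 (\<Psi> + \<Phi>) (n + y) = fun_of_L2 \<Psi> (n + y) + fun_of_L2 \<Phi> (n + y)"
    unfolding tag_measure_torus
    by (rule AE_translate_cell) (rule fun_of_L2_plus[of \<Psi> \<Phi>, unfolded tag_measure_whole])
  then show "AE y in tag_measure TYPE(torus). fun_of_L2 (cell_part (\<Psi> + \<Phi>) n) y = fun_of_L2 (cell_part \<Psi> n + cell_part \<Phi> n) y"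
    using fun_of_cell_part[of \<Psi> n] fun_of_cell_part[of \<Phi> n] fun_of_cell_part[of "\<Psi> + \<Phi>" n]
      fun_of_L2_plus[of "cell_part \<Psi> n" "cell_part \<Phi> n"]
    by eventually_elim simp
qed

lemma cell_part_scaleC: "cell_part (c *\<^sub>C \<Psi>) n = c *\<^sub>C cell_part \<Psi> n"
proof (rule L2_eqI)
  have "AE y in tag_measure TYPE(torus). fun_of_L2 (c *\<^sub>C \<Psi>) (n + y) = c *\<^sub>C fun_of_L2 \<Psi> (n + y)"
    unfolding tag_measure_torus
    by (rule AE_translate_cell) (rule fun_of_L2_scaleC[of c \<Psi>, unfolded tag_measure_whole])
  then show "AE y in tag_measure TYPE(torus). fun_of_L2 (cell_part (c *\<^sub>C \<Psi>) n) y = fun_of_L2 (c *\<^sub>C cell_part \<Psi> n) y"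
    using fun_of_cell_part[of \<Psi> n] fun_of_cell_part[of "c *\<^sub>C \<Psi>" n] fun_of_L2_scaleC[of c "cell_part \<Psi> n"]
    by eventually_elim simp
qed

text \<open>The inverse of cutting into cells. It is defined for arbitrary families of cells,
  because the limit of the resolvents need not have square summable ones.\<close>

definition glue :: "(real^3 \<Rightarrow> L2_T) \<Rightarrow> real^3 \<Rightarrow> complex" where
  "glue l x = fun_of_L2 (l (floor_vec x)) (x - floor_vec x)"

lemma glue_borel: "glue l \<in> borel_measurable borel"
proof -
  \<comment> \<open>A representative is measurable on the cell only; cut off by the indicator it is
    Borel on the whole space. At the points x - floor_vec x the indicator equals 1.\<close>
  define g where "g n y = indicator Pi_cell y *\<^sub>R fun_of_L2 (l n) y" for n y
  have g: "g n \<in> borel_measurable borel" for n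
  proof -
    have "fun_of_L2 (l n) \<in> borel_measurable (restrict_space lborel Pi_cell)"
      using square_integrable_fun_of_L2[of "l n"]
      by (simp add: square_integrable_def strongly_measurable_iff_borel tag_measure_torus)
    then show ?thesis
      unfolding g_def[abs_def] by (subst (asm) borel_measurable_restrict_space_iff) auto
  qed
  have "(\<lambda>x. g (floor_vec x) (x - floor_vec x)) \<in> borel_measurable borel"
  proof (rule measurable_compose_countable'[OF _ measurable_floor_vec countable_Z3])
    show "(\<lambda>x. g n (x - n)) \<in> borel_measurable borel" for n
      by (rule measurable_compose[OF _ g]) simp
  qed
  also have "(\<lambda>x. g (floor_vec x) (x - floor_vec x)) = glue l"
    using floor_vec_diff_in_cell by (auto simp: g_def glue_def)
  finally show ?thesis .
qed

lemma AE_glue: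
  assumes "n \<in> Z3"
  shows "AE y in tag_measure TYPE(torus). glue l (n + y) = fun_of_L2 (l n) y"
  using AE_cell_floor unfolding tag_measure_torus[symmetric]
  by eventually_elim (simp add: glue_def floor_vec_add[OF assms])

lemma square_integrable_glue_translate:
  assumes "n \<in> Z3"
  shows "square_integrable (tag_measure TYPE(torus)) (\<lambda>y. glue l (n + y))"
  unfolding square_integrable_def
proof
  note [measurable] = glue_borel[of l]
  have m: "(\<lambda>y. glue l (n + y)) \<in> borel_measurable (tag_measure TYPE(torus))"
    unfolding tag_measure_torus by (intro measurable_restrict_space1) measurable
  then show "strongly_measurable (tag_measure TYPE(torus)) (\<lambda>y. glue l (n + y))"
    by (simp add: strongly_measurable_iff_borel)
  have i: "integrable (tag_measure TYPE(torus)) (\<lambda>y. (norm (fun_of_L2 (l n) y))\<^sup>2)"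
    using square_integrable_fun_of_L2[of "l n"] by (simp add: square_integrable_def)
  show "integrable (tag_measure TYPE(torus)) (\<lambda>y. (norm (glue l (n + y)))\<^sup>2)"
    by (rule integrable_cong_AE_imp[OF i]) (use m AE_glue[OF assms, of l] in \<open>auto elim!: eventually_mono\<close>)
qed

lemma to_L2_glue:
  assumes "n \<in> Z3"
  shows "to_L2 (\<lambda>y. glue l (n + y)) = l n"
  using to_L2_cong[OF AE_glue[OF assms], of l] by (simp add: to_L2_fun_of_L2)

lemma square_integrable_glue:
  assumes "(\<lambda>n. (norm (l n))\<^sup>2) summable_on Z3"
  shows "square_integrable (tag_measure TYPE(whole_space)) (glue l)"
  unfolding square_integrable_def tag_measure_whole
proof
  note [measurable] = glue_borel[of l]
  show "strongly_measurable lborel (glue l)"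
    by (simp add: strongly_measurable_iff_borel)
  have "(\<integral>\<^sup>+x. ennreal ((norm (glue l x))\<^sup>2) \<partial>lborel)
      = (\<integral>\<^sup>+n. (\<integral>\<^sup>+y. ennreal ((norm (glue l (n + y)))\<^sup>2) \<partial>restrict_space lborel Pi_cell) \<partial>count_space Z3)"
    by (rule nn_integral_cells) measurable
  also have "\<dots> = (\<integral>\<^sup>+n. ennreal ((norm (l n))\<^sup>2) \<partial>count_space Z3)"
  proof (rule nn_integral_cong)
    fix n assume "n \<in> space (count_space Z3)"
    then have "AE y in tag_measure TYPE(torus). glue l (n + y) = fun_of_L2 (l n) y"
      by (intro AE_glue) simp
    then have "(\<integral>\<^sup>+y. ennreal ((norm (glue l (n + y)))\<^sup>2) \<partial>tag_measure TYPE(torus))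
        = (\<integral>\<^sup>+y. ennreal ((norm (fun_of_L2 (l n) y))\<^sup>2) \<partial>tag_measure TYPE(torus))"
      by (intro nn_integral_cong_AE) (auto elim!: eventually_mono)
    then show "(\<integral>\<^sup>+y. ennreal ((norm (glue l (n + y)))\<^sup>2) \<partial>restrict_space lborel Pi_cell) = ennreal ((norm (l n))\<^sup>2)"
      unfolding nn_integral_norm_L2 unfolding tag_measure_torus .
  qed
  also have "\<dots> < \<infinity>"
    using assms by (subst (asm) summable_on_iff_nn_integral) auto
  finally show "integrable lborel (\<lambda>x. (norm (glue l x))\<^sup>2)"
    by (intro integrableI_bounded) auto
qed

lemma cell_part_glue:
  assumes "(\<lambda>n. (norm (l n))\<^sup>2) summable_on Z3" "n \<in> Z3"
  shows "cell_part (to_L2 (glue l)) n = l n"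
proof -
  have "AE x in lborel. fun_of_L2 (to_L2 (glue l) :: (whole_space, complex) L2) x = glue l x"
    using fun_of_L2_to_L2[OF square_integrable_glue[OF assms(1)]] unfolding tag_measure_whole .
  then have "AE y in tag_measure TYPE(torus). fun_of_L2 (to_L2 (glue l) :: (whole_space, complex) L2) (n + y) = glue l (n + y)"
    unfolding tag_measure_torus by (rule AE_translate_cell)
  then show ?thesis
    unfolding cell_part_def using to_L2_cong to_L2_glue[OF assms(2)] by metis
qed

section \<open>Elements of X^0(R^3) as square summable families of cells\<close>

lemma square_integrable_lattice_iff:
  fixes q :: "real^3 \<Rightarrow> complex^3"
  shows "square_integrable (tag_measure TYPE(integer_lattice)) q \<longleftrightarrow> (\<lambda>n. (norm (q n))\<^sup>2) summable_on Z3"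
  by (simp add: square_integrable_def tag_measure_lattice strongly_measurable_iff_borel
      summable_on_iff_nn_integral integrable_iff_bounded)

definition cell_of :: "X0_R3 \<Rightarrow> real^3 \<Rightarrow> X0_T" where
  "cell_of Y n = cell (quad_of Y) n"

lemma cell_of_eq:
  "cell_of (\<Psi>\<^sub>1, \<Psi>\<^sub>2, q, p) n = (cell_part \<Psi>\<^sub>1 n, cell_part \<Psi>\<^sub>2 n, fun_of_L2 q n, fun_of_L2 p n)"
  by (simp add: cell_of_def cell_def quad_of_def cell_part_def)

lemma norm_X0_T: "(norm (x :: X0_T))\<^sup>2 =
    (norm (fst x))\<^sup>2 + ((norm (fst (snd x)))\<^sup>2 + ((norm (fst (snd (snd x))))\<^sup>2 + (norm (snd (snd (snd x))))\<^sup>2))"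
  by (simp add: norm_prod_def)

lemma summable_cell_of: "(\<lambda>n. (norm (cell_of Y n))\<^sup>2) summable_on Z3"
proof -
  obtain \<Psi>\<^sub>1 \<Psi>\<^sub>2 q p where Y: "Y = (\<Psi>\<^sub>1, \<Psi>\<^sub>2, q, p)" by (cases Y)
  have "(\<lambda>n. (norm (fun_of_L2 q n))\<^sup>2) summable_on Z3" "(\<lambda>n. (norm (fun_of_L2 p n))\<^sup>2) summable_on Z3"
    using square_integrable_fun_of_L2[of q] square_integrable_fun_of_L2[of p]
    by (simp_all add: square_integrable_lattice_iff)
  then show ?thesis
    unfolding Y cell_of_eq norm_X0_T fst_conv snd_conv
    by (intro summable_on_add summable_cell_parts)
qed

lemma fun_of_L2_lattice:
  fixes q p :: "(integer_lattice, complex^3) L2"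
  assumes "n \<in> Z3"
  shows "fun_of_L2 (q + p) n = fun_of_L2 q n + fun_of_L2 p n"
    "fun_of_L2 (c *\<^sub>C q) n = c *\<^sub>C fun_of_L2 q n" "fun_of_L2 (0 :: (integer_lattice, complex^3) L2) n = 0"
  using fun_of_L2_plus[of q p, unfolded tag_measure_lattice AE_count_space]
    fun_of_L2_scaleC[of c q, unfolded tag_measure_lattice AE_count_space]
    fun_of_L2_zero[where 'a = integer_lattice and 'b = "complex^3", unfolded tag_measure_lattice AE_count_space]
    assms by blast+

lemma cell_of_add: "n \<in> Z3 \<Longrightarrow> cell_of (Y + Y') n = cell_of Y n + cell_of Y' n"
  by (cases Y, cases Y') (simp add: cell_of_eq cell_part_add fun_of_L2_lattice)

lemma cell_of_scaleC: "n \<in> Z3 \<Longrightarrow> cell_of (c *\<^sub>C Y) n = c *\<^sub>C cell_of Y n"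
  by (cases Y) (simp add: cell_of_eq cell_part_scaleC fun_of_L2_lattice scaleC_prod_def)

lemma cell_of_zero_imp:
  assumes "\<And>n. n \<in> Z3 \<Longrightarrow> cell_of Y n = 0" shows "Y = 0"
proof -
  obtain \<Psi>\<^sub>1 \<Psi>\<^sub>2 q p where Y: "Y = (\<Psi>\<^sub>1, \<Psi>\<^sub>2, q, p)" by (cases Y)
  have *: "\<Psi> = 0" if "\<And>n. n \<in> Z3 \<Longrightarrow> cell_part \<Psi> n = 0" for \<Psi>
  proof -
    have "ennreal ((norm \<Psi>)\<^sup>2) = (\<integral>\<^sup>+n. 0 \<partial>count_space Z3)"
      unfolding nn_integral_cell_parts[symmetric] using that by (intro nn_integral_cong) simp
    then show ?thesis by (simp add: ennreal_eq_0_iff)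
  qed
  have **: "q = 0" if "\<And>n. n \<in> Z3 \<Longrightarrow> fun_of_L2 q n = 0" for q :: "(integer_lattice, complex^3) L2"
  proof (rule L2_eqI)
    show "AE x in tag_measure TYPE(integer_lattice). fun_of_L2 q x = fun_of_L2 (0 :: (integer_lattice, complex^3) L2) x"
      unfolding tag_measure_lattice AE_count_space using that by (simp add: fun_of_L2_lattice(3))
  qed
  show ?thesis
    using assms * ** by (simp add: Y cell_of_eq zero_prod_def)
qed

lemma cell_of_surj:
  assumes l: "(\<lambda>n. (norm (l n :: X0_T))\<^sup>2) summable_on Z3"
  shows "\<exists>Y. \<forall>n\<in>Z3. cell_of Y n = l n"
proof -
  have le: "(\<lambda>n. (norm (f (l n)))\<^sup>2) summable_on Z3"
    if "\<And>x :: X0_T. (norm (f x))\<^sup>2 \<le> (norm x)\<^sup>2" for f :: "X0_T \<Rightarrow> 'z::real_normed_vector"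
    using l by (rule summable_on_comparison_test) (use that in auto)
  have s: "(\<lambda>n. (norm (fst (l n)))\<^sup>2) summable_on Z3" "(\<lambda>n. (norm (fst (snd (l n))))\<^sup>2) summable_on Z3"
    "(\<lambda>n. (norm (fst (snd (snd (l n)))))\<^sup>2) summable_on Z3" "(\<lambda>n. (norm (snd (snd (snd (l n)))))\<^sup>2) summable_on Z3"
    by (rule le[of "\<lambda>x. fst x"] le[of "\<lambda>x. fst (snd x)"] le[of "\<lambda>x. fst (snd (snd x))"] le[of "\<lambda>x. snd (snd (snd x))"];
        simp add: norm_X0_T)+
  let ?q = "to_L2 (\<lambda>n. fst (snd (snd (l n)))) :: (integer_lattice, complex^3) L2"
  let ?p = "to_L2 (\<lambda>n. snd (snd (snd (l n)))) :: (integer_lattice, complex^3) L2"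
  have "fun_of_L2 ?q n = fst (snd (snd (l n)))" "fun_of_L2 ?p n = snd (snd (snd (l n)))" if "n \<in> Z3" for n
    using fun_of_L2_to_L2[OF s(3)[folded square_integrable_lattice_iff]]
      fun_of_L2_to_L2[OF s(4)[folded square_integrable_lattice_iff]] that
    unfolding tag_measure_lattice AE_count_space by blast+
  then have "\<forall>n\<in>Z3. cell_of (to_L2 (glue (\<lambda>n. fst (l n))), to_L2 (glue (\<lambda>n. fst (snd (l n)))), ?q, ?p) n = l n"
    using cell_part_glue[OF s(1)] cell_part_glue[OF s(2)] by (auto simp: cell_of_eq prod_eq_iff)
  then show ?thesis by blast
qed

section \<open>Orthogonal families\<close>

text \<open>An abstract Fourier series with coefficients in a Hilbert space: each T n is an isometry
  up to the factor sqrt c, and their ranges are mutually orthogonal. The instance below takes the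
  Fourier modes on the Brillouin zone, with c its volume.\<close>

locale orthogonal_family =
  fixes T :: "'i \<Rightarrow> 'x::real_inner \<Rightarrow> 'h::{real_inner,banach}" and A :: "'i set" and c :: real
  assumes linear_T: "linear (T n)"
    and orth: "\<lbrakk>n \<in> A; m \<in> A; n \<noteq> m\<rbrakk> \<Longrightarrow> T n x \<bullet> T m y = 0"
    and isom: "n \<in> A \<Longrightarrow> T n x \<bullet> T n y = c * (x \<bullet> y)"
    and c_pos: "c > 0"
begin

definition partial_sums :: "'h set" where
  "partial_sums = {\<Sum>n\<in>F. T n (x n) | F x. finite F \<and> F \<subseteq> A}"

lemma inner_partial_sum:
  assumes "finite F" "F \<subseteq> A" "m \<in> F"
  shows "T m y \<bullet> (\<Sum>n\<in>F. T n (x n)) = c * (y \<bullet> x m)"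
proof -
  have "T m y \<bullet> (\<Sum>n\<in>F. T n (x n)) = (\<Sum>n\<in>F. T m y \<bullet> T n (x n))"
    by (simp add: inner_sum_right)
  also have "\<dots> = (\<Sum>n\<in>F. if n = m then c * (y \<bullet> x m) else 0)"
    using assms by (intro sum.cong) (auto simp: isom orth subset_iff)
  finally show ?thesis using assms by simp
qed

lemma norm_partial_sum:
  assumes "finite F" "F \<subseteq> A"
  shows "(norm (\<Sum>n\<in>F. T n (x n)))\<^sup>2 = c * (\<Sum>n\<in>F. (norm (x n))\<^sup>2)"
proof -
  have "(\<Sum>m\<in>F. T m (x m)) \<bullet> (\<Sum>n\<in>F. T n (x n)) = (\<Sum>m\<in>F. c * (x m \<bullet> x m))"
    unfolding inner_sum_left using assms by (intro sum.cong) (auto simp: inner_partial_sum)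
  then show ?thesis by (simp add: power2_norm_eq_inner sum_distrib_left)
qed

text \<open>By Pythagoras the squared norm of a block of the series is c times the corresponding
  block of the squared coefficients. The index set carries no order, hence the Cauchy filter over
  finite subsets.\<close>

lemma summable_on_T:
  assumes x: "(\<lambda>n. (norm (x n))\<^sup>2) summable_on A"
  shows "(\<lambda>n. T n (x n)) summable_on A"
proof -
  let ?S = "sum (\<lambda>n. T n (x n))"
  have "cauchy_filter (filtermap ?S (finite_subsets_at_top A))"
    unfolding cauchy_filter_metric_filtermap
  proof (intro allI impI)
    fix e :: real assume e: "e > 0"
    \<comment> \<open>Chosen so that c * d = (e / 2)^2.\<close>
    define d where "d = (e / 2)\<^sup>2 / c"
    have d: "d > 0" using e c_pos by (simp add: d_def)
    have "(sum (\<lambda>n. (norm (x n))\<^sup>2) \<longlongrightarrow> infsum (\<lambda>n. (norm (x n))\<^sup>2) A) (finite_subsets_at_top A)"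
      using has_sum_infsum[OF x] by (simp add: has_sum_def)
    then have "\<forall>\<^sub>F F in finite_subsets_at_top A. sum (\<lambda>n. (norm (x n))\<^sup>2) F > infsum (\<lambda>n. (norm (x n))\<^sup>2) A - d"
      by (rule order_tendstoD) (use d in simp)
    then have "\<exists>F. finite F \<and> F \<subseteq> A \<and> (\<forall>G. finite G \<and> F \<subseteq> G \<and> G \<subseteq> A \<longrightarrow> sum (\<lambda>n. (norm (x n))\<^sup>2) G > infsum (\<lambda>n. (norm (x n))\<^sup>2) A - d)"
      by (simp only: eventually_finite_subsets_at_top)
    then obtain F where F: "finite F" "F \<subseteq> A" "sum (\<lambda>n. (norm (x n))\<^sup>2) F > infsum (\<lambda>n. (norm (x n))\<^sup>2) A - d"
      by blast
    let ?P = "\<lambda>G. finite G \<and> F \<subseteq> G \<and> G \<subseteq> A"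
    have near: "dist (?S G) (?S F) < e / 2" if "?P G" for G
    proof -
      have "?S G - ?S F = ?S (G - F)" using that by (simp add: sum_diff)
      then have "(dist (?S G) (?S F))\<^sup>2 = c * (\<Sum>n\<in>G - F. (norm (x n))\<^sup>2)"
        using that by (simp add: dist_norm norm_partial_sum subset_iff)
      also have "(\<Sum>n\<in>G - F. (norm (x n))\<^sup>2) = (\<Sum>n\<in>G. (norm (x n))\<^sup>2) - (\<Sum>n\<in>F. (norm (x n))\<^sup>2)"
        using that by (simp add: sum_diff)
      also have "(\<Sum>n\<in>G. (norm (x n))\<^sup>2) \<le> infsum (\<lambda>n. (norm (x n))\<^sup>2) A"
        using that by (intro finite_sum_le_infsum[OF x]) auto
      then have "c * ((\<Sum>n\<in>G. (norm (x n))\<^sup>2) - (\<Sum>n\<in>F. (norm (x n))\<^sup>2)) < c * d"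
        using F(3) c_pos by (intro mult_strict_left_mono) auto
      also have "c * d = (e / 2)\<^sup>2" using c_pos by (simp add: d_def)
      finally show ?thesis by (rule power2_less_imp_less) (use e in simp)
    qed
    have "dist (?S G) (?S H) < e" if "?P G" "?P H" for G H
      using near[OF that(1)] near[OF that(2)] dist_triangle2[of "?S G" "?S H" "?S F"] by linarith
    moreover have "eventually ?P (finite_subsets_at_top A)"
      using F by (auto simp: eventually_finite_subsets_at_top)
    ultimately show "\<exists>P. eventually P (finite_subsets_at_top A) \<and> (\<forall>G H. P G \<and> P H \<longrightarrow> dist (?S G) (?S H) < e)"
      by (intro exI[of _ ?P] conjI) simp_all
  qed
  moreover have "complete (UNIV::'h set)"
    by (meson Cauchy_convergent UNIV_I complete_def convergent_def)
  ultimately obtain L where "(?S \<longlongrightarrow> L) (finite_subsets_at_top A)"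
    using complete_uniform[where S=UNIV] by (force simp add: filterlim_def)
  then show ?thesis using summable_on_def has_sum_def by blast
qed

lemma inner_has_sum_T:
  assumes "((\<lambda>n. T n (x n)) has_sum U) A" "m \<in> A"
  shows "T m y \<bullet> U = c * (y \<bullet> x m)"
proof -
  have "((\<lambda>n. T m y \<bullet> T n (x n)) has_sum T m y \<bullet> U) A"
    by (rule has_sum_bounded_linear[OF bounded_linear_inner_right assms(1)])
  moreover have "((\<lambda>n. T m y \<bullet> T n (x n)) has_sum c * (y \<bullet> x m)) A"
    by (rule has_sum_finite_neutralI[of "{m}"]) (use assms(2) in \<open>auto simp: isom orth\<close>)
  ultimately show ?thesis by (rule has_sum_unique)
qed

text \<open>Best approximation: among all sums over a given finite index set the one with the
  coefficients y n is closest to U, since the remainder is orthogonal to the ranges involved. A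
  finite sum that is near U is therefore beaten by every larger partial sum of the expansion.
  Bessel's inequality bounds the coefficients.\<close>

lemma expansion:
  assumes U: "U \<in> closure partial_sums" and y: "\<And>n x. n \<in> A \<Longrightarrow> T n x \<bullet> U = c * (x \<bullet> y n)"
  shows "((\<lambda>n. T n (y n)) has_sum U) A" "(\<lambda>n. (norm (y n))\<^sup>2) summable_on A"
proof -
  let ?S = "sum (\<lambda>n. T n (y n))"
  have orthU: "T n x \<bullet> (U - ?S F) = 0" if "finite F" "F \<subseteq> A" "n \<in> F" for n x F
    using inner_partial_sum[OF that] y[of n x] that by (auto simp: inner_diff_right)
  have split: "(norm (U - (\<Sum>n\<in>F. T n (x n))))\<^sup>2 = (norm (U - ?S F))\<^sup>2 + (norm (\<Sum>n\<in>F. T n (y n - x n)))\<^sup>2"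
    if F: "finite F" "F \<subseteq> A" for F x
  proof -
    have eq: "U - (\<Sum>n\<in>F. T n (x n)) = (U - ?S F) + (\<Sum>n\<in>F. T n (y n - x n))"
      by (simp add: linear_diff[OF linear_T] sum_subtractf)
    have "(\<Sum>n\<in>F. T n (y n - x n)) \<bullet> (U - ?S F) = 0"
      unfolding inner_sum_left using orthU[OF F] by simp
    then show ?thesis
      unfolding eq by (simp add: power2_norm_eq_inner inner_add_left inner_add_right inner_commute)
  qed
  show "((\<lambda>n. T n (y n)) has_sum U) A"
    unfolding has_sum_def
  proof (rule tendstoI)
    fix e :: real assume "e > 0"
    then obtain V where "V \<in> partial_sums" "dist V U < e"
      using U unfolding closure_approachable by blast
    then obtain F x where F: "finite F" "F \<subseteq> A" and V: "dist (\<Sum>n\<in>F. T n (x n)) U < e"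
      by (auto simp: partial_sums_def)
    show "\<forall>\<^sub>F G in finite_subsets_at_top A. dist (?S G) U < e"
      unfolding eventually_finite_subsets_at_top
    proof (intro exI[of _ F] conjI F allI impI)
      fix G assume G: "finite G \<and> F \<subseteq> G \<and> G \<subseteq> A"
      \<comment> \<open>Padding by zeros makes the competitor a sum over the larger set G.\<close>
      define x' where "x' n = (if n \<in> F then x n else 0)" for n
      have "(\<Sum>n\<in>G. T n (x' n)) = (\<Sum>n\<in>F. T n (x n))"
        using G by (intro sum.mono_neutral_cong_right) (auto simp: x'_def linear_0[OF linear_T])
      then have "(norm (U - ?S G))\<^sup>2 \<le> (norm (U - (\<Sum>n\<in>F. T n (x n))))\<^sup>2"
        using split[of G x'] G by simp
      then have "norm (U - ?S G) \<le> norm (U - (\<Sum>n\<in>F. T n (x n)))"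
        by (rule power2_le_imp_le) simp
      then show "dist (?S G) U < e" using V by (simp add: dist_norm norm_minus_commute)
    qed
  qed
  show "(\<lambda>n. (norm (y n))\<^sup>2) summable_on A"
  proof (rule nonneg_bdd_above_summable_on)
    show "bdd_above (sum (\<lambda>n. (norm (y n))\<^sup>2) ` {F. F \<subseteq> A \<and> finite F})"
    proof (rule bdd_aboveI2)
      fix F assume "F \<in> {F. F \<subseteq> A \<and> finite F}"
      then have F: "finite F" "F \<subseteq> A" by auto
      have "(norm U)\<^sup>2 = (norm (U - ?S F))\<^sup>2 + (norm (?S F))\<^sup>2"
        using split[OF F, of "\<lambda>_. 0"] by (simp add: linear_0[OF linear_T])
      then have "c * (\<Sum>n\<in>F. (norm (y n))\<^sup>2) \<le> (norm U)\<^sup>2"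
        using norm_partial_sum[OF F, of y] by simp
      then show "(\<Sum>n\<in>F. (norm (y n))\<^sup>2) \<le> (norm U)\<^sup>2 / c"
        using c_pos by (simp add: field_simps)
    qed
  qed simp
qed

lemma partial_sums_add:
  assumes "U \<in> partial_sums" "V \<in> partial_sums" shows "U + V \<in> partial_sums"
proof -
  from assms obtain F x G y where
    F: "finite F" "F \<subseteq> A" "U = (\<Sum>n\<in>F. T n (x n))" and G: "finite G" "G \<subseteq> A" "V = (\<Sum>n\<in>G. T n (y n))"
    by (auto simp: partial_sums_def)
  define x' where "x' n = (if n \<in> F then x n else 0)" for n
  define y' where "y' n = (if n \<in> G then y n else 0)" for n
  have "U = (\<Sum>n\<in>F \<union> G. T n (x' n))" "V = (\<Sum>n\<in>F \<union> G. T n (y' n))"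
    unfolding F(3) G(3) using F(1) G(1)
    by (auto intro!: sum.mono_neutral_cong_left simp: x'_def y'_def linear_0[OF linear_T])
  then have "U + V = (\<Sum>n\<in>F \<union> G. T n (x' n + y' n))"
    by (simp add: sum.distrib linear_add[OF linear_T])
  then show ?thesis
    unfolding partial_sums_def using F G by (intro CollectI exI[of _ "F \<union> G"] exI[of _ "\<lambda>n. x' n + y' n"]) auto
qed

lemma closure_partial_sums_add:
  assumes "U \<in> closure partial_sums" "V \<in> closure partial_sums"
  shows "U + V \<in> closure partial_sums"
proof -
  obtain u v where "\<And>k::nat. u k \<in> partial_sums" "u \<longlonglongrightarrow> U" "\<And>k::nat. v k \<in> partial_sums" "v \<longlonglongrightarrow> V"
    using assms by (auto simp: closure_sequential)
  then show ?thesis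
    unfolding closure_sequential by (intro exI[of _ "\<lambda>k. u k + v k"]) (auto intro: partial_sums_add tendsto_add)
qed

lemma has_sum_in_closure: "((\<lambda>n. T n (x n)) has_sum U) A \<Longrightarrow> U \<in> closure partial_sums"
  unfolding has_sum_def
proof (rule Lim_in_closed_set[OF closed_closure])
  have "(\<Sum>n\<in>F. T n (x n)) \<in> partial_sums" if "finite F" "F \<subseteq> A" for F
    using that by (auto simp: partial_sums_def)
  then show "\<forall>\<^sub>F F in finite_subsets_at_top A. (\<Sum>n\<in>F. T n (x n)) \<in> closure partial_sums"
    using closure_subset by (intro eventually_finite_subsets_at_top_weakI) blast
qed auto

end

section \<open>The phase operators\<close>

lemma bounded_multiplier_restrict:
  assumes "compact S" "continuous_on S m"
  shows "bounded_multiplier (restrict_space lborel S) m"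
proof -
  have "m \<in> borel_measurable (restrict_space borel S)"
    by (rule borel_measurable_continuous_on_restrict[OF assms(2)])
  moreover obtain C where "\<forall>x\<in>S. cmod (m x) \<le> C"
    using compact_imp_bounded[OF compact_continuous_image[OF assms(2,1)]] by (auto simp: bounded_iff)
  ultimately show ?thesis
    unfolding bounded_multiplier_def
    by (intro conjI exI[of _ C]) (auto simp: space_restrict_space cong: measurable_cong_sets sets_restrict_space_cong)
qed

lemma bounded_multiplier_torus: "continuous_on Pi_cell m \<Longrightarrow> bounded_multiplier (tag_measure TYPE(torus)) m"
  unfolding tag_measure_torus by (rule bounded_multiplier_restrict) (simp_all add: Pi_cell_def)

lemma bounded_multiplier_brillouin: "continuous_on Pi_star m \<Longrightarrow> bounded_multiplier (tag_measure TYPE(brillouin)) m"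
  unfolding tag_measure_brillouin by (rule bounded_multiplier_restrict) (simp_all add: Pi_star_def)

text \<open>The part of e^{i\<theta>(n+y)} that depends on y. It leaves q and p alone, since their
  Bloch transforms carry only the factor e^{i\<theta>n}.\<close>

definition phase :: "real^3 \<Rightarrow> X0_T \<Rightarrow> X0_T" where
  "phase \<theta> = (\<lambda>(\<Psi>\<^sub>1, \<Psi>\<^sub>2, q, p). (mult_L2 (\<lambda>y. cis (\<theta> \<bullet> y)) \<Psi>\<^sub>1, mult_L2 (\<lambda>y. cis (\<theta> \<bullet> y)) \<Psi>\<^sub>2, q, p))"

lemma bounded_multiplier_cis: "bounded_multiplier (tag_measure TYPE(torus)) (\<lambda>y. cis (\<theta> \<bullet> y))"
  by (intro bounded_multiplier_torus continuous_intros)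

lemma phase_add: "phase \<theta> (x + y) = phase \<theta> x + phase \<theta> y"
  by (cases x, cases y) (simp add: phase_def mult_L2_add[OF bounded_multiplier_cis])

lemma phase_scaleC: "phase \<theta> (c *\<^sub>C x) = c *\<^sub>C phase \<theta> x"
  by (cases x) (simp add: phase_def mult_L2_scaleC[OF bounded_multiplier_cis] scaleC_prod_def)

lemma phase_scaleR: "phase \<theta> (r *\<^sub>R x) = r *\<^sub>R phase \<theta> x"
  using phase_scaleC[of \<theta> "complex_of_real r" x] by (simp add: scaleC_of_real)

lemma phase_phase: "phase \<theta> (phase \<eta> x) = phase (\<theta> + \<eta>) x"
  by (cases x) (simp add: phase_def mult_L2_mult[OF bounded_multiplier_cis] cis_mult inner_add_left)

lemma phase_0 [simp]: "phase 0 x = x"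
  by (cases x) (simp add: phase_def mult_L2_const)

lemma inner_phase: "phase \<theta> x \<bullet> y = x \<bullet> phase (- \<theta>) y"
  by (cases x, cases y) (simp add: phase_def inner_mult_L2[OF bounded_multiplier_cis] cis_cnj)

lemma inner_phase_phase: "phase \<theta> x \<bullet> phase \<theta> y = x \<bullet> y"
  by (simp add: inner_phase phase_phase)

lemma norm_phase: "norm (phase \<theta> x) = norm x"
  by (simp add: norm_eq_sqrt_inner inner_phase_phase)

lemma bounded_linear_phase: "bounded_linear (phase \<theta>)"
  by (rule bounded_linear_intro[of _ 1]) (simp_all add: phase_add phase_scaleR norm_phase)

text \<open>The derivative of \<open>phase\<close> at 0 in direction h; it vanishes on q and p, on
  which \<open>phase\<close> is constant.\<close>

definition phase_gen :: "real^3 \<Rightarrow> X0_T \<Rightarrow> X0_T" where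
  "phase_gen h = (\<lambda>(\<Psi>\<^sub>1, \<Psi>\<^sub>2, q, p). (mult_L2 (\<lambda>y. \<i> * of_real (h \<bullet> y)) \<Psi>\<^sub>1, mult_L2 (\<lambda>y. \<i> * of_real (h \<bullet> y)) \<Psi>\<^sub>2, 0, 0))"

lemma bounded_multiplier_gen: "bounded_multiplier (tag_measure TYPE(torus)) (\<lambda>y. \<i> * of_real (h \<bullet> y))"
  by (intro bounded_multiplier_torus continuous_intros)

lemma phase_gen_add: "phase_gen (h + k) x = phase_gen h x + phase_gen k x"
  by (cases x) (simp add: phase_gen_def inner_add_left distrib_left
      mult_L2_plus_multiplier[OF bounded_multiplier_gen bounded_multiplier_gen])

lemma phase_gen_scaleR: "phase_gen (r *\<^sub>R h) x = r *\<^sub>R phase_gen h x"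
proof -
  have "mult_L2 (\<lambda>y. \<i> * of_real ((r *\<^sub>R h) \<bullet> y)) \<Psi> = r *\<^sub>R mult_L2 (\<lambda>y. \<i> * of_real (h \<bullet> y)) \<Psi>" for \<Psi> :: L2_T
    using mult_L2_scale_multiplier[OF bounded_multiplier_gen, of "complex_of_real r" h \<Psi>]
    by (simp add: scaleC_of_real mult_ac)
  then show ?thesis by (cases x) (simp add: phase_gen_def)
qed

lemma norm_X0_T_le: "norm (a :: L2_T, b :: L2_T, 0 :: complex^3, 0 :: complex^3) \<le> norm a + norm b"
  using norm_Pair_le[of a "(b, 0 :: (complex^3) \<times> (complex^3))"] norm_Pair_le[of b "0 :: (complex^3) \<times> (complex^3)"]
  by (simp add: zero_prod_def)

lemma norm_X0_T_ge: "norm \<Psi>\<^sub>1 \<le> norm (\<Psi>\<^sub>1, \<Psi>\<^sub>2, q, p)" "norm \<Psi>\<^sub>2 \<le> norm (\<Psi>\<^sub>1, \<Psi>\<^sub>2, q, p)"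
  for \<Psi>\<^sub>1 \<Psi>\<^sub>2 :: L2_T and q p :: "complex^3"
  using norm_fst_le[of \<Psi>\<^sub>1 "(\<Psi>\<^sub>2, q, p)"] norm_snd_le[of "(\<Psi>\<^sub>2, q, p)" \<Psi>\<^sub>1] norm_fst_le[of \<Psi>\<^sub>2 "(q, p)"]
  by simp_all

text \<open>The crude bound by the sum of the three coordinates. It is the source of the constants 6
  = 2 * 3 and 18 = 2 * 3^2 below, the factor 2 standing for the two function components.\<close>

lemma norm_le_3_cell: "y \<in> Pi_cell \<Longrightarrow> norm y \<le> 3"
proof -
  assume "y \<in> Pi_cell"
  then have "norm y \<le> (\<Sum>i\<in>(UNIV::3 set). 1)"
    by (intro order_trans[OF norm_le_l1_cart] sum_mono) (auto simp: Pi_cell_def mem_box_cart abs_le_iff intro: order_trans[of _ 0])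
  then show ?thesis by simp
qed

lemma norm_phase_gen: "norm (phase_gen h x) \<le> norm h * 6 * norm x"
proof -
  obtain \<Psi>\<^sub>1 \<Psi>\<^sub>2 q p where x: "x = (\<Psi>\<^sub>1, \<Psi>\<^sub>2, q, p)" by (cases x)
  have "norm (mult_L2 (\<lambda>y. \<i> * of_real (h \<bullet> y)) \<Psi>) \<le> (norm h * 3) * norm \<Psi>" for \<Psi> :: L2_T
  proof (rule norm_mult_L2_le[OF bounded_multiplier_gen])
    fix y assume "y \<in> space (tag_measure TYPE(torus))"
    then have "norm y \<le> 3" by (intro norm_le_3_cell) (simp add: tag_measure_torus space_restrict_space)
    then have "norm h * norm y \<le> norm h * 3" by (rule mult_left_mono) simp
    then show "cmod (\<i> * of_real (h \<bullet> y)) \<le> norm h * 3"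
      using Cauchy_Schwarz_ineq2[of h y] by (simp add: norm_mult)
  qed simp
  then have "norm (phase_gen h x) \<le> (norm h * 3) * norm \<Psi>\<^sub>1 + (norm h * 3) * norm \<Psi>\<^sub>2"
    unfolding x phase_gen_def by (auto intro!: order_trans[OF norm_X0_T_le] add_mono)
  also have "\<dots> \<le> (norm h * 3) * norm x + (norm h * 3) * norm x"
    unfolding x by (intro add_mono mult_left_mono norm_X0_T_ge) auto
  finally show ?thesis by (simp add: mult_ac)
qed

lemma bounded_linear_phase_gen: "bounded_linear (phase_gen h)"
proof (rule bounded_linear_intro)
  show "phase_gen h (x + y) = phase_gen h x + phase_gen h y" for x y
    by (cases x, cases y) (simp add: phase_gen_def mult_L2_add[OF bounded_multiplier_gen])
  show "phase_gen h (r *\<^sub>R x) = r *\<^sub>R phase_gen h x" for r x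
    by (cases x) (simp add: phase_gen_def mult_L2_scaleR[OF bounded_multiplier_gen])
  show "norm (phase_gen h x) \<le> norm x * (norm h * 6)" for x
    using norm_phase_gen[of h x] by (simp add: mult_ac)
qed

lemma cmod_cis_minus_1: "cmod (cis t - 1) \<le> \<bar>t\<bar>"
proof -
  have "norm (cis t - cis 0) \<le> 1 * norm (t - 0)"
    by (rule differentiable_bound[of UNIV cis "\<lambda>x t. t *\<^sub>R (\<i> * cis x)"])
      (auto intro!: derivative_eq_intros onorm_le simp: norm_mult)
  then show ?thesis by simp
qed

text \<open>Mean value theorem on the segment from 0 to t, where the derivative has modulus |cis s -
  1| \<le> |s| \<le> |t|.\<close>

lemma cmod_cis_taylor: "cmod (cis t - 1 - \<i> * of_real t) \<le> t\<^sup>2"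
proof -
  let ?S = "closed_segment 0 t"
  have "norm ((cis t - 1 - \<i> * of_real t) - (cis 0 - 1 - \<i> * of_real 0)) \<le> \<bar>t\<bar> * norm (t - 0)"
  proof (rule differentiable_bound[of ?S "\<lambda>s. cis s - 1 - \<i> * of_real s" "\<lambda>s h. h *\<^sub>R (\<i> * cis s - \<i>)"])
    fix s assume s: "s \<in> ?S"
    show "((\<lambda>s. cis s - 1 - \<i> * of_real s) has_derivative (\<lambda>h. h *\<^sub>R (\<i> * cis s - \<i>))) (at s within ?S)"
      by (auto intro!: derivative_eq_intros simp: fun_eq_iff algebra_simps scaleR_conv_of_real)
    have "cmod (\<i> * cis s - \<i>) = cmod (cis s - 1)"
      by (metis mult.right_neutral norm_ii norm_mult mult_1 right_diff_distrib)
    also have "\<dots> \<le> \<bar>t\<bar>"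
      using cmod_cis_minus_1[of s] s by (auto simp: closed_segment_eq_real_ivl split: if_splits)
    finally show "onorm (\<lambda>h. h *\<^sub>R (\<i> * cis s - \<i>)) \<le> \<bar>t\<bar>"
      by (intro onorm_le) (simp add: mult.commute mult_left_mono)
  qed auto
  then show ?thesis by (simp add: power2_eq_square abs_mult_self_eq flip: abs_mult)
qed

lemma phase_taylor: "norm (phase h x - x - phase_gen h x) \<le> 18 * (norm h)\<^sup>2 * norm x"
proof -
  obtain \<Psi>\<^sub>1 \<Psi>\<^sub>2 q p where x: "x = (\<Psi>\<^sub>1, \<Psi>\<^sub>2, q, p)" by (cases x)
  let ?m = "\<lambda>y. cis (h \<bullet> y) - 1 - \<i> * of_real (h \<bullet> y)"
  have bm: "bounded_multiplier (tag_measure TYPE(torus)) (\<lambda>y. cis (h \<bullet> y) - 1)" "bounded_multiplier (tag_measure TYPE(torus)) ?m"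
    by (intro bounded_multiplier_torus continuous_intros)+
  have eq: "mult_L2 (\<lambda>y. cis (h \<bullet> y)) \<Psi> - \<Psi> - mult_L2 (\<lambda>y. \<i> * of_real (h \<bullet> y)) \<Psi> = mult_L2 ?m \<Psi>" for \<Psi> :: L2_T
    using mult_L2_diff_multiplier[OF bm(1) bounded_multiplier_gen, of h \<Psi>]
      mult_L2_diff_multiplier[OF bounded_multiplier_cis bounded_multiplier_const, of h 1 \<Psi>]
    by (simp add: mult_L2_const)
  have le: "norm (mult_L2 ?m \<Psi>) \<le> (9 * (norm h)\<^sup>2) * norm \<Psi>" for \<Psi> :: L2_T
  proof (rule norm_mult_L2_le[OF bm(2)])
    fix y assume "y \<in> space (tag_measure TYPE(torus))"
    then have y: "norm y \<le> 3" by (intro norm_le_3_cell) (simp add: tag_measure_torus space_restrict_space)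
    have "cmod (?m y) \<le> (h \<bullet> y)\<^sup>2" by (rule cmod_cis_taylor)
    also have "\<dots> \<le> (norm h * norm y)\<^sup>2"
      using power_mono[OF Cauchy_Schwarz_ineq2[of h y] abs_ge_zero, of 2] by simp
    also have "\<dots> \<le> (norm h * 3)\<^sup>2"
      using y by (intro power_mono mult_left_mono) auto
    finally show "cmod (?m y) \<le> 9 * (norm h)\<^sup>2" by (simp add: power_mult_distrib)
  qed simp
  have "norm (phase h x - x - phase_gen h x) = norm (mult_L2 ?m \<Psi>\<^sub>1, mult_L2 ?m \<Psi>\<^sub>2, 0 :: complex^3, 0 :: complex^3)"
    by (simp add: x phase_def phase_gen_def eq)
  also have "\<dots> \<le> (9 * (norm h)\<^sup>2) * norm \<Psi>\<^sub>1 + (9 * (norm h)\<^sup>2) * norm \<Psi>\<^sub>2"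
    by (intro order_trans[OF norm_X0_T_le] add_mono le)
  also have "\<dots> \<le> (9 * (norm h)\<^sup>2) * norm x + (9 * (norm h)\<^sup>2) * norm x"
    unfolding x by (intro add_mono mult_left_mono norm_X0_T_ge) auto
  finally show ?thesis by (simp add: mult_ac)
qed

text \<open>Differentiability holds in operator norm because y ranges over a bounded cell, so the
  second order remainder in \<open>phase_taylor\<close> is uniform in x. The group law
  \<open>phase_phase\<close> transports the estimate from 0 to \<theta>.\<close>

lemma phase_blinfun_has_derivative:
  "((\<lambda>\<theta>. Blinfun (phase \<theta>)) has_derivative (\<lambda>h. Blinfun (phase \<theta>) o\<^sub>L Blinfun (phase_gen h))) (at \<theta>)"
proof (rule has_derivativeI_sandwich[of 1])
  have B: "blinfun_apply (Blinfun (phase \<theta>)) = phase \<theta>" "blinfun_apply (Blinfun (phase_gen h)) = phase_gen h" for \<theta> h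
    by (simp_all add: bounded_linear_Blinfun_apply bounded_linear_phase bounded_linear_phase_gen)
  show "bounded_linear (\<lambda>h. Blinfun (phase \<theta>) o\<^sub>L Blinfun (phase_gen h))"
  proof (rule bounded_linear_intro)
    fix h k :: "real^3" and r :: real
    show "Blinfun (phase \<theta>) o\<^sub>L Blinfun (phase_gen (h + k)) =
        (Blinfun (phase \<theta>) o\<^sub>L Blinfun (phase_gen h)) + (Blinfun (phase \<theta>) o\<^sub>L Blinfun (phase_gen k))"
      by (rule blinfun_eqI) (simp add: B phase_gen_add phase_add blinfun.add_left)
    show "Blinfun (phase \<theta>) o\<^sub>L Blinfun (phase_gen (r *\<^sub>R h)) = r *\<^sub>R (Blinfun (phase \<theta>) o\<^sub>L Blinfun (phase_gen h))"
      by (rule blinfun_eqI) (simp add: B phase_gen_scaleR phase_scaleR blinfun.scaleR_left)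
    show "norm (Blinfun (phase \<theta>) o\<^sub>L Blinfun (phase_gen h)) \<le> norm h * 6"
      by (rule norm_blinfun_bound) (simp_all add: B norm_phase norm_phase_gen)
  qed
  show "norm (Blinfun (phase \<eta>) - Blinfun (phase \<theta>) - (Blinfun (phase \<theta>) o\<^sub>L Blinfun (phase_gen (\<eta> - \<theta>)))) / norm (\<eta> - \<theta>)
      \<le> 18 * norm (\<eta> - \<theta>)" if "\<eta> \<in> UNIV" "\<eta> \<noteq> \<theta>" "dist \<eta> \<theta> < 1" for \<eta>
  proof -
    have "norm (Blinfun (phase \<eta>) - Blinfun (phase \<theta>) - (Blinfun (phase \<theta>) o\<^sub>L Blinfun (phase_gen (\<eta> - \<theta>))))
        \<le> 18 * (norm (\<eta> - \<theta>))\<^sup>2"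
    proof (rule norm_blinfun_bound)
      fix x
      have "blinfun_apply (Blinfun (phase \<eta>) - Blinfun (phase \<theta>) - (Blinfun (phase \<theta>) o\<^sub>L Blinfun (phase_gen (\<eta> - \<theta>)))) x
        = phase \<theta> (phase (\<eta> - \<theta>) x - x - phase_gen (\<eta> - \<theta>) x)"
        using linear_diff[OF bounded_linear.linear[OF bounded_linear_phase[of \<theta>]]]
        by (simp add: B blinfun.diff_left phase_phase)
      then show "norm (blinfun_apply (Blinfun (phase \<eta>) - Blinfun (phase \<theta>) - (Blinfun (phase \<theta>) o\<^sub>L Blinfun (phase_gen (\<eta> - \<theta>)))) x)
        \<le> 18 * (norm (\<eta> - \<theta>))\<^sup>2 * norm x"
        by (simp add: norm_phase phase_taylor)
    qed simp
    then show ?thesis using that by (simp add: field_simps power2_eq_square)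
  qed
  show "((\<lambda>\<eta>. 18 * norm (\<eta> - \<theta>)) \<longlongrightarrow> 0) (at \<theta>)"
    by (auto intro!: tendsto_eq_intros)
qed simp

text \<open>By the product rule each partial derivative is again \<open>phase\<close> applied to a
  smooth function, so the induction on k works with F left general. The scalar s stands for the two
  signs 1 and -1.\<close>

lemma smooth_phase:
  assumes "open W" "smooth k F W"
  shows "smooth k (\<lambda>\<theta>. phase (s *\<^sub>R \<theta>) (F \<theta>)) W"
  using assms(2)
proof (induction k arbitrary: F)
  have app: "blinfun_apply (Blinfun (phase \<theta>)) = phase \<theta>" "blinfun_apply (Blinfun (phase_gen h)) = phase_gen h" for \<theta> h
    by (simp_all add: bounded_linear_Blinfun_apply bounded_linear_phase bounded_linear_phase_gen)
  have B: "((\<lambda>\<theta>. Blinfun (phase (s *\<^sub>R \<theta>))) has_derivative (\<lambda>h. Blinfun (phase (s *\<^sub>R \<theta>)) o\<^sub>L Blinfun (phase_gen (s *\<^sub>R h)))) (at \<theta>)" for \<theta>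
    by (rule has_derivative_compose[OF _ phase_blinfun_has_derivative, of "\<lambda>\<theta>. s *\<^sub>R \<theta>" "\<lambda>h. s *\<^sub>R h"]) 
      (auto intro!: derivative_eq_intros)
  {
    case 0
    have "continuous_on W (\<lambda>\<theta>. Blinfun (phase (s *\<^sub>R \<theta>)))"
      by (auto intro!: continuous_at_imp_continuous_on has_derivative_continuous[OF B])
    then have "continuous_on W (\<lambda>\<theta>. blinfun_apply (Blinfun (phase (s *\<^sub>R \<theta>))) (F \<theta>))"
      using 0 by (intro bounded_bilinear.continuous_on[OF bounded_bilinear_blinfun_apply]) auto
    then show ?case by (simp add: app)
  next
    case (Suc k)
    have D: "((\<lambda>\<theta>. phase (s *\<^sub>R \<theta>) (F \<theta>)) has_derivative
        (\<lambda>h. phase (s *\<^sub>R \<theta>) (frechet_derivative F (at \<theta>) h) + phase (s *\<^sub>R \<theta>) (s *\<^sub>R phase_gen h (F \<theta>)))) (at \<theta>)"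
      if "\<theta> \<in> W" for \<theta>
      using bounded_bilinear.FDERIV[OF bounded_bilinear_blinfun_apply B, of F "frechet_derivative F (at \<theta>)" \<theta>] Suc.prems that
      by (simp add: app phase_gen_scaleR flip: frechet_derivative_works)
    have "smooth k (partial i (\<lambda>\<theta>. phase (s *\<^sub>R \<theta>) (F \<theta>))) W" for i
    proof (subst smooth_cong[OF assms(1)])
      show "smooth k (\<lambda>\<theta>. phase (s *\<^sub>R \<theta>) (partial i F \<theta> + s *\<^sub>R phase_gen (axis i 1) (F \<theta>))) W"
        using Suc.prems smooth_Suc_imp[OF Suc.prems]
        by (intro Suc.IH smooth_add[OF assms(1)]
            smooth_linear[OF bounded_linear_compose[OF bounded_linear_scaleR_right bounded_linear_phase_gen] assms(1)]) auto
    qed (use partial_eq[OF D] in \<open>auto simp: partial_def phase_add\<close>)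
    then show ?case using D by (auto simp: differentiable_def)
  }
qed

lemma continuous_on_phase:
  assumes "open W" "continuous_on W F"
  shows "continuous_on W (\<lambda>\<theta>. phase (s *\<^sub>R \<theta>) (F \<theta>))"
  using smooth_phase[of W 0 F s] assms by simp

section \<open>Fourier modes on the Brillouin zone\<close>

text \<open>Lebesgue measure is the image of the product measure over \<open>Basis\<close>, for
  which the integral of a product factorises.\<close>

lemma integral_lborel_prod:
  fixes g :: "'a::euclidean_space \<Rightarrow> real \<Rightarrow> complex"
  assumes "\<And>b. b \<in> Basis \<Longrightarrow> integrable lborel (g b)"
  shows "(\<integral>x. (\<Prod>b\<in>Basis. g b (x \<bullet> b)) \<partial>lborel) = (\<Prod>b\<in>Basis. \<integral>t. g b t \<partial>lborel)"
proof -
  interpret product_sigma_finite "\<lambda>_::'a. lborel :: real measure" ..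
  have gm: "g b \<in> borel_measurable borel" if "b \<in> Basis" for b
    using borel_measurable_integrable[OF assms[OF that]] by simp
  have "(\<integral>x. (\<Prod>b\<in>Basis. g b (x \<bullet> b)) \<partial>lborel)
      = (\<integral>f. (\<Prod>b\<in>Basis. g b ((\<Sum>b\<in>Basis. f b *\<^sub>R b) \<bullet> b)) \<partial>(\<Pi>\<^sub>M b\<in>Basis. lborel))"
    unfolding lborel_eq[where 'a = 'a]
    by (rule integral_distr) (use gm in \<open>auto intro!: borel_measurable_prod measurable_compose[OF _ gm]\<close>)
  also have "\<dots> = (\<integral>f. (\<Prod>b\<in>Basis. g b (f b)) \<partial>(\<Pi>\<^sub>M b\<in>Basis. lborel))"
    by (intro Bochner_Integration.integral_cong refl prod.cong) simp_all
  also have "\<dots> = (\<Prod>b\<in>Basis. \<integral>t. g b t \<partial>lborel)"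
    by (rule product_integral_prod) (use assms in auto)
  finally show ?thesis .
qed

text \<open>The exponential is a product over the coordinates. A coordinate in which k is a nonzero
  integer contributes an integral over full periods, hence a factor 0.\<close>

lemma integral_Pi_star_cis:
  assumes k: "k \<in> Z3" "k \<noteq> 0"
  shows "integral Pi_star (\<lambda>\<theta>. cis (\<theta> \<bullet> k)) = 0"
proof -
  define g where "g b t = indicator {0..2*pi} t *\<^sub>R cis (t * (k \<bullet> b))" for b :: "real^3" and t
  have gi: "integrable lborel (g b)" for b
    unfolding g_def[abs_def] by (rule borel_integrable_compact) (auto intro!: continuous_intros)
  obtain i where i: "k $ i \<noteq> 0" using k(2) by (auto simp: vec_eq_iff)
  have "(\<integral>t. g (axis i 1) t \<partial>lborel) = 0"
  proof -
    let ?\<kappa> = "k $ i"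
    have \<kappa>: "?\<kappa> \<in> \<int>" using k(1) by (simp add: Z3_def)
    have "((\<lambda>t. cis (t * ?\<kappa>)) has_integral (cis (2 * pi * ?\<kappa>) / (\<i> * ?\<kappa>) - cis (0 * ?\<kappa>) / (\<i> * ?\<kappa>))) {0..2*pi}"
      by (rule fundamental_theorem_of_calculus[of 0 "2*pi" "\<lambda>t. cis (t * ?\<kappa>) / (\<i> * ?\<kappa>)"])
        (use i in \<open>auto intro!: derivative_eq_intros simp: has_vector_derivative_def scaleR_conv_of_real fun_eq_iff mult_ac\<close>)
    then have *: "integral {0..2*pi} (\<lambda>t. cis (t * ?\<kappa>)) = 0"
      using \<kappa> by (simp add: integral_unique)
    have "set_integrable lborel {0..2*pi} (\<lambda>t. cis (t * ?\<kappa>))"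
      unfolding set_integrable_def by (rule borel_integrable_compact) (auto intro!: continuous_intros)
    from set_borel_integral_eq_integral(2)[OF this] * show ?thesis
      by (simp add: set_lebesgue_integral_def g_def inner_axis)
  qed
  moreover have "axis i 1 \<in> (Basis :: (real^3) set)" by (simp add: axis_in_Basis_iff)
  ultimately have "(\<Prod>b\<in>Basis. \<integral>t. g b t \<partial>lborel) = 0"
    by (auto intro!: prod_zero)
  then have "(\<integral>\<theta>. (\<Prod>b\<in>Basis. g b (\<theta> \<bullet> b)) \<partial>lborel) = 0"
    by (simp add: integral_lborel_prod gi)
  moreover have "(\<Prod>b\<in>Basis. g b (\<theta> \<bullet> b)) = indicator Pi_star \<theta> *\<^sub>R cis (\<theta> \<bullet> k)" for \<theta>
  proof -
    have one: "(1 :: real^3) \<bullet> b = 1" if "b \<in> Basis" for b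
      using that by (auto simp: Basis_vec_def inner_axis)
    have ind: "(\<Prod>b\<in>Basis. indicator {0..2*pi} (\<theta> \<bullet> b)) = (indicator Pi_star \<theta> :: complex)"
    proof (cases "\<theta> \<in> Pi_star")
      case True
      then have "\<theta> \<bullet> b \<in> {0..2*pi}" if "b \<in> Basis" for b
        using that by (auto simp: Pi_star_def mem_box inner_axis Basis_vec_def)
      then show ?thesis using True by simp
    next
      case False
      then obtain b where b: "b \<in> Basis" "\<not> (0 \<le> \<theta> \<bullet> b \<and> \<theta> \<bullet> b \<le> 2 * pi)"
        using one by (auto simp: Pi_star_def mem_box)
      then have "indicator {0..2*pi} (\<theta> \<bullet> b) = (0 :: complex)" by auto
      then have "(\<Prod>b\<in>Basis. indicator {0..2*pi} (\<theta> \<bullet> b)) = (0 :: complex)"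
        using b(1) by (intro prod_zero) auto
      then show ?thesis using False by simp
    qed
    have "(\<Prod>b\<in>Basis. cis ((\<theta> \<bullet> b) * (k \<bullet> b))) = cis (\<Sum>b\<in>Basis. (\<theta> \<bullet> b) * (k \<bullet> b))" 
      by (induction rule: finite_induct[OF finite_Basis]) (simp_all add: cis_mult)
    then show ?thesis
      by (simp add: g_def scaleR_conv_of_real prod.distrib euclidean_inner[of \<theta> k] of_real_indicator ind)
  qed
  moreover have "set_integrable lborel Pi_star (\<lambda>\<theta>. cis (\<theta> \<bullet> k))"
    unfolding set_integrable_def Pi_star_def by (rule borel_integrable_compact) (auto intro!: continuous_intros)
  ultimately show ?thesis
    using set_borel_integral_eq_integral(2)[of Pi_star "\<lambda>\<theta>. cis (\<theta> \<bullet> k)"]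
    by (simp add: set_lebesgue_integral_def)
qed


lemma to_L2_add:
  fixes f g :: "real^3 \<Rightarrow> 'b::real_inner"
  assumes "square_integrable (tag_measure TYPE('t::measure_tag)) f" "square_integrable (tag_measure TYPE('t)) g"
  shows "(to_L2 (\<lambda>x. f x + g x) :: ('t,'b) L2) = to_L2 f + to_L2 g"
  apply (rule L2_eqI)
  using fun_of_L2_to_L2[OF square_integrable_add[OF assms]] fun_of_L2_to_L2[OF assms(1)]
    fun_of_L2_to_L2[OF assms(2)] fun_of_L2_plus[of "to_L2 f :: ('t,'b) L2" "to_L2 g"]
  by eventually_elim simp

lemma to_L2_scaleC:
  fixes f :: "real^3 \<Rightarrow> 'b::complex_inner"
  assumes "square_integrable (tag_measure TYPE('t::measure_tag)) f"
  shows "(to_L2 (\<lambda>x. c *\<^sub>C f x) :: ('t,'b) L2) = c *\<^sub>C to_L2 f"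
  using mult_L2_to_L2[OF assms, of "\<lambda>_. c"] by (simp add: mult_L2_const)

lemma square_integrable_brillouin:
  fixes f :: "real^3 \<Rightarrow> 'b::real_inner"
  assumes "continuous_on Pi_star f"
  shows "square_integrable (tag_measure TYPE(brillouin)) f"
  unfolding square_integrable_def tag_measure_brillouin
proof
  show "strongly_measurable (restrict_space lborel Pi_star) f"
    using strongly_measurable_continuous_on[OF assms]
    by (subst strongly_measurable_cong_sets[of _ "restrict_space borel Pi_star"]) (simp_all cong: sets_restrict_space_cong)
  have "integrable lborel (\<lambda>\<theta>. indicator Pi_star \<theta> *\<^sub>R (norm (f \<theta>))\<^sup>2)"
    using assms by (intro borel_integrable_compact continuous_intros) (simp_all add: Pi_star_def)
  then show "integrable (restrict_space lborel Pi_star) (\<lambda>\<theta>. (norm (f \<theta>))\<^sup>2)"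
    by (subst integrable_restrict_space) simp_all
qed

lemma integral_brillouin:
  fixes f :: "real^3 \<Rightarrow> real"
  assumes "continuous_on Pi_star f"
  shows "(\<integral>\<theta>. f \<theta> \<partial>tag_measure TYPE(brillouin)) = integral Pi_star f"
proof -
  have "set_integrable lborel Pi_star f"
    unfolding set_integrable_def using assms by (intro borel_integrable_compact) (simp_all add: Pi_star_def)
  from set_borel_integral_eq_integral(2)[OF this] show ?thesis
    unfolding tag_measure_brillouin by (subst integral_restrict_space) (simp_all add: set_lebesgue_integral_def)
qed

text \<open>The n-th term of a Bloch series whose n-th cell is x.\<close>

definition mode :: "real^3 \<Rightarrow> X0_T \<Rightarrow> (brillouin, X0_T) L2" where
  "mode n x = to_L2 (\<lambda>\<theta>. cis (\<theta> \<bullet> n) *\<^sub>C phase \<theta> x)"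

text \<open>The Fourier coefficient with \<open>phase\<close> undone. By \<open>inner_mode\<close>
  it gives the pairing of U with the n-th modes, so dividing by the volume yields the n-th
  cell.\<close>

definition coeff_integral :: "(real^3 \<Rightarrow> X0_T) \<Rightarrow> real^3 \<Rightarrow> X0_T" where
  "coeff_integral U n = integral Pi_star (\<lambda>\<theta>. cis (- (\<theta> \<bullet> n)) *\<^sub>C phase (- \<theta>) (U \<theta>))"

lemma continuous_on_scaleC:
  "continuous_on S f \<Longrightarrow> continuous_on S g \<Longrightarrow> continuous_on S (\<lambda>x. f x *\<^sub>C g x)"
  by (rule bounded_bilinear.continuous_on[OF bounded_bilinear_scaleC])

lemma continuous_on_mode: "continuous_on S (\<lambda>\<theta>. cis (\<theta> \<bullet> n) *\<^sub>C phase \<theta> x)"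
  by (rule continuous_on_subset[of UNIV])
    (use continuous_on_phase[of UNIV "\<lambda>_. x" 1] in \<open>auto intro!: continuous_on_scaleC continuous_intros\<close>)

lemma square_integrable_mode: "square_integrable (tag_measure TYPE(brillouin)) (\<lambda>\<theta>. cis (\<theta> \<bullet> n) *\<^sub>C phase \<theta> x)"
  by (rule square_integrable_brillouin[OF continuous_on_mode])

lemma inner_mode:
  assumes "continuous_on UNIV U"
  shows "mode n x \<bullet> to_L2 U = x \<bullet> coeff_integral U n"
proof -
  let ?V = "\<lambda>\<theta>. cis (- (\<theta> \<bullet> n)) *\<^sub>C phase (- \<theta>) (U \<theta>)"
  have V: "continuous_on UNIV ?V"
    using continuous_on_phase[OF open_UNIV assms, of "-1"] by (auto intro!: continuous_on_scaleC continuous_intros)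
  then have Vc: "continuous_on Pi_star ?V" by (rule continuous_on_subset) simp
  have "mode n x \<bullet> to_L2 U = (\<integral>\<theta>. (cis (\<theta> \<bullet> n) *\<^sub>C phase \<theta> x) \<bullet> U \<theta> \<partial>tag_measure TYPE(brillouin))"
    unfolding mode_def
    by (rule inner_to_L2[OF square_integrable_mode square_integrable_brillouin[OF continuous_on_subset[OF assms]]]) simp
  also have "(\<lambda>\<theta>. (cis (\<theta> \<bullet> n) *\<^sub>C phase \<theta> x) \<bullet> U \<theta>) = (\<lambda>\<theta>. x \<bullet> ?V \<theta>)"
    by (simp add: inner_scaleC_left inner_phase phase_scaleC cis_cnj)
  also have "(\<integral>\<theta>. x \<bullet> ?V \<theta> \<partial>tag_measure TYPE(brillouin)) = integral Pi_star (\<lambda>\<theta>. x \<bullet> ?V \<theta>)"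
    using Vc by (intro integral_brillouin continuous_intros)
  also have "\<dots> = x \<bullet> integral Pi_star ?V"
    using integral_linear[OF integrable_on_Pi_star[OF Vc] bounded_linear_inner_right[of x]] by (simp add: comp_def)
  finally show ?thesis by (simp add: coeff_integral_def)
qed

lemma mode_scaleC: "mode n (c *\<^sub>C x) = c *\<^sub>C mode n x"
proof -
  have "(\<lambda>\<theta>. cis (\<theta> \<bullet> n) *\<^sub>C phase \<theta> (c *\<^sub>C x)) = (\<lambda>\<theta>. c *\<^sub>C (cis (\<theta> \<bullet> n) *\<^sub>C phase \<theta> x))"
    by (simp add: phase_scaleC scaleC_scaleC mult.commute)
  then show ?thesis unfolding mode_def by (simp add: to_L2_scaleC square_integrable_mode)
qed

lemma mode_add: "mode n (x + y) = mode n x + mode n y"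
  unfolding mode_def by (subst to_L2_add[symmetric]) (simp_all add: square_integrable_mode phase_add scaleC_add_right)

definition brillouin_volume :: real where
  "brillouin_volume = measure lborel Pi_star"

lemma brillouin_volume_pos: "brillouin_volume > 0"
  unfolding brillouin_volume_def Pi_star_def
  by (rule content_pos_lt) (auto simp: inner_axis Basis_vec_def)

lemma mode_inner_mode:
  "mode n x \<bullet> mode m y = x \<bullet> (integral Pi_star (\<lambda>\<theta>. cis (\<theta> \<bullet> (m - n))) *\<^sub>C y)"
proof -
  have "mode n x \<bullet> mode m y = x \<bullet> coeff_integral (\<lambda>\<theta>. cis (\<theta> \<bullet> m) *\<^sub>C phase \<theta> y) n"
    unfolding mode_def[of m] by (rule inner_mode[OF continuous_on_mode])
  also have "coeff_integral (\<lambda>\<theta>. cis (\<theta> \<bullet> m) *\<^sub>C phase \<theta> y) n = integral Pi_star (\<lambda>\<theta>. cis (\<theta> \<bullet> (m - n)) *\<^sub>C y)"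
    unfolding coeff_integral_def
    by (simp add: phase_scaleC phase_phase scaleC_scaleC cis_mult inner_diff_right)
  also have "\<dots> = integral Pi_star (\<lambda>\<theta>. cis (\<theta> \<bullet> (m - n))) *\<^sub>C y"
    using integral_linear[OF integrable_on_Pi_star bounded_bilinear.bounded_linear_left[OF bounded_bilinear_scaleC],
        of "\<lambda>\<theta>. cis (\<theta> \<bullet> (m - n))" y]
    by (simp add: comp_def continuous_intros)
  finally show ?thesis .
qed

text \<open>The unitary phases at the same \<theta> cancel in the inner product, and what remains is
  the scalar integral of e^{i\<theta>(m-n)}.\<close>

interpretation modes: orthogonal_family mode Z3 brillouin_volume
proof (rule orthogonal_family.intro)
  show "linear (mode n)" for n
  proof (rule linearI)
    show "mode n (r *\<^sub>R x) = r *\<^sub>R mode n x" for r x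
      using mode_scaleC[of n "complex_of_real r" x] by (simp add: scaleC_of_real)
  qed (rule mode_add)
  show "mode n x \<bullet> mode m y = 0" if "n \<in> Z3" "m \<in> Z3" "n \<noteq> m" for n m x y
  proof -
    have "m - n \<in> Z3" "m - n \<noteq> 0" using that by (auto simp: Z3_def)
    then show ?thesis by (simp add: mode_inner_mode integral_Pi_star_cis)
  qed
  show "mode n x \<bullet> mode n y = brillouin_volume * (x \<bullet> y)" for n x y
    by (simp add: mode_inner_mode brillouin_volume_def Pi_star_def flip: scaleR_conv_of_real)
      (simp add: scaleR_conv_of_real scaleC_of_real)
qed (rule brillouin_volume_pos)

abbreviation mode_closure :: "(brillouin, X0_T) L2 set" where
  "mode_closure \<equiv> closure modes.partial_sums"

section \<open>Multipliers on the closed span of the modes\<close>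

text \<open>Every Bloch transform lies in \<open>mode_closure\<close>
  (\<open>bloch_in_closure\<close>), and the class of a continuous function lying in it is a Bloch
  transform (\<open>bloch_surj\<close>). Invariance of this closed space is thus what keeps a
  multiplied branch vector in the range of the transform.\<close>

definition preserves_modes :: "(real^3 \<Rightarrow> complex) \<Rightarrow> bool" where
  "preserves_modes m \<longleftrightarrow> continuous_on Pi_star m \<and> (\<forall>U\<in>mode_closure. mult_L2 m U \<in> mode_closure)"

text \<open>Multiplication by e^{i\<theta>k} shifts the index of each mode by k, so it permutes the
  finite sums of modes; boundedness extends this to the closure.\<close>

lemma preserves_modes_cis:
  assumes "k \<in> Z3" shows "preserves_modes (\<lambda>\<theta>. cis (\<theta> \<bullet> k))"
proof -
  let ?m = "\<lambda>\<theta>. cis (\<theta> \<bullet> k)"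
  have c: "continuous_on Pi_star ?m" by (intro continuous_intros)
  have shift: "mult_L2 ?m (mode n x) = mode (n + k) x" for n x
    unfolding mode_def mult_L2_to_L2[OF square_integrable_mode]
    by (simp add: scaleC_scaleC cis_mult inner_add_right add.commute)
  have lin: "bounded_linear (mult_L2 ?m :: (brillouin, X0_T) L2 \<Rightarrow> _)"
    by (rule bounded_linear_mult_L2[OF bounded_multiplier_brillouin[OF c]])
  have "mult_L2 ?m U \<in> modes.partial_sums" if "U \<in> modes.partial_sums" for U
  proof -
    from that obtain F x where F: "finite F" "F \<subseteq> Z3" "U = (\<Sum>n\<in>F. mode n (x n))"
      by (auto simp: modes.partial_sums_def)
    have "mult_L2 ?m U = (\<Sum>n\<in>F. mode (n + k) (x n))"
      by (simp add: F(3) linear_sum[OF bounded_linear.linear[OF lin]] shift)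
    also have "\<dots> = (\<Sum>n\<in>(\<lambda>n. n + k) ` F. mode n (x (n - k)))"
      by (subst sum.reindex) (simp_all add: inj_on_def)
    finally show ?thesis
      unfolding modes.partial_sums_def using F assms
      by (intro CollectI exI[of _ "(\<lambda>n. n + k) ` F"] exI[of _ "\<lambda>n. x (n - k)"]) (auto simp: Z3_def)
  qed
  then have "mult_L2 ?m ` mode_closure \<subseteq> mode_closure"
    using closure_bounded_linear_image_subset[OF lin, of modes.partial_sums] closure_mono by blast
  then show ?thesis using c by (auto simp: preserves_modes_def)
qed

lemma preserves_modes_add:
  assumes "preserves_modes m" "preserves_modes m'" shows "preserves_modes (\<lambda>\<theta>. m \<theta> + m' \<theta>)"
proof -
  have "mult_L2 (\<lambda>\<theta>. m \<theta> + m' \<theta>) U = mult_L2 m U + mult_L2 m' U" for U :: "(brillouin, X0_T) L2"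
    using assms by (intro mult_L2_plus_multiplier bounded_multiplier_brillouin) (simp_all add: preserves_modes_def)
  then show ?thesis
    using assms by (auto simp: preserves_modes_def intro!: continuous_on_add modes.closure_partial_sums_add)
qed

lemma preserves_modes_mult:
  assumes "preserves_modes m" "preserves_modes m'" shows "preserves_modes (\<lambda>\<theta>. m \<theta> * m' \<theta>)"
proof -
  have "mult_L2 (\<lambda>\<theta>. m \<theta> * m' \<theta>) U = mult_L2 m (mult_L2 m' U)" for U :: "(brillouin, X0_T) L2"
    using assms by (intro mult_L2_mult[symmetric] bounded_multiplier_brillouin) (simp add: preserves_modes_def)
  then show ?thesis using assms by (auto simp: preserves_modes_def intro!: continuous_on_mult)
qed

lemma preserves_modes_const: "preserves_modes (\<lambda>_. c)"
proof -
  have lin: "bounded_linear (mult_L2 (\<lambda>_. c) :: (brillouin, X0_T) L2 \<Rightarrow> _)"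
    by (rule bounded_linear_mult_L2[OF bounded_multiplier_const])
  have "mult_L2 (\<lambda>_. c) U \<in> modes.partial_sums" if "U \<in> modes.partial_sums" for U
  proof -
    from that obtain F x where F: "finite F" "F \<subseteq> Z3" "U = (\<Sum>n\<in>F. mode n (x n))"
      by (auto simp: modes.partial_sums_def)
    have "mult_L2 (\<lambda>_. c) U = (\<Sum>n\<in>F. mode n (c *\<^sub>C x n))"
      by (simp add: F(3) mult_L2_const mode_scaleC linear_sum[OF bounded_linear.linear[OF bounded_linear_scaleC]])
    then show ?thesis unfolding modes.partial_sums_def using F by auto
  qed
  then have "mult_L2 (\<lambda>_. c) ` mode_closure \<subseteq> mode_closure"
    using closure_bounded_linear_image_subset[OF lin, of modes.partial_sums] closure_mono by blast
  then show ?thesis by (auto simp: preserves_modes_def)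
qed

text \<open>The operator norm of a multiplier is at most its supremum on \<open>Pi_star\<close>, so
  uniform limits of multipliers give norm limits of the products, and the closure absorbs
  them.\<close>

lemma preserves_modes_limit:
  assumes m: "continuous_on Pi_star m"
    and approx: "\<And>e. e > 0 \<Longrightarrow> \<exists>m'. preserves_modes m' \<and> (\<forall>\<theta>\<in>Pi_star. cmod (m \<theta> - m' \<theta>) < e)"
  shows "preserves_modes m"
  unfolding preserves_modes_def
proof (intro conjI ballI m)
  fix U assume U: "U \<in> mode_closure"
  have "mult_L2 m U \<in> closure mode_closure"
    unfolding closure_approachable
  proof (intro allI impI)
    fix e :: real assume e: "e > 0"
    define d where "d = e / (norm U + 1)"
    have d: "d > 0" using e by (simp add: d_def add_nonneg_pos)
    from approx[OF this] obtain m' where m': "preserves_modes m'" "\<And>\<theta>. \<theta> \<in> Pi_star \<Longrightarrow> cmod (m \<theta> - m' \<theta>) < d"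
      by blast
    have bm: "bounded_multiplier (tag_measure TYPE(brillouin)) m" "bounded_multiplier (tag_measure TYPE(brillouin)) m'"
      using m m'(1) by (auto simp: preserves_modes_def intro: bounded_multiplier_brillouin)
    have "norm (mult_L2 m U - mult_L2 m' U) = norm (mult_L2 (\<lambda>\<theta>. m \<theta> - m' \<theta>) U)"
      by (simp add: mult_L2_diff_multiplier[OF bm])
    also have "\<dots> \<le> d * norm U"
      using m'(2) d
      by (intro norm_mult_L2_le[OF bounded_multiplier_diff[OF bm]])
        (auto simp: tag_measure_brillouin space_restrict_space intro: less_imp_le)
    also have "\<dots> < d * (norm U + 1)" using d by simp
    also have "\<dots> = e" by (simp add: d_def add_nonneg_eq_0_iff)
    finally have "dist (mult_L2 m' U) (mult_L2 m U) < e"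
      by (simp add: dist_norm norm_minus_commute)
    moreover have "mult_L2 m' U \<in> mode_closure" using m'(1) U by (simp add: preserves_modes_def)
    ultimately show "\<exists>V\<in>mode_closure. dist V (mult_L2 m U) < e" by blast
  qed
  then show "mult_L2 m U \<in> mode_closure" by simp
qed

definition torus_map :: "real^3 \<Rightarrow> complex^3" where
  "torus_map \<theta> = (\<chi> j. cis (\<theta> $ j))"

lemma preserves_modes_cis_component:
  "preserves_modes (\<lambda>\<theta>. complex_of_real (cos (\<theta> $ j)))" "preserves_modes (\<lambda>\<theta>. complex_of_real (sin (\<theta> $ j)))"
proof -
  have Z: "axis j 1 \<in> Z3" "- axis j 1 \<in> Z3"
    by (auto simp: Z3_def axis_def)
  have 1: "preserves_modes (\<lambda>\<theta>. cis (\<theta> $ j))" and 2: "preserves_modes (\<lambda>\<theta>. cis (- (\<theta> $ j)))"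
    using preserves_modes_cis[OF Z(1)] preserves_modes_cis[OF Z(2)] by (simp_all add: inner_axis)
  have eq: "complex_of_real (cos t) = (1/2) * (cis t + cis (- t))" "complex_of_real (sin t) = (- \<i>/2) * (cis t + (-1) * cis (- t))" for t
    by (simp_all add: complex_eq_iff)
  show "preserves_modes (\<lambda>\<theta>. complex_of_real (cos (\<theta> $ j)))" "preserves_modes (\<lambda>\<theta>. complex_of_real (sin (\<theta> $ j)))"
    unfolding eq by (intro preserves_modes_mult preserves_modes_add preserves_modes_const 1 2)+
qed

text \<open>Real polynomials on C^3 are generated by the real-linear functionals. On the image of
  \<open>torus_map\<close> such a functional is a combination of cosines and sines of the
  coordinates.\<close>

lemma preserves_modes_polynomial:
  "real_polynomial_function g \<Longrightarrow> preserves_modes (\<lambda>\<theta>. complex_of_real (g (torus_map \<theta>)))"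
proof (induction g rule: real_polynomial_function.induct)
  case (linear f)
  interpret bounded_linear f by fact
  have "f (torus_map \<theta>) = (\<Sum>j\<in>UNIV. cos (\<theta> $ j) * f (axis j 1) + sin (\<theta> $ j) * f (axis j \<i>))" for \<theta>
  proof -
    have "torus_map \<theta> = (\<Sum>j\<in>UNIV. cos (\<theta> $ j) *\<^sub>R axis j 1 + sin (\<theta> $ j) *\<^sub>R axis j \<i>)"
    proof (rule vec_eq_iff[THEN iffD2], rule allI)
      fix i
      have "(\<Sum>j\<in>UNIV. cos (\<theta> $ j) *\<^sub>R axis j 1 + sin (\<theta> $ j) *\<^sub>R axis j \<i>) $ i
        = (\<Sum>j\<in>UNIV. if j = i then cis (\<theta> $ i) else 0)"
        unfolding sum_component by (intro sum.cong) (auto simp: axis_def complex_eq_iff)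
      then show "torus_map \<theta> $ i = (\<Sum>j\<in>UNIV. cos (\<theta> $ j) *\<^sub>R axis j 1 + sin (\<theta> $ j) *\<^sub>R axis j \<i>) $ i"
        by (simp add: torus_map_def)
    qed
    then show ?thesis by (simp add: sum add scaleR)
  qed
  moreover have "preserves_modes (\<lambda>\<theta>. \<Sum>j\<in>J. complex_of_real (cos (\<theta> $ j)) * of_real (f (axis j 1)) + complex_of_real (sin (\<theta> $ j)) * of_real (f (axis j \<i>)))"
    if "finite J" for J
    using that
    by (induction J rule: finite_induct)
      (auto intro!: preserves_modes_add preserves_modes_mult preserves_modes_const preserves_modes_cis_component)
  ultimately show ?case using finite_class.finite_UNIV by simp
qed (auto intro: preserves_modes_const preserves_modes_add preserves_modes_mult)

text \<open>A function vanishing on the boundary of the cell descends to the torus, where polynomials in the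
  coordinates $e^{i\theta_j}$ are dense.\<close>

lemma preserves_modes_real:
  fixes m :: "real^3 \<Rightarrow> real"
  assumes m: "continuous_on Pi_star m"
    and bd: "\<And>\<theta> j. \<theta> \<in> Pi_star \<Longrightarrow> \<theta> $ j = 0 \<or> \<theta> $ j = 2 * pi \<Longrightarrow> m \<theta> = 0"
  shows "preserves_modes (\<lambda>\<theta>. complex_of_real (m \<theta>))"
proof (rule preserves_modes_limit)
  show "continuous_on Pi_star (\<lambda>\<theta>. complex_of_real (m \<theta>))" using m by (intro continuous_intros)
  have comp: "compact Pi_star" by (simp add: Pi_star_def)
  have tc: "continuous_on Pi_star torus_map"
    unfolding torus_map_def[abs_def] by (auto simp: continuous_on_vec_lambda intro!: continuous_on_vec_lambda continuous_intros)
  \<comment> \<open>Two points of \<open>Pi_star\<close> over the same torus point differ in a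
    coordinate only by a multiple of 2 pi, so such a coordinate is 0 or 2 pi in both; there m
    vanishes.\<close>
  have inj: "m \<theta> = m \<eta>" if "\<theta> \<in> Pi_star" "\<eta> \<in> Pi_star" "torus_map \<theta> = torus_map \<eta>" for \<theta> \<eta>
  proof (cases "\<theta> = \<eta>")
    case False
    then obtain j where j: "\<theta> $ j \<noteq> \<eta> $ j" by (auto simp: vec_eq_iff)
    have "cis (\<theta> $ j) = cis (\<eta> $ j)" using that(3) by (simp add: torus_map_def vec_eq_iff)
    then have "exp (\<i> * complex_of_real (\<theta> $ j)) = exp (\<i> * complex_of_real (\<eta> $ j))" by (simp add: cis_conv_exp)
    then obtain k :: int where "\<i> * complex_of_real (\<theta> $ j) = \<i> * complex_of_real (\<eta> $ j) + (of_int (2 * k) * pi) * \<i>"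
      unfolding exp_eq by blast
    then have k: "\<theta> $ j = \<eta> $ j + 2 * k * pi"
      by (simp add: complex_eq_iff)
    have r: "0 \<le> \<theta> $ j" "\<theta> $ j \<le> 2 * pi" "0 \<le> \<eta> $ j" "\<eta> $ j \<le> 2 * pi"
      using that(1,2) by (auto simp: Pi_star_def mem_box_cart)
    have "real_of_int k * (2 * pi) \<le> 1 * (2 * pi)" "(-1) * (2 * pi) \<le> real_of_int k * (2 * pi)"
    proof -
      have "\<theta> $ j = \<eta> $ j + real_of_int k * (2 * pi)" using k by simp
      then show "real_of_int k * (2 * pi) \<le> 1 * (2 * pi)" "(-1) * (2 * pi) \<le> real_of_int k * (2 * pi)"
        using r by linarith+
    qed
    then have "real_of_int k \<le> 1" "-1 \<le> real_of_int k"
      using mult_right_le_imp_le[of _ "2 * pi"] pi_gt_zero by (metis mult_pos_pos zero_less_numeral)+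
    then have "k = 1 \<or> k = 0 \<or> k = -1" by linarith
    then have "(\<theta> $ j = 0 \<or> \<theta> $ j = 2 * pi) \<and> (\<eta> $ j = 0 \<or> \<eta> $ j = 2 * pi)"
      using k r j by auto
    then show ?thesis using bd[of \<theta> j] bd[of \<eta> j] that by simp
  qed simp
  \<comment> \<open>The function induced by m on the torus, independent of the chosen preimage by
    \<open>inj\<close>.\<close>
  define H where "H z = m (SOME \<theta>. \<theta> \<in> Pi_star \<and> torus_map \<theta> = z)" for z
  have H: "H (torus_map \<theta>) = m \<theta>" if "\<theta> \<in> Pi_star" for \<theta>
  proof -
    have "\<exists>\<eta>. \<eta> \<in> Pi_star \<and> torus_map \<eta> = torus_map \<theta>" using that by blast
    from someI_ex[OF this] show ?thesis unfolding H_def using inj that by blast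
  qed
  have Hc: "continuous_on (torus_map ` Pi_star) H"
    unfolding continuous_openin_preimage_eq
  proof (intro allI impI)
    fix B :: "real set" assume "open B"
    then have "openin (top_of_set Pi_star) (Pi_star \<inter> m -` B)"
      using m by (simp add: continuous_openin_preimage_eq)
    moreover have "Pi_star \<inter> m -` B = Pi_star \<inter> torus_map -` (torus_map ` Pi_star \<inter> H -` B)"
      by (intro set_eqI) (simp add: H cong: conj_cong)
    \<comment> \<open>Since \<open>Pi_star\<close> is compact, \<open>torus_map\<close> is a
      quotient map onto its image, so openness may be tested on preimages.\<close>
    ultimately show "openin (top_of_set (torus_map ` Pi_star)) (torus_map ` Pi_star \<inter> H -` B)"
      using Abstract_Topology_2.continuous_imp_quotient_map[OF tc refl comp, of "torus_map ` Pi_star \<inter> H -` B"] by auto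
  qed
  fix e :: real assume "e > 0"
  then obtain g where g: "real_polynomial_function g" "\<And>z. z \<in> torus_map ` Pi_star \<Longrightarrow> \<bar>H z - g z\<bar> < e"
    using Stone_Weierstrass_real_polynomial_function[OF compact_continuous_image[OF tc comp] Hc] by blast
  show "\<exists>m'. preserves_modes m' \<and> (\<forall>\<theta>\<in>Pi_star. cmod (complex_of_real (m \<theta>) - m' \<theta>) < e)"
  proof (intro exI conjI ballI)
    show "preserves_modes (\<lambda>\<theta>. complex_of_real (g (torus_map \<theta>)))" by (rule preserves_modes_polynomial[OF g(1)])
    fix \<theta> assume "\<theta> \<in> Pi_star"
    then have "\<bar>m \<theta> - g (torus_map \<theta>)\<bar> < e" using g(2) H by fastforce
    then show "cmod (complex_of_real (m \<theta>) - complex_of_real (g (torus_map \<theta>))) < e"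
      by (metis norm_of_real of_real_diff)
  qed
qed

lemma preserves_modes_complex:
  fixes m :: "real^3 \<Rightarrow> complex"
  assumes m: "continuous_on Pi_star m"
    and bd: "\<And>\<theta> j. \<theta> \<in> Pi_star \<Longrightarrow> \<theta> $ j = 0 \<or> \<theta> $ j = 2 * pi \<Longrightarrow> m \<theta> = 0"
  shows "preserves_modes m"
proof -
  have "preserves_modes (\<lambda>\<theta>. complex_of_real (Re (m \<theta>)) + \<i> * complex_of_real (Im (m \<theta>)))"
    by (intro preserves_modes_add preserves_modes_mult preserves_modes_const preserves_modes_real)
      (use m bd in \<open>auto intro!: continuous_intros\<close>)
  then show ?thesis by (simp add: complex_eq[symmetric])
qed

section \<open>The Bloch transform\<close>

lemma bloch_term_eq: "bloch_term Y n \<theta> = cis (\<theta> \<bullet> n) *\<^sub>C phase \<theta> (cell_of Y n)"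
proof -
  obtain \<Psi>\<^sub>1 \<Psi>\<^sub>2 q p where Y: "Y = (\<Psi>\<^sub>1, \<Psi>\<^sub>2, q, p)" by (cases Y)
  have "to_L2 (\<lambda>y. cis (\<theta> \<bullet> (n + y)) * fun_of_L2 \<Psi> (n + y)) = cis (\<theta> \<bullet> n) *\<^sub>C mult_L2 (\<lambda>y. cis (\<theta> \<bullet> y)) (cell_part \<Psi> n)" for \<Psi>
    unfolding cell_part_def mult_L2_to_L2[OF square_integrable_translate]
      to_L2_scaleC[OF square_integrable_multiplier[OF bounded_multiplier_cis square_integrable_translate], symmetric]
    by (simp add: scaleC_complex_def inner_add_right cis_mult[symmetric] mult.assoc)
  then show ?thesis
    by (simp add: bloch_term_def Y cell_of_eq phase_def scaleC_prod_def)
qed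

text \<open>The terms of the Bloch series are modes with the cells as coefficients, and the cells
  are square summable; convergence is thus that of an orthogonal series.\<close>

lemma bloch_has_sum: "((\<lambda>n. mode n (cell_of Y n)) has_sum bloch Y) Z3"
proof -
  have "to_L2 (bloch_term Y n) = mode n (cell_of Y n)" for n
    by (simp add: mode_def bloch_term_eq[abs_def])
  then show ?thesis
    unfolding bloch_def using has_sum_infsum[OF modes.summable_on_T[OF summable_cell_of[of Y]]] by simp
qed

lemma bloch_eqI:
  assumes "((\<lambda>n. mode n (cell_of Y n)) has_sum U) Z3" shows "bloch Y = U"
  using bloch_has_sum assms by (rule has_sum_unique)

lemma bloch_add: "bloch (Y + Y') = bloch Y + bloch Y'"
  by (rule bloch_eqI, rule has_sum_cong[THEN iffD2, OF _ has_sum_add[OF bloch_has_sum bloch_has_sum]])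
    (simp add: cell_of_add mode_add)

lemma bloch_scaleC: "bloch (c *\<^sub>C Y) = c *\<^sub>C bloch Y"
  by (rule bloch_eqI, rule has_sum_cong[THEN iffD2, OF _ has_sum_bounded_linear[OF bounded_linear_scaleC bloch_has_sum]])
    (simp add: cell_of_scaleC mode_scaleC)

lemma bloch_diff: "bloch (Y - Y') = bloch Y - bloch Y'"
  using bloch_add[of "Y - Y'" Y'] by simp

text \<open>The mode coefficients of a Bloch transform are the cells, so a vanishing transform
  leaves no nonzero cell.\<close>

lemma bloch_inject: "bloch Y = bloch Y' \<Longrightarrow> Y = Y'"
proof -
  assume "bloch Y = bloch Y'"
  then have 0: "bloch (Y - Y') = 0" by (simp add: bloch_diff)
  have "Y - Y' = 0"
  proof (rule cell_of_zero_imp)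
    fix n assume n: "n \<in> Z3"
    have "brillouin_volume * (cell_of (Y - Y') n \<bullet> cell_of (Y - Y') n) = 0"
      using modes.inner_has_sum_T[OF bloch_has_sum n, of "cell_of (Y - Y') n" "Y - Y'"] by (simp add: 0)
    then show "cell_of (Y - Y') n = 0" using brillouin_volume_pos by simp
  qed
  then show ?thesis by simp
qed

lemma bloch_in_closure: "bloch Y \<in> mode_closure"
  by (rule modes.has_sum_in_closure[OF bloch_has_sum])

text \<open>The orthogonal expansion of U has square summable coefficients, which are therefore the
  cells of some Y. The explicit formula for them is what the oscillatory integrals are applied
  to.\<close>

lemma bloch_surj:
  assumes U: "continuous_on UNIV U" and cl: "to_L2 U \<in> mode_closure"
  shows "\<exists>Y. bloch Y = to_L2 U \<and> (\<forall>n\<in>Z3. cell_of Y n = (1 / brillouin_volume) *\<^sub>R coeff_integral U n)"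
proof -
  let ?y = "\<lambda>n. (1 / brillouin_volume) *\<^sub>R coeff_integral U n"
  have "mode n x \<bullet> to_L2 U = brillouin_volume * (x \<bullet> ?y n)" for n x
    using brillouin_volume_pos by (simp add: inner_mode[OF U])
  note e = modes.expansion[OF cl this]
  obtain Y where Y: "\<And>n. n \<in> Z3 \<Longrightarrow> cell_of Y n = ?y n"
    using cell_of_surj[OF e(2)] by blast
  moreover have "bloch Y = to_L2 U"
    by (rule bloch_eqI, rule has_sum_cong[THEN iffD2, OF _ e(1)]) (simp add: Y)
  ultimately show ?thesis by blast
qed

section \<open>The operators\<close>

text \<open>Otherwise the simplifier would break quantifiers over \<open>X0_R3\<close> and
  \<open>X0_T\<close> into four components.\<close>

declare split_paired_Ex [simp del] split_paired_All [simp del]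

lemma adjoint_op_iff: "(x, y) \<in> adjoint_op R \<longleftrightarrow> (\<forall>u v. (u, v) \<in> R \<longrightarrow> cinner v x = cinner u y)"
  by (auto simp: adjoint_op_def)

lemma adjoint_op_add:
  "(x, y) \<in> adjoint_op R \<Longrightarrow> (x', y') \<in> adjoint_op R \<Longrightarrow> (x + x', y + y') \<in> adjoint_op R"
  by (simp add: adjoint_op_iff cinner_add_right)

lemma adjoint_op_scaleC: "(x, y) \<in> adjoint_op R \<Longrightarrow> (c *\<^sub>C x, c *\<^sub>C y) \<in> adjoint_op R"
  by (simp add: adjoint_op_iff cinner_scaleC_right)

lemma selfadjoint_add: "selfadjoint S \<Longrightarrow> (x, y) \<in> S \<Longrightarrow> (x', y') \<in> S \<Longrightarrow> (x + x', y + y') \<in> S"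
  using adjoint_op_add[of x y S x' y'] by (simp add: selfadjoint_def)

lemma selfadjoint_scaleC: "selfadjoint S \<Longrightarrow> (x, y) \<in> S \<Longrightarrow> (c *\<^sub>C x, c *\<^sub>C y) \<in> S"
  using adjoint_op_scaleC[of x y S c] by (simp add: selfadjoint_def)

lemma selfadjoint_symmetric:
  assumes "selfadjoint S" "(x, y) \<in> S" "(u, v) \<in> S"
  shows "cinner v x = cinner u y"
proof -
  have "(x, y) \<in> adjoint_op S" using assms by (simp add: selfadjoint_def)
  then show ?thesis using assms(3) by (simp add: adjoint_op_iff)
qed

text \<open>The dummy value is empty, so a single pair in the graph certifies a genuine square root.
  Every later use of self-adjointness of \<Lambda> starts from such a pair.\<close>

lemma sqrt_op_selfadjoint: "(x, y) \<in> sqrt_op R \<Longrightarrow> selfadjoint (sqrt_op R)"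
proof -
  assume "(x, y) \<in> sqrt_op R"
  then have ex: "\<exists>!S. is_sqrt_op R S" by (auto simp: sqrt_op_def split: if_splits)
  then have "is_sqrt_op R (sqrt_op R)"
    using theI'[OF ex] by (simp add: sqrt_op_def)
  then show ?thesis by (simp add: is_sqrt_op_def)
qed

lemma J_mat_add: "J_mat (x + y) = J_mat x + J_mat y"
  by (cases x, cases y) (simp add: J_mat_def scaleR_add_right)

lemma scaleC_minus_right: "c *\<^sub>C (- x) = - (c *\<^sub>C x)" for x :: "'a::complex_inner"
  by (rule linear_neg[OF bounded_linear.linear[OF bounded_linear_scaleC]])

lemma J_mat_scaleC: "J_mat (c *\<^sub>C x) = c *\<^sub>C J_mat x"
  by (cases x) (simp add: J_mat_def scaleC_prod_def scaleC_scaleR_commute scaleC_minus_right)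

lemma inner_J_mat: "J_mat x \<bullet> y = - (x \<bullet> J_mat y)"
  by (cases x, cases y) (simp add: J_mat_def inner_commute)

text \<open>J is complex linear and antisymmetric, so iJ is symmetric.\<close>

lemma cinner_J_mat: "cinner (\<i> *\<^sub>C J_mat x) y = cinner x (\<i> *\<^sub>C J_mat y)"
proof -
  have "cinner (J_mat x) y = - cinner x (J_mat y)"
    by (simp add: cinner_def complex_eq_iff inner_J_mat flip: J_mat_scaleC)
  then show ?thesis by (simp add: cinner_scaleC_left cinner_scaleC_right)
qed

section \<open>The fibre operators and the resolvent equation\<close>

context
  fixes e M Z\<^sub>0 :: real and \<sigma> :: "real^3 \<Rightarrow> real"
begin

abbreviation Kt :: "real^3 \<Rightarrow> (X0_T \<times> X0_T) set" where
  "Kt \<equiv> K_tilde e M Z\<^sub>0 \<sigma>"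

abbreviation K :: "(X0_R3 \<times> X0_R3) set" where
  "K \<equiv> K_op e M Z\<^sub>0 \<sigma>"

lemma K_tilde_iff:
  "(x, y) \<in> Kt \<theta> \<longleftrightarrow> (\<exists>b. (x, b) \<in> sqrt_op (B_tilde e M Z\<^sub>0 \<sigma> \<theta>) \<and>
      (\<i> *\<^sub>C J_mat b, y) \<in> sqrt_op (B_tilde e M Z\<^sub>0 \<sigma> \<theta>))"
  by (simp add: K_tilde_def Let_def graph_of_def relcomp_unfold)

lemma K_tilde_add:
  assumes "(x, y) \<in> Kt \<theta>" "(x', y') \<in> Kt \<theta>" shows "(x + x', y + y') \<in> Kt \<theta>"
proof -
  from assms obtain b b' where b: "(x, b) \<in> sqrt_op (B_tilde e M Z\<^sub>0 \<sigma> \<theta>)" "(\<i> *\<^sub>C J_mat b, y) \<in> sqrt_op (B_tilde e M Z\<^sub>0 \<sigma> \<theta>)"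
    "(x', b') \<in> sqrt_op (B_tilde e M Z\<^sub>0 \<sigma> \<theta>)" "(\<i> *\<^sub>C J_mat b', y') \<in> sqrt_op (B_tilde e M Z\<^sub>0 \<sigma> \<theta>)"
    by (auto simp: K_tilde_iff)
  note sa = sqrt_op_selfadjoint[OF b(1)]
  show ?thesis
    unfolding K_tilde_iff
    using selfadjoint_add[OF sa b(1,3)] selfadjoint_add[OF sa b(2,4)]
    by (intro exI[of _ "b + b'"]) (simp add: J_mat_add scaleC_add_right)
qed

lemma K_tilde_scaleC:
  assumes "(x, y) \<in> Kt \<theta>" shows "(c *\<^sub>C x, c *\<^sub>C y) \<in> Kt \<theta>"
proof -
  from assms obtain b where b: "(x, b) \<in> sqrt_op (B_tilde e M Z\<^sub>0 \<sigma> \<theta>)" "(\<i> *\<^sub>C J_mat b, y) \<in> sqrt_op (B_tilde e M Z\<^sub>0 \<sigma> \<theta>)"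
    by (auto simp: K_tilde_iff)
  note sa = sqrt_op_selfadjoint[OF b(1)]
  have "c *\<^sub>C \<i> *\<^sub>C J_mat b = \<i> *\<^sub>C J_mat (c *\<^sub>C b)"
    by (simp add: J_mat_scaleC scaleC_scaleC mult.commute)
  then show ?thesis
    unfolding K_tilde_iff
    using selfadjoint_scaleC[OF sa b(1), of c] selfadjoint_scaleC[OF sa b(2), of c]
    by (intro exI[of _ "c *\<^sub>C b"]) simp
qed

lemma K_tilde_symmetric:
  assumes "(x, y) \<in> Kt \<theta>" "(u, v) \<in> Kt \<theta>" shows "cinner v x = cinner u y"
proof -
  from assms obtain b d where b: "(x, b) \<in> sqrt_op (B_tilde e M Z\<^sub>0 \<sigma> \<theta>)" "(\<i> *\<^sub>C J_mat b, y) \<in> sqrt_op (B_tilde e M Z\<^sub>0 \<sigma> \<theta>)"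
    and d: "(u, d) \<in> sqrt_op (B_tilde e M Z\<^sub>0 \<sigma> \<theta>)" "(\<i> *\<^sub>C J_mat d, v) \<in> sqrt_op (B_tilde e M Z\<^sub>0 \<sigma> \<theta>)"
    by (auto simp: K_tilde_iff)
  note sym = selfadjoint_symmetric[OF sqrt_op_selfadjoint[OF b(1)]]
  have "cinner v x = cinner (\<i> *\<^sub>C J_mat d) b" by (rule sym[OF b(1) d(2)])
  also have "\<dots> = cinner d (\<i> *\<^sub>C J_mat b)" by (rule cinner_J_mat)
  also have "\<dots> = cinner u y" by (rule sym[OF b(2) d(1)])
  finally show ?thesis .
qed

text \<open>The difference of two solutions satisfies the eigenvalue equation for the nonreal number
  z, which symmetry allows only for the zero vector.\<close>

lemma K_tilde_injective:
  assumes "(u, v) \<in> Kt \<theta>" "(u', v') \<in> Kt \<theta>" "v - z *\<^sub>C u = v' - z *\<^sub>C u'" "Im z \<noteq> 0"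
  shows "u = u'"
proof -
  have d: "(u - u', v - v') \<in> Kt \<theta>"
    using K_tilde_add[OF assms(1) K_tilde_scaleC[OF assms(2), of "-1"]] by (simp add: scaleC_minus_left)
  have "v - v' = z *\<^sub>C (u - u')"
    using assms(3) by (simp add: scaleC_diff_right algebra_simps)
  then have "cinner (z *\<^sub>C (u - u')) (u - u') = cinner (u - u') (z *\<^sub>C (u - u'))"
    using K_tilde_symmetric[OF d d] by simp
  then have "cnj z * complex_of_real ((norm (u - u'))\<^sup>2) = z * complex_of_real ((norm (u - u'))\<^sup>2)"
    by (simp add: cinner_scaleC_left cinner_scaleC_right cinner_self)
  moreover have "cnj z \<noteq> z" using assms(4) by (auto simp: complex_eq_iff)
  ultimately show "u = u'" by simp
qed

lemma K_op_iff: "(Y, V) \<in> K \<longleftrightarrow>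
    (AE \<theta> in tag_measure TYPE(brillouin). (fun_of_L2 (bloch Y) \<theta>, fun_of_L2 (bloch V) \<theta>) \<in> Kt \<theta>)"
  by (simp add: K_op_def mult_op_def)

lemma K_op_add:
  assumes "(Y, V) \<in> K" "(Y', V') \<in> K" shows "(Y + Y', V + V') \<in> K"
  using assms fun_of_L2_plus[of "bloch Y" "bloch Y'"] fun_of_L2_plus[of "bloch V" "bloch V'"]
  unfolding K_op_iff bloch_add by eventually_elim (simp add: K_tilde_add)

lemma K_op_scaleC:
  assumes "(Y, V) \<in> K" shows "(c *\<^sub>C Y, c *\<^sub>C V) \<in> K"
  using assms fun_of_L2_scaleC[of c "bloch Y"] fun_of_L2_scaleC[of c "bloch V"]
  unfolding K_op_iff bloch_scaleC by eventually_elim (simp add: K_tilde_scaleC)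

text \<open>One element of the graph shows that almost no fibre operator is the dummy one. The pair
  (0, 0) is what is required at those \<theta> where the branch vector is extended by zero.\<close>

lemma K_op_nonempty_zero:
  assumes "K \<noteq> {}" shows "AE \<theta> in tag_measure TYPE(brillouin). (0, 0) \<in> Kt \<theta>"
proof -
  from assms obtain Y V where "(Y, V) \<in> K" by auto
  then show ?thesis
    unfolding K_op_iff by eventually_elim (drule K_tilde_scaleC[where c = 0], simp)
qed

text \<open>A relation rather than the definite description \<open>resolvent\<close>, so that sums
  and multiples of solutions can be formed; \<open>resolvent_eq\<close> converts at the end.\<close>

definition solves :: "complex \<Rightarrow> X0_R3 \<Rightarrow> X0_R3 \<Rightarrow> bool" where
  "solves z Z Y \<longleftrightarrow> (\<exists>V. (Y, V) \<in> K \<and> V - z *\<^sub>C Y = Z)"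

lemma resolvent_eq:
  assumes "solves z Z Y" "Im z \<noteq> 0" shows "resolvent K z Z = Y"
  unfolding resolvent_def
proof (rule the_equality)
  from assms(1) obtain V where V: "(Y, V) \<in> K" "V - z *\<^sub>C Y = Z" by (auto simp: solves_def)
  then show "\<exists>V. (Y, V) \<in> K \<and> V - z *\<^sub>C Y = Z" by blast
  fix Y' assume "\<exists>V. (Y', V) \<in> K \<and> V - z *\<^sub>C Y' = Z"
  then obtain V' where V': "(Y', V') \<in> K" "V' - z *\<^sub>C Y' = Z" by blast
  have b: "bloch V - z *\<^sub>C bloch Y = bloch V' - z *\<^sub>C bloch Y'"
  proof -
    have "bloch (V - z *\<^sub>C Y) = bloch (V' - z *\<^sub>C Y')" by (simp only: V(2) V'(2))
    then show ?thesis by (simp only: bloch_diff bloch_scaleC)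
  qed
  have "AE \<theta> in tag_measure TYPE(brillouin). fun_of_L2 (bloch Y') \<theta> = fun_of_L2 (bloch Y) \<theta>"
    using V(1)[unfolded K_op_iff] V'(1)[unfolded K_op_iff]
      fun_of_L2_diff[of "bloch V" "z *\<^sub>C bloch Y"] fun_of_L2_diff[of "bloch V'" "z *\<^sub>C bloch Y'"]
      fun_of_L2_scaleC[of z "bloch Y"] fun_of_L2_scaleC[of z "bloch Y'"]
  proof eventually_elim
    case (elim \<theta>)
    show ?case
    proof (rule K_tilde_injective[OF elim(2,1) _ assms(2)])
      show "fun_of_L2 (bloch V') \<theta> - z *\<^sub>C fun_of_L2 (bloch Y') \<theta> = fun_of_L2 (bloch V) \<theta> - z *\<^sub>C fun_of_L2 (bloch Y) \<theta>"
        using elim(3)[unfolded b] elim(4-6) by (simp only:)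
    qed
  qed
  then show "Y' = Y" by (intro bloch_inject L2_eqI)
qed

lemma solves_scaleC:
  assumes "solves z Z Y" shows "solves z (c *\<^sub>C Z) (c *\<^sub>C Y)"
proof -
  from assms obtain V where V: "(Y, V) \<in> K" "V - z *\<^sub>C Y = Z" by (auto simp: solves_def)
  have "c *\<^sub>C V - z *\<^sub>C c *\<^sub>C Y = c *\<^sub>C (V - z *\<^sub>C Y)"
    by (simp add: scaleC_diff_right scaleC_scaleC mult.commute)
  then show ?thesis
    unfolding solves_def using V K_op_scaleC[OF V(1)] by (intro exI[of _ "c *\<^sub>C V"]) simp
qed

lemma solves_add:
  assumes "solves z Z Y" "solves z Z' Y'" shows "solves z (Z + Z') (Y + Y')"
proof -
  from assms obtain V V' where "(Y, V) \<in> K" "V - z *\<^sub>C Y = Z" "(Y', V') \<in> K" "V' - z *\<^sub>C Y' = Z'"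
    by (auto simp: solves_def)
  then show ?thesis
    unfolding solves_def by (intro exI[of _ "V + V'"]) (auto simp: K_op_add scaleC_add_right)
qed

lemma solves_zero:
  assumes "K \<noteq> {}" shows "solves z 0 0"
proof -
  obtain Y V where "(Y, V) \<in> K" using assms by auto
  from K_op_scaleC[OF this, of 0] show ?thesis by (auto simp: solves_def)
qed

section \<open>Limiting absorption for branch vectors and their combinations\<close>

text \<open>Everything that the passage to the limit requires of Z, in a form stable under sums and
  multiples, so that it is enough to verify it for a single branch vector. The sign s = 1 or s = -1
  selects the side from which the real axis is approached.\<close>

definition absorption :: "real \<Rightarrow> real \<Rightarrow> X0_R3 \<Rightarrow> (real \<Rightarrow> X0_R3) \<Rightarrow> bool" where
  "absorption s \<omega> Z Y \<longleftrightarrow> (\<forall>\<epsilon>>0. solves (Complex \<omega> (s * \<epsilon>)) Z (Y \<epsilon>)) \<and>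
    (\<exists>C. \<forall>\<epsilon>\<in>{0<..1}. \<forall>n\<in>Z3. norm (cell_of (Y \<epsilon>) n) \<le> C * (1 + norm n)\<^sup>2) \<and>
    (\<forall>n\<in>Z3. \<exists>l. ((\<lambda>\<epsilon>. cell_of (Y \<epsilon>) n) \<longlongrightarrow> l) (at_right 0))"

lemma absorptionD:
  assumes "absorption s \<omega> Z Y"
  shows "\<epsilon> > 0 \<Longrightarrow> solves (Complex \<omega> (s * \<epsilon>)) Z (Y \<epsilon>)"
    and "\<exists>C. \<forall>\<epsilon> n. \<epsilon> \<in> {0<..1} \<longrightarrow> n \<in> Z3 \<longrightarrow> norm (cell_of (Y \<epsilon>) n) \<le> C * (1 + norm n)\<^sup>2"
    and "n \<in> Z3 \<Longrightarrow> \<exists>l. ((\<lambda>\<epsilon>. cell_of (Y \<epsilon>) n) \<longlongrightarrow> l) (at_right 0)"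
  using assms unfolding absorption_def by blast+

lemma cell_of_zero: "n \<in> Z3 \<Longrightarrow> cell_of 0 n = 0"
  using cell_of_scaleC[of n 0 0] by simp

lemma absorption_zero: "K \<noteq> {} \<Longrightarrow> absorption s \<omega> 0 (\<lambda>_. 0)"
  by (auto simp: absorption_def solves_zero cell_of_zero intro: exI[of _ "0::real"] tendsto_const)

lemma absorption_scaleC:
  assumes "absorption s \<omega> Z Y" shows "absorption s \<omega> (c *\<^sub>C Z) (\<lambda>\<epsilon>. c *\<^sub>C Y \<epsilon>)"
  unfolding absorption_def
proof (intro conjI allI impI ballI)
  show "solves (Complex \<omega> (s * \<epsilon>)) (c *\<^sub>C Z) (c *\<^sub>C Y \<epsilon>)" if "\<epsilon> > 0" for \<epsilon>
    using absorptionD(1)[OF assms that] by (rule solves_scaleC)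
  obtain C where C: "\<And>\<epsilon> n. \<epsilon> \<in> {0<..1} \<Longrightarrow> n \<in> Z3 \<Longrightarrow> norm (cell_of (Y \<epsilon>) n) \<le> C * (1 + norm n)\<^sup>2"
    using absorptionD(2)[OF assms] by blast
  show "\<exists>C. \<forall>\<epsilon>\<in>{0<..1}. \<forall>n\<in>Z3. norm (cell_of (c *\<^sub>C Y \<epsilon>) n) \<le> C * (1 + norm n)\<^sup>2"
  proof (intro exI[of _ "cmod c * C"] ballI)
    fix \<epsilon> :: real and n :: "real^3" assume "\<epsilon> \<in> {0<..1}" "n \<in> Z3"
    then show "norm (cell_of (c *\<^sub>C Y \<epsilon>) n) \<le> cmod c * C * (1 + norm n)\<^sup>2"
      using mult_left_mono[OF C, of \<epsilon> n "cmod c"] by (simp add: cell_of_scaleC norm_scaleC mult.assoc)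
  qed
  fix n assume n: "n \<in> Z3"
  from absorptionD(3)[OF assms this] obtain l where "((\<lambda>\<epsilon>. cell_of (Y \<epsilon>) n) \<longlongrightarrow> l) (at_right 0)" by blast
  from bounded_linear.tendsto[OF bounded_linear_scaleC this]
  show "\<exists>l. ((\<lambda>\<epsilon>. cell_of (c *\<^sub>C Y \<epsilon>) n) \<longlongrightarrow> l) (at_right 0)"
    using n by (auto simp: cell_of_scaleC)
qed

lemma absorption_add:
  assumes "absorption s \<omega> Z Y" "absorption s \<omega> Z' Y'" shows "absorption s \<omega> (Z + Z') (\<lambda>\<epsilon>. Y \<epsilon> + Y' \<epsilon>)"
  unfolding absorption_def
proof (intro conjI allI impI ballI)
  show "solves (Complex \<omega> (s * \<epsilon>)) (Z + Z') (Y \<epsilon> + Y' \<epsilon>)" if "\<epsilon> > 0" for \<epsilon>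
    using absorptionD(1)[OF assms(1) that] absorptionD(1)[OF assms(2) that] by (rule solves_add)
  obtain C C' where C: "\<And>\<epsilon> n. \<epsilon> \<in> {0<..1} \<Longrightarrow> n \<in> Z3 \<Longrightarrow> norm (cell_of (Y \<epsilon>) n) \<le> C * (1 + norm n)\<^sup>2"
    "\<And>\<epsilon> n. \<epsilon> \<in> {0<..1} \<Longrightarrow> n \<in> Z3 \<Longrightarrow> norm (cell_of (Y' \<epsilon>) n) \<le> C' * (1 + norm n)\<^sup>2"
    using absorptionD(2)[OF assms(1)] absorptionD(2)[OF assms(2)] by blast
  show "\<exists>C. \<forall>\<epsilon>\<in>{0<..1}. \<forall>n\<in>Z3. norm (cell_of (Y \<epsilon> + Y' \<epsilon>) n) \<le> C * (1 + norm n)\<^sup>2"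
  proof (intro exI[of _ "C + C'"] ballI)
    fix \<epsilon> :: real and n :: "real^3" assume "\<epsilon> \<in> {0<..1}" "n \<in> Z3"
    then show "norm (cell_of (Y \<epsilon> + Y' \<epsilon>) n) \<le> (C + C') * (1 + norm n)\<^sup>2"
      unfolding distrib_right cell_of_add[OF \<open>n \<in> Z3\<close>] by (intro norm_triangle_le add_mono C)
  qed
  fix n assume n: "n \<in> Z3"
  obtain l l' where "((\<lambda>\<epsilon>. cell_of (Y \<epsilon>) n) \<longlongrightarrow> l) (at_right 0)" "((\<lambda>\<epsilon>. cell_of (Y' \<epsilon>) n) \<longlongrightarrow> l') (at_right 0)"
    using absorptionD(3)[OF assms(1) n] absorptionD(3)[OF assms(2) n] by blast
  from tendsto_add[OF this]
  show "\<exists>l. ((\<lambda>\<epsilon>. cell_of (Y \<epsilon> + Y' \<epsilon>) n) \<longlongrightarrow> l) (at_right 0)"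
    using n by (auto simp: cell_of_add)
qed

lemma absorption_sum:
  assumes "K \<noteq> {}" "finite A" "\<And>x. x \<in> A \<Longrightarrow> absorption s \<omega> (Z x) (Y x)"
  shows "absorption s \<omega> (\<Sum>x\<in>A. Z x) (\<lambda>\<epsilon>. \<Sum>x\<in>A. Y x \<epsilon>)"
  using assms(2,3)
  by (induction A rule: finite_induct) (auto intro: absorption_zero[OF assms(1)] absorption_add)

text \<open>The resolvent acts on a branch as multiplication by
  $(\omega_l-\omega\mp i\epsilon)^{-1}=\pm i\,(\epsilon\pm i(\omega_l-\omega))^{-1}$.\<close>

lemma branch_absorption:
  assumes Y\<^sub>0: "Y\<^sub>0 \<in> branch_vectors e M Z\<^sub>0 \<sigma>" and ne: "K \<noteq> {}" and s: "s = 1 \<or> s = -1"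
  shows "\<exists>Y. absorption s \<omega> Y\<^sub>0 Y"
proof -
  obtain W w P D where D: "D \<in> test_functions W" and nb: "nonconstant_branch e M Z\<^sub>0 \<sigma> W w P"
    and bY\<^sub>0: "AE \<theta> in tag_measure TYPE(brillouin). fun_of_L2 (bloch Y\<^sub>0) \<theta> = (if \<theta> \<in> W then blinfun_apply (P \<theta>) (D \<theta>) else 0)"
    using Y\<^sub>0 unfolding branch_vectors_def by blast
  have W: "open W" and WP: "W \<subseteq> Pi_star" using nb by (auto simp: nonconstant_branch_def Pi_star_plus_def)
  define S where "S = closure {\<theta>. D \<theta> \<noteq> 0}"
  have S: "compact S" "S \<subseteq> W" and D0: "D \<theta> = 0" if "\<theta> \<notin> S" for \<theta>
    using D closure_subset[of "{\<theta>. D \<theta> \<noteq> 0}"] that by (auto simp: test_functions_def S_def)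
  have S': "compact S" "S \<subseteq> W" "S \<subseteq> Pi_star" using S WP D by (auto simp: test_functions_def S_def)
  define F where "F \<theta> = blinfun_apply (P \<theta>) (D \<theta>)" for \<theta>
  have F: "cut_smooth W S F"
    unfolding cut_smooth_def
  proof (intro conjI allI impI)
    have "smooth k P W" for k
      using nb by (intro real_analytic_on_imp_smooth) (simp add: nonconstant_branch_def)
    moreover have "smooth k D W" for k
      using D by (intro C_k_imp_smooth) (simp add: test_functions_def)
    ultimately show "smooth k F W" for k
      unfolding F_def[abs_def] by (intro smooth_bilinear[OF bounded_bilinear_blinfun_apply W])
    show "F \<theta> = 0" if "\<theta> \<notin> S" for \<theta> using D0[OF that] by (simp add: F_def)
  qed
  have bF: "AE \<theta> in tag_measure TYPE(brillouin). fun_of_L2 (bloch Y\<^sub>0) \<theta> = F \<theta>"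
    using bY\<^sub>0
  proof eventually_elim
    case (elim \<theta>)
    have "F \<theta> = 0" if "\<theta> \<notin> W"
      using that S'(2) D0[of \<theta>] by (cases "\<theta> \<in> S") (auto simp: F_def)
    then show ?case using elim by (auto simp: F_def)
  qed
  have eig: "(F \<theta>, complex_of_real (w \<theta>) *\<^sub>C F \<theta>) \<in> Kt \<theta>" if "\<theta> \<in> W" for \<theta>
    using nb that by (auto simp: nonconstant_branch_def orthogonal_projection_def eigenspace_def F_def)
  \<comment> \<open>The sign is put into u, so that \<epsilon> + iu has positive real part for both
    choices of s.\<close>
  define u where "u \<theta> = s * (w \<theta> - \<omega>)" for \<theta>
  have w_smooth: "smooth k w W" for k
    using nb by (intro real_analytic_on_imp_smooth) (simp add: nonconstant_branch_def)
  have u_smooth: "smooth k u W" for k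
    unfolding u_def[abs_def] diff_conv_add_uminus
    by (intro smooth_linear[OF bounded_linear_mult_right W] smooth_add[OF W] w_smooth smooth_const)
  have u_grad: "\<exists>i. partial i u \<theta> \<noteq> 0" if "\<theta> \<in> W" for \<theta>
  proof -
    have "gradient w \<theta> \<noteq> 0" using nb that by (simp add: nonconstant_branch_def)
    then obtain i where "partial i w \<theta> \<noteq> 0" by (auto simp: gradient_def vec_eq_iff)
    moreover have "(w has_derivative frechet_derivative w (at \<theta>)) (at \<theta>)"
      using w_smooth[of 1] that by (simp add: frechet_derivative_works)
    then have "(u has_derivative (\<lambda>h. s * frechet_derivative w (at \<theta>) h)) (at \<theta>)"
      unfolding u_def[abs_def] by (auto intro!: derivative_eq_intros)
    then have "partial i u \<theta> = s * partial i w \<theta>"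
      by (subst partial_eq) (auto simp: partial_def)
    ultimately show ?thesis using s by (intro exI[of _ i]) auto
  qed
  \<comment> \<open>The amplitude of the oscillatory integral: it absorbs the inverse phase from
    \<open>coeff_integral\<close> and the constant s i from the multiplier.\<close>
  define G where "G \<theta> = (of_real s * \<i>) *\<^sub>C phase ((-1) *\<^sub>R \<theta>) (F \<theta>)" for \<theta>
  have G: "cut_smooth W S G"
  proof -
    have c: "cut_smooth W S (\<lambda>\<theta>. phase ((-1) *\<^sub>R \<theta>) (F \<theta>))"
      using F smooth_phase[OF W, of _ F "-1"] linear_0[OF bounded_linear.linear[OF bounded_linear_phase]]
      by (auto simp: cut_smooth_def)
    show ?thesis
      unfolding G_def[abs_def]
      by (rule cut_smooth_linear[OF W S' u_smooth _ bounded_linear_scaleC c]) (rule u_grad)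
  qed
  \<comment> \<open>Equal to 1 / (w - \<omega> - i s \<epsilon>), because s i (w - \<omega> - i s
    \<epsilon>) = \<epsilon> + i u.\<close>
  define m where "m \<epsilon> \<theta> = of_real s * \<i> / Complex \<epsilon> (u \<theta>)" for \<epsilon> \<theta>
  have m_cont: "continuous_on W (m \<epsilon>)" if "\<epsilon> > 0" for \<epsilon>
  proof -
    have "Complex \<epsilon> (u \<theta>) \<noteq> 0" for \<theta> using that by (simp add: complex_eq_iff)
    moreover have "continuous_on W (\<lambda>\<theta>. Complex \<epsilon> (u \<theta>))"
      unfolding Complex_eq using smooth_imp_continuous_on[OF u_smooth[of 0]] by (intro continuous_intros)
    ultimately show ?thesis
      unfolding m_def[abs_def] by (intro continuous_on_divide continuous_on_const) auto
  qed
  have m_eq: "m \<epsilon> \<theta> * (complex_of_real (w \<theta>) - Complex \<omega> (s * \<epsilon>)) = 1" if "\<epsilon> > 0" for \<epsilon> \<theta>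
  proof -
    have "Complex \<epsilon> (u \<theta>) \<noteq> 0" using that by (simp add: complex_eq_iff)
    moreover have "of_real s * \<i> * (complex_of_real (w \<theta>) - Complex \<omega> (s * \<epsilon>)) = Complex \<epsilon> (u \<theta>)"
      using s by (auto simp: complex_eq_iff u_def)
    ultimately show ?thesis by (simp add: m_def)
  qed
  define U where "U \<epsilon> \<theta> = m \<epsilon> \<theta> *\<^sub>C F \<theta>" for \<epsilon> \<theta>
  have U_cont: "continuous_on T (U \<epsilon>)" if "\<epsilon> > 0" for \<epsilon> T
    unfolding U_def[abs_def] by (rule continuous_on_cut_smooth[OF W S' u_smooth u_grad m_cont[OF that] F])
  have coeff: "coeff_integral (U \<epsilon>) n = integral Pi_star (\<lambda>\<theta>. (cis (\<theta> \<bullet> (- n)) / Complex \<epsilon> (u \<theta>)) *\<^sub>C G \<theta>)" for \<epsilon> n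
    unfolding coeff_integral_def U_def G_def m_def
    by (simp add: phase_scaleC scaleC_scaleC mult_ac)
  have U_closure: "to_L2 (U \<epsilon>) \<in> mode_closure" if \<epsilon>: "\<epsilon> > 0" for \<epsilon>
  proof -
    \<comment> \<open>The faces of \<open>Pi_star\<close>. As W is open it lies in the interior, so
      S is disjoint from them.\<close>
    define Fr where "Fr = Pi_star \<inter> (\<Union>j. {\<theta>. \<theta> $ j = 0} \<union> {\<theta>. \<theta> $ j = 2 * pi})"
    have "closed ({\<theta> :: real^3. \<theta> $ j = 0} \<union> {\<theta>. \<theta> $ j = 2 * pi})" for j
      by (intro closed_Un closed_Collect_eq continuous_intros)
    then have Fr: "closed Fr"
      unfolding Fr_def Pi_star_def by (intro closed_Int closed_cbox closed_UN) auto
    have "W \<subseteq> interior Pi_star" using W WP by (rule interior_maximal[rotated])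
    then have pos: "0 < \<theta> $ j" "\<theta> $ j < 2 * pi" if "\<theta> \<in> S" for \<theta> j
      using that S'(2) by (auto simp: Pi_star_def interior_cbox mem_box_cart dest!: subsetD)
    have disj: "S \<inter> Fr = {}"
    proof (rule equals0I)
      fix \<theta> assume "\<theta> \<in> S \<inter> Fr"
      then obtain j where "\<theta> \<in> S" "\<theta> $ j = 0 \<or> \<theta> $ j = 2 * pi" by (auto simp: Fr_def)
      then show False using pos[of \<theta> j] by auto
    qed
    \<comment> \<open>The multiplier matters on S only and may be replaced elsewhere. Tietze's
      theorem extends it continuously with value 0 on the faces, as
      \<open>preserves_modes_complex\<close> requires.\<close>
    have "continuous_on (S \<union> Fr) (\<lambda>\<theta>. if \<theta> \<in> S then m \<epsilon> \<theta> else 0)"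
      using disj by (intro continuous_on_cases compact_imp_closed S' Fr continuous_on_const
          continuous_on_subset[OF m_cont[OF \<epsilon>]]) auto
    then obtain g where g: "continuous_on UNIV g" "\<And>\<theta>. \<theta> \<in> S \<union> Fr \<Longrightarrow> g \<theta> = (if \<theta> \<in> S then m \<epsilon> \<theta> else 0)"
      by (rule Tietze_unbounded[where U = UNIV]) (use closed_Un[OF compact_imp_closed[OF S'(1)] Fr] in auto)
    have "preserves_modes g"
    proof (rule preserves_modes_complex)
      show "continuous_on Pi_star g" using g(1) by (rule continuous_on_subset) simp
      fix \<theta> j assume "\<theta> \<in> Pi_star" "\<theta> $ j = 0 \<or> \<theta> $ j = 2 * pi"
      then have "\<theta> \<in> Fr" by (auto simp: Fr_def)
      then show "g \<theta> = 0" using g(2)[of \<theta>] disj by auto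
    qed
    then have "mult_L2 g (bloch Y\<^sub>0) \<in> mode_closure"
      using bloch_in_closure by (simp add: preserves_modes_def)
    moreover have "mult_L2 g (bloch Y\<^sub>0) = to_L2 (U \<epsilon>)"
      unfolding mult_L2_def
    proof (rule to_L2_cong, use bF in eventually_elim)
      case (elim \<theta>)
      then show ?case
        using g(2)[of \<theta>] F by (cases "\<theta> \<in> S") (auto simp: U_def cut_smooth_def)
    qed
    ultimately show ?thesis by simp
  qed
  have "\<exists>Y. bloch Y = to_L2 (U \<epsilon>) \<and> (\<forall>n\<in>Z3. cell_of Y n = (1 / brillouin_volume) *\<^sub>R coeff_integral (U \<epsilon>) n)" if "\<epsilon> > 0" for \<epsilon>
    by (rule bloch_surj[OF U_cont[OF that] U_closure[OF that]])
  then obtain Y where Y: "\<And>\<epsilon>. \<epsilon> > 0 \<Longrightarrow> bloch (Y \<epsilon>) = to_L2 (U \<epsilon>)"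
    "\<And>\<epsilon> n. \<epsilon> > 0 \<Longrightarrow> n \<in> Z3 \<Longrightarrow> cell_of (Y \<epsilon>) n = (1 / brillouin_volume) *\<^sub>R coeff_integral (U \<epsilon>) n"
    by metis
  have sol: "solves (Complex \<omega> (s * \<epsilon>)) Y\<^sub>0 (Y \<epsilon>)" if \<epsilon>: "\<epsilon> > 0" for \<epsilon>
    unfolding solves_def
  proof (intro exI conjI)
    let ?z = "Complex \<omega> (s * \<epsilon>)"
    \<comment> \<open>The image of Y under K is forced by the equation to be
      \<open>Y\<^sub>0 + z Y\<close>.\<close>
    show "Y\<^sub>0 + ?z *\<^sub>C Y \<epsilon> - ?z *\<^sub>C Y \<epsilon> = Y\<^sub>0" by simp
    have "AE \<theta> in tag_measure TYPE(brillouin). fun_of_L2 (bloch (Y \<epsilon>)) \<theta> = U \<epsilon> \<theta>"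
      unfolding Y(1)[OF \<epsilon>] by (rule fun_of_L2_to_L2[OF square_integrable_brillouin[OF U_cont[OF \<epsilon>]]])
    then show "(Y \<epsilon>, Y\<^sub>0 + ?z *\<^sub>C Y \<epsilon>) \<in> K"
      unfolding K_op_iff bloch_add bloch_scaleC
      using bF K_op_nonempty_zero[OF ne] fun_of_L2_plus[of "bloch Y\<^sub>0" "?z *\<^sub>C bloch (Y \<epsilon>)"]
        fun_of_L2_scaleC[of ?z "bloch (Y \<epsilon>)"]
    proof eventually_elim
      case (elim \<theta>)
      show ?case
      proof (cases "\<theta> \<in> W")
        case True
        \<comment> \<open>As m (w - z) = 1, the vector F + z U equals w U, so the pair required is
          the eigenvector pair of F scaled by m.\<close>
        have "F \<theta> + ?z *\<^sub>C U \<epsilon> \<theta> = (m \<epsilon> \<theta> * (complex_of_real (w \<theta>) - ?z)) *\<^sub>C F \<theta> + (?z * m \<epsilon> \<theta>) *\<^sub>C F \<theta>"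
          by (simp add: m_eq[OF \<epsilon>] U_def scaleC_scaleC)
        also have "\<dots> = m \<epsilon> \<theta> *\<^sub>C complex_of_real (w \<theta>) *\<^sub>C F \<theta>"
          by (simp add: scaleC_scaleC algebra_simps flip: scaleC_add_left)
        finally show ?thesis
          using K_tilde_scaleC[OF eig[OF True], of "m \<epsilon> \<theta>"] elim by (simp add: U_def)
      next
        case False
        then have "F \<theta> = 0" using F S'(2) by (auto simp: cut_smooth_def)
        then show ?thesis using elim by (simp add: U_def)
      qed
    qed
  qed
  obtain C where C: "\<And>n \<epsilon>. \<epsilon> \<in> {0<..1} \<Longrightarrow>
      norm (integral Pi_star (\<lambda>\<theta>. (cis (\<theta> \<bullet> n) / Complex \<epsilon> (u \<theta>)) *\<^sub>C G \<theta>)) \<le> C * (1 + norm n)\<^sup>2"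
    using oscillatory_integral(1)[OF W S' u_smooth u_grad G] by blast
  have bound: "norm (cell_of (Y \<epsilon>) n) \<le> (1 / brillouin_volume * C) * (1 + norm n)\<^sup>2" if "\<epsilon> \<in> {0<..1}" "n \<in> Z3" for \<epsilon> n
    using mult_left_mono[OF C[OF that(1), of "- n"], of "1 / brillouin_volume"] that Y(2)[of \<epsilon> n] brillouin_volume_pos
    by (simp add: coeff divide_right_mono)
  have lim: "\<exists>l. ((\<lambda>\<epsilon>. cell_of (Y \<epsilon>) n) \<longlongrightarrow> l) (at_right 0)" if n: "n \<in> Z3" for n
  proof -
    obtain l where "((\<lambda>\<epsilon>. integral Pi_star (\<lambda>\<theta>. (cis (\<theta> \<bullet> (- n)) / Complex \<epsilon> (u \<theta>)) *\<^sub>C G \<theta>)) \<longlongrightarrow> l) (at_right 0)"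
      using oscillatory_integral(2)[OF W S' u_smooth u_grad G] by blast
    from tendsto_scaleR[OF tendsto_const[of "1 / brillouin_volume"] this]
    have "((\<lambda>\<epsilon>. (1 / brillouin_volume) *\<^sub>R coeff_integral (U \<epsilon>) n) \<longlongrightarrow> (1 / brillouin_volume) *\<^sub>R l) (at_right 0)"
      by (simp add: coeff)
    moreover have "\<forall>\<^sub>F \<epsilon> in at_right 0. (1 / brillouin_volume) *\<^sub>R coeff_integral (U \<epsilon>) n = cell_of (Y \<epsilon>) n"
      using eventually_at_right_less[of 0] by eventually_elim (simp add: Y(2) n)
    ultimately have "((\<lambda>\<epsilon>. cell_of (Y \<epsilon>) n) \<longlongrightarrow> (1 / brillouin_volume) *\<^sub>R l) (at_right 0)"
      by (rule Lim_transform_eventually)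
    then show ?thesis by blast
  qed
  show ?thesis
    unfolding absorption_def
    by (intro exI[of _ Y] conjI allI impI ballI sol exI[of _ "1 / brillouin_volume * C"] bound lim)
qed

lemma cspan_branch_absorption:
  assumes Z: "Z \<in> cspan (branch_vectors e M Z\<^sub>0 \<sigma>)" and ne: "K \<noteq> {}" and s: "s = 1 \<or> s = -1"
  shows "\<exists>Y. absorption s \<omega> Z Y"
proof -
  obtain A c where A: "finite A" "A \<subseteq> branch_vectors e M Z\<^sub>0 \<sigma>" "Z = (\<Sum>x\<in>A. c x *\<^sub>C x)"
    using Z by (auto simp: cspan_def)
  have "\<forall>x\<in>A. \<exists>Y. absorption s \<omega> x Y" using branch_absorption[OF _ ne s] A(2) by blast
  then obtain Y where "\<And>x. x \<in> A \<Longrightarrow> absorption s \<omega> x (Y x)" by metis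
  then have "absorption s \<omega> Z (\<lambda>\<epsilon>. \<Sum>x\<in>A. c x *\<^sub>C Y x \<epsilon>)"
    unfolding A(3) by (intro absorption_sum[OF ne A(1)] absorption_scaleC)
  then show ?thesis by blast
qed

end

section \<open>Weighted norms\<close>

lemma summable_on_Ints_powr:
  assumes "q < -1"
  shows "(\<lambda>k::real. (1 + \<bar>k\<bar>) powr q) summable_on \<int>"
proof -
  have "summable (\<lambda>n. real n powr q)" using assms by (simp add: summable_real_powr_iff)
  then have "summable (\<lambda>n. real (Suc n) powr q)" by (subst summable_Suc_iff)
  then have s: "(\<lambda>n. (1 + real n) powr q) summable_on UNIV"
    by (subst summable_on_UNIV_nonneg_real_iff) (auto simp: add.commute)
  have 1: "(\<lambda>k::real. (1 + \<bar>k\<bar>) powr q) summable_on \<nat>"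
    unfolding Nats_def by (subst summable_on_reindex) (use s in \<open>auto simp: comp_def inj_def\<close>)
  have 2: "(\<lambda>k::real. (1 + \<bar>k\<bar>) powr q) summable_on (uminus ` \<nat>)"
    by (subst summable_on_reindex) (use 1 in \<open>auto simp: comp_def\<close>)
  have "\<int> \<subseteq> \<nat> \<union> uminus ` (\<nat> :: real set)"
  proof
    fix x :: real assume "x \<in> \<int>"
    then obtain k where k: "x = of_int k" by (rule Ints_cases)
    show "x \<in> \<nat> \<union> uminus ` \<nat>" by (cases k rule: int_cases2) (auto simp: k)
  qed
  then show ?thesis
    by (rule summable_on_subset_banach[OF summable_on_union[OF 1 2]])
qed

text \<open>Each coordinate is at most the norm in modulus and p is negative, so the weight is at
  most a product of one-dimensional weights with exponent p / 3 < -1.\<close>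

lemma summable_on_Z3_powr:
  assumes "p < -3"
  shows "(\<lambda>n. (1 + norm n) powr p) summable_on Z3"
proof (rule summable_on_comparison_test)
  show "(\<lambda>n::real^3. \<Prod>i\<in>UNIV. (1 + \<bar>n $ i\<bar>) powr (p / 3)) summable_on Z3"
    unfolding Z3_def by (rule summable_on_prod_vec[OF _ summable_on_Ints_powr]) (use assms in auto)
  fix n :: "real^3"
  have "(1 + norm n) powr p = (\<Prod>i\<in>(UNIV::3 set). (1 + norm n) powr (p / 3))"
  proof -
    have "((1 + norm n) powr (p / 3)) ^ 3 = ((1 + norm n) powr (p / 3)) powr (real 3)"
      by (rule powr_realpow[symmetric]) (simp add: add_nonneg_eq_0_iff)
    then show ?thesis by (simp add: powr_powr)
  qed
  also have "\<dots> \<le> (\<Prod>i\<in>UNIV. (1 + \<bar>n $ i\<bar>) powr (p / 3))"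
    using assms by (intro prod_mono conjI powr_mono2') (auto simp: component_le_norm_cart)
  finally show "(1 + norm n) powr p \<le> (\<Prod>i\<in>UNIV. (1 + \<bar>n $ i\<bar>) powr (p / 3))" .
qed simp

text \<open>Dominated convergence for unordered sums along an arbitrary filter: the tail is
  controlled by g, and the finite part tends to 0 termwise.\<close>

lemma infsum_tendsto_0:
  fixes f :: "'b \<Rightarrow> 'a \<Rightarrow> real"
  assumes g: "g summable_on A"
    and le: "\<forall>\<^sub>F t in F. \<forall>n\<in>A. 0 \<le> f t n \<and> f t n \<le> g n"
    and lim: "\<And>n. n \<in> A \<Longrightarrow> ((\<lambda>t. f t n) \<longlongrightarrow> 0) F"
  shows "((\<lambda>t. infsum (f t) A) \<longlongrightarrow> 0) F"
proof (rule tendstoI)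
  fix e :: real assume e: "e > 0"
  have "(sum g \<longlongrightarrow> infsum g A) (finite_subsets_at_top A)"
    using has_sum_infsum[OF g] by (simp add: has_sum_def)
  then have "\<forall>\<^sub>F B in finite_subsets_at_top A. sum g B > infsum g A - e / 2"
    by (rule order_tendstoD) (use e in simp)
  then have "\<exists>B. finite B \<and> B \<subseteq> A \<and> (\<forall>C. finite C \<and> B \<subseteq> C \<and> C \<subseteq> A \<longrightarrow> sum g C > infsum g A - e / 2)"
    by (simp only: eventually_finite_subsets_at_top)
  then obtain B where B: "finite B" "B \<subseteq> A" "sum g B > infsum g A - e / 2" by blast
  have gB: "infsum g A = sum g B + infsum g (A - B)"
    using infsum_Un_disjoint[of g B "A - B"] B g by (simp add: summable_on_subset_banach Un_absorb1)
  have "((\<lambda>t. sum (f t) B) \<longlongrightarrow> (\<Sum>n\<in>B. 0)) F"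
    using B(2) lim by (intro tendsto_sum) auto
  then have "\<forall>\<^sub>F t in F. sum (f t) B < e / 2"
    by (intro order_tendstoD(2)[of _ 0]) (use e in auto)
  with le show "\<forall>\<^sub>F t in F. dist (infsum (f t) A) 0 < e"
  proof eventually_elim
    case (elim t)
    have ft: "f t summable_on A"
      using g by (rule summable_on_comparison_test) (use elim in auto)
    have "infsum (f t) A = sum (f t) B + infsum (f t) (A - B)"
      using infsum_Un_disjoint[of "f t" B "A - B"] B ft by (simp add: summable_on_subset_banach Un_absorb1)
    also have "infsum (f t) (A - B) \<le> infsum g (A - B)"
      by (rule infsum_mono) (use elim g ft in \<open>auto intro: summable_on_subset_banach\<close>)
    also have "infsum g (A - B) < e / 2" using gB B(3) by linarith
    finally have "infsum (f t) A < e" using elim by linarith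
    moreover have "infsum (f t) A \<ge> 0" using elim by (intro infsum_nonneg) auto
    ultimately show ?case by (simp add: dist_real_def)
  qed
qed

text \<open>Squaring the quadratic bound on the cells raises the exponent of the weight to 2
  \<alpha> + 4, and summability over a lattice of dimension three asks for 2 \<alpha> + 4 < -3, that
  is \<alpha> < -7/2.\<close>

lemma weight_summable:
  assumes "\<alpha> < - 7/2" and "\<And>n. n \<in> Z3 \<Longrightarrow> 0 \<le> r n" "\<And>n. n \<in> Z3 \<Longrightarrow> r n \<le> C * (1 + norm n)\<^sup>2"
  shows "(\<lambda>n. C\<^sup>2 * (1 + norm n) powr (2 * \<alpha> + 4)) summable_on Z3"
    and "n \<in> Z3 \<Longrightarrow> (1 + norm n) powr (2 * \<alpha>) * (r n)\<^sup>2 \<le> C\<^sup>2 * (1 + norm n) powr (2 * \<alpha> + 4)"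
proof -
  show "(\<lambda>n. C\<^sup>2 * (1 + norm n) powr (2 * \<alpha> + 4)) summable_on Z3"
    using assms(1) by (intro summable_on_cmult_right summable_on_Z3_powr) simp
  assume n: "n \<in> Z3"
  have "(r n)\<^sup>2 \<le> (C * (1 + norm n)\<^sup>2)\<^sup>2" using assms(2,3) n by (intro power_mono) auto
  also have "\<dots> = C\<^sup>2 * (1 + norm n) powr 4"
    by (subst powr_numeral) (simp_all add: power_mult_distrib flip: power_mult)
  finally have "(1 + norm n) powr (2 * \<alpha>) * (r n)\<^sup>2 \<le> (1 + norm n) powr (2 * \<alpha>) * (C\<^sup>2 * (1 + norm n) powr 4)"
    by (intro mult_left_mono) auto
  also have "\<dots> = C\<^sup>2 * (1 + norm n) powr (2 * \<alpha> + 4)" by (simp add: powr_add)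
  finally show "(1 + norm n) powr (2 * \<alpha>) * (r n)\<^sup>2 \<le> C\<^sup>2 * (1 + norm n) powr (2 * \<alpha> + 4)" .
qed

section \<open>Convergence in the weighted space\<close>

definition glue_quad :: "(real^3 \<Rightarrow> X0_T) \<Rightarrow> quadruple" where
  "glue_quad l = (glue (\<lambda>n. fst (l n)), glue (\<lambda>n. fst (snd (l n))), (\<lambda>n. fst (snd (snd (l n)))), (\<lambda>n. snd (snd (snd (l n)))))"

lemma cell_glue_quad: "n \<in> Z3 \<Longrightarrow> cell (glue_quad l) n = l n"
  by (simp add: glue_quad_def cell_def to_L2_glue)

lemma cell_diff_glue_quad:
  assumes "n \<in> Z3" shows "cell (quad_of Y - glue_quad l) n = cell_of Y n - l n"
proof -
  obtain \<Psi>\<^sub>1 \<Psi>\<^sub>2 q p where Y: "Y = (\<Psi>\<^sub>1, \<Psi>\<^sub>2, q, p)" by (cases Y)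
  have "to_L2 (\<lambda>y. fun_of_L2 \<Psi> (n + y) - glue g (n + y)) = cell_part \<Psi> n - g n" for \<Psi> g
    using to_L2_diff[OF square_integrable_translate square_integrable_glue_translate[OF assms], of \<Psi> n g]
    by (simp add: cell_part_def to_L2_glue[OF assms])
  then show ?thesis
    by (simp add: Y quad_of_def glue_quad_def cell_def cell_of_eq fun_diff_def prod_eq_iff)
qed

text \<open>For \<alpha> \<le> 0 the weight is at most 1. This serves the degenerate case of an
  empty K, where the value of \<open>resolvent\<close> is one unspecified element of
  X^0(R^3).\<close>

lemma quad_of_in_X_weighted:
  assumes "\<alpha> \<le> 0" shows "quad_of Y \<in> X_weighted \<alpha>"
proof -
  obtain \<Psi>\<^sub>1 \<Psi>\<^sub>2 q p where Y: "Y = (\<Psi>\<^sub>1, \<Psi>\<^sub>2, q, p)" by (cases Y)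
  have "(\<lambda>n. (1 + norm n) powr (2 * \<alpha>) * (norm (cell (quad_of Y) n))\<^sup>2) summable_on Z3"
  proof (rule summable_on_comparison_test[OF summable_cell_of[of Y]])
    fix n :: "real^3"
    have "(1 + norm n) powr (2 * \<alpha>) \<le> 1"
      using powr_mono[of "2 * \<alpha>" 0 "1 + norm n"] assms by (simp add: add_nonneg_eq_0_iff)
    then show "(1 + norm n) powr (2 * \<alpha>) * (norm (cell (quad_of Y) n))\<^sup>2 \<le> (norm (cell_of Y n))\<^sup>2"
      by (simp add: cell_of_def mult_left_le_one_le)
  qed simp
  then show ?thesis
    by (auto simp: X_weighted_def Y quad_of_def square_integrable_translate)
qed

lemma norm_weighted_zero: "norm_weighted \<alpha> (Y - Y) = 0"
proof -
  obtain \<Psi>\<^sub>1 \<Psi>\<^sub>2 q p where Y: "Y = (\<Psi>\<^sub>1, \<Psi>\<^sub>2, q, p)" by (cases Y)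
  have "cell (Y - Y) n = 0" for n
    by (simp add: Y cell_def fun_diff_def zero_prod_def zero_L2_def[symmetric])
  then show ?thesis by (simp add: norm_weighted_def)
qed

text \<open>L is glued from the limits of the cells. These inherit the quadratic bound, so the
  squared differences are dominated by a summable weight independent of \<epsilon>.\<close>

lemma resolvent_limit:
  assumes abs: "absorption e M Z\<^sub>0 \<sigma> s \<omega> Z Y" and s: "s = 1 \<or> s = -1" and \<alpha>: "\<alpha> < - 7/2"
  shows "\<exists>L \<in> X_weighted \<alpha>.
      ((\<lambda>\<epsilon>. norm_weighted \<alpha> (quad_of (resolvent (K_op e M Z\<^sub>0 \<sigma>) (Complex \<omega> (s * \<epsilon>)) Z) - L)) \<longlongrightarrow> 0) (at_right 0)"
proof -
  have sol: "resolvent (K_op e M Z\<^sub>0 \<sigma>) (Complex \<omega> (s * \<epsilon>)) Z = Y \<epsilon>" if "\<epsilon> > 0" for \<epsilon>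
    using absorptionD(1)[OF abs that] by (rule resolvent_eq) (use that s in auto)
  obtain C where C: "\<And>\<epsilon> n. \<epsilon> \<in> {0<..1} \<Longrightarrow> n \<in> Z3 \<Longrightarrow> norm (cell_of (Y \<epsilon>) n) \<le> C * (1 + norm n)\<^sup>2"
    using absorptionD(2)[OF abs] by blast
  obtain l where l: "\<And>n. n \<in> Z3 \<Longrightarrow> ((\<lambda>\<epsilon>. cell_of (Y \<epsilon>) n) \<longlongrightarrow> l n) (at_right 0)"
    using absorptionD(3)[OF abs] by metis
  have small: "\<forall>\<^sub>F \<epsilon>::real in at_right 0. \<epsilon> \<in> {0<..1}"
    by (auto simp: eventually_at_right_field intro!: exI[of _ 1])
  have l_bound: "norm (l n) \<le> C * (1 + norm n)\<^sup>2" if n: "n \<in> Z3" for n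
    using small by (intro tendsto_upperbound[OF tendsto_norm[OF l[OF n]]]) (auto elim!: eventually_mono simp: C n)
  let ?w = "\<lambda>n::real^3. (1 + norm n) powr (2 * \<alpha>)"
  \<comment> \<open>The factor 2 accounts for a difference of two cells, each bounded with the
    constant C.\<close>
  let ?g = "\<lambda>n::real^3. (2 * C)\<^sup>2 * (1 + norm n) powr (2 * \<alpha> + 4)"
  note wl = weight_summable[OF \<alpha>, of "\<lambda>n. norm (l n)" C, OF _ l_bound]
  show ?thesis
  proof
    have "(\<lambda>n. ?w n * (norm (l n))\<^sup>2) summable_on Z3"
      by (rule summable_on_comparison_test[OF wl(1)]) (use wl(2) in auto)
    then have "(\<lambda>n. ?w n * (norm (cell (glue_quad l) n))\<^sup>2) summable_on Z3"
      by (rule summable_on_cong[THEN iffD1, rotated]) (simp add: cell_glue_quad)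
    then show "glue_quad l \<in> X_weighted \<alpha>"
      by (auto simp: X_weighted_def glue_quad_def square_integrable_glue_translate)
    have "((\<lambda>\<epsilon>. \<Sum>\<^sub>\<infinity>n\<in>Z3. ?w n * (norm (cell_of (Y \<epsilon>) n - l n))\<^sup>2) \<longlongrightarrow> 0) (at_right 0)"
    proof (rule infsum_tendsto_0)
      show "?g summable_on Z3"
        \<comment> \<open>Summability concerns the majorant alone, so the zero family can stand in
          for the cells.\<close>
        by (rule weight_summable(1)[OF \<alpha>, of "\<lambda>_. 0"]) (use order_trans[OF norm_ge_zero l_bound] in auto)
      show "\<forall>\<^sub>F \<epsilon> in at_right 0. \<forall>n\<in>Z3. 0 \<le> ?w n * (norm (cell_of (Y \<epsilon>) n - l n))\<^sup>2 \<and>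
          ?w n * (norm (cell_of (Y \<epsilon>) n - l n))\<^sup>2 \<le> ?g n"
        using small
      proof eventually_elim
        case (elim \<epsilon>)
        have "norm (cell_of (Y \<epsilon>) n - l n) \<le> 2 * C * (1 + norm n)\<^sup>2" if "n \<in> Z3" for n
          using norm_triangle_ineq4[of "cell_of (Y \<epsilon>) n" "l n"] C[OF elim that] l_bound[OF that] by linarith
        then show ?case
          using weight_summable(2)[OF \<alpha>, of "\<lambda>n. norm (cell_of (Y \<epsilon>) n - l n)" "2 * C"] by auto
      qed
      show "((\<lambda>\<epsilon>. ?w n * (norm (cell_of (Y \<epsilon>) n - l n))\<^sup>2) \<longlongrightarrow> 0) (at_right 0)" if "n \<in> Z3" for n
      proof -
        have "((\<lambda>\<epsilon>. ?w n * (norm (cell_of (Y \<epsilon>) n - l n))\<^sup>2) \<longlongrightarrow> ?w n * (norm (l n - l n))\<^sup>2) (at_right 0)"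
          by (intro tendsto_intros l that)
        then show ?thesis by simp
      qed
    qed
    then have "((\<lambda>\<epsilon>. sqrt (\<Sum>\<^sub>\<infinity>n\<in>Z3. ?w n * (norm (cell_of (Y \<epsilon>) n - l n))\<^sup>2)) \<longlongrightarrow> sqrt 0) (at_right 0)"
      by (rule tendsto_real_sqrt)
    moreover have "norm_weighted \<alpha> (quad_of (Y \<epsilon>) - glue_quad l) = sqrt (\<Sum>\<^sub>\<infinity>n\<in>Z3. ?w n * (norm (cell_of (Y \<epsilon>) n - l n))\<^sup>2)" for \<epsilon>
      unfolding norm_weighted_def
      by (rule arg_cong[where f = sqrt], rule infsum_cong) (simp add: cell_diff_glue_quad)
    ultimately have lim: "((\<lambda>\<epsilon>. norm_weighted \<alpha> (quad_of (Y \<epsilon>) - glue_quad l)) \<longlongrightarrow> 0) (at_right 0)" by simp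
    show "((\<lambda>\<epsilon>. norm_weighted \<alpha> (quad_of (resolvent (K_op e M Z\<^sub>0 \<sigma>) (Complex \<omega> (s * \<epsilon>)) Z) - glue_quad l)) \<longlongrightarrow> 0) (at_right 0)"
    proof (rule Lim_transform_eventually[OF lim])
      show "\<forall>\<^sub>F \<epsilon> in at_right 0. norm_weighted \<alpha> (quad_of (Y \<epsilon>) - glue_quad l) =
          norm_weighted \<alpha> (quad_of (resolvent (K_op e M Z\<^sub>0 \<sigma>) (Complex \<omega> (s * \<epsilon>)) Z) - glue_quad l)"
        using eventually_at_right_less[of 0] by eventually_elim (simp add: sol)
    qed
  qed
qed

theorem lemma5p5:
  fixes e M Z\<^sub>0 :: real and \<sigma> :: "real^3 \<Rightarrow> real" and Z :: X0_R3 and \<omega> \<alpha> :: real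
  assumes "e > 0" and "M > 0" and "Z\<^sub>0 > 0"
    and "integrable lebesgue \<sigma>" and "(\<integral>x. \<sigma> x \<partial>lebesgue) = e * Z\<^sub>0"
    and "laplace_minus_one_L1 \<sigma>"
    and "\<exists>C>0. \<exists>\<epsilon>>0. \<forall>x. \<bar>\<sigma> x\<bar> \<le> C * exp (- \<epsilon> * norm x)"
    and Wiener: "AE \<theta> in lebesgue. \<theta> \<in> Pi_star - Gamma_star \<longrightarrow> pos_def (Sigma_mat \<sigma> \<theta>)"
    and Jellium: "\<forall>m \<in> Z3 - {0}. fourier \<sigma> ((2 * pi) *\<^sub>R m) = 0"
    and "Z \<in> orth_compl (discrete_subspace (K_op e M Z\<^sub>0 \<sigma>))"
    and "Z \<in> cspan (branch_vectors e M Z\<^sub>0 \<sigma>)"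
    and "\<alpha> < - 7/2"
  shows "(\<exists>L \<in> X_weighted \<alpha>.
      ((\<lambda>\<epsilon>. norm_weighted \<alpha> (quad_of (resolvent (K_op e M Z\<^sub>0 \<sigma>) (Complex \<omega> \<epsilon>) Z) - L))
        \<longlongrightarrow> 0) (at_right 0)) \<and>
    (\<exists>L \<in> X_weighted \<alpha>.
      ((\<lambda>\<epsilon>. norm_weighted \<alpha> (quad_of (resolvent (K_op e M Z\<^sub>0 \<sigma>) (Complex \<omega> (- \<epsilon>)) Z) - L))
        \<longlongrightarrow> 0) (at_right 0))"
proof (cases "K_op e M Z\<^sub>0 \<sigma> = {}")
  case True
  \<comment> \<open>Only if \<^const>\<open>sqrt_op\<close> took its dummy value on a set of positive measure; the resolvent is then
    a junk value independent of \<open>z\<close>.\<close>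
  then have "resolvent (K_op e M Z\<^sub>0 \<sigma>) z Z = (THE Y. False)" for z
    by (simp add: resolvent_def)
  moreover have "quad_of (THE Y. False) \<in> X_weighted \<alpha>"
    using assms(12) by (intro quad_of_in_X_weighted) simp
  ultimately show ?thesis
    by (auto simp: norm_weighted_zero intro!: bexI[of _ "quad_of (THE Y. False)"])
next
  case False
  obtain Y where "absorption e M Z\<^sub>0 \<sigma> 1 \<omega> Z Y"
    using cspan_branch_absorption[OF assms(11) False, of 1] by auto
  moreover obtain Y' where "absorption e M Z\<^sub>0 \<sigma> (-1) \<omega> Z Y'"
    using cspan_branch_absorption[OF assms(11) False, of "-1"] by auto
  ultimately show ?thesis
    using resolvent_limit[OF _ _ assms(12), of e M Z\<^sub>0 \<sigma> 1] resolvent_limit[OF _ _ assms(12), of e M Z\<^sub>0 \<sigma> "-1"]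
    by simp
qed

end
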